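(* Let $(X,d,m)$ be a homogeneous ultrametric measure space, $L$ a homogeneous hierarchical Laplacian on it, $\mathcal{H}$ a horocycle, $\sigma:\mathcal{H}\to\mathbb{R}$ a function, $V=\sum_{B\in\mathcal{H}}\sigma(B)1_B$, and $H=L+V$. Let $\mathfrak{S}_{\mathcal{H}}$ be the common spectrum of the operators $L_B$, $B\in\mathcal{H}$, and let $\mathfrak{R}_V=\{\sigma(B):B\in\mathcal{H}\}$ be the range of $V$. Then $$\mathrm{Spec}(H_-)=\overline{\mathfrak{S}_{\mathcal{H}}+\mathfrak{R}_V}.$$ In particular, the operator $H_-$ has a pure point (not necessarily discrete) spectrum.
   Context: Homogeneous ultrametric measure space: $(X,d)$ is a non-compact ultrametric space ($d(x,y)\le\max\{d(x,z),d(z,y)\}$) in which every closed ball $B_r(x)=\{y:d(x,y)\le r\}$ is compact and whose isometry group acts transitively; $m$ is a Radon measure on $X$ with full support, invariant under all isometries, normalized so that $m(B)=\mathrm{diam}(B)$ for every ball $B$ of positive diameter. $\mathcal{B}$ is the family of all distinct balls $B_r(x)$ with $r>0$, and $\mathcal{B}(x)$ the family of those containing $x$. $\mathcal{D}$ is the set of locally constant functions with compact support. Homogeneous hierarchical Laplacian: let $C:\mathcal{B}\to(0,\infty)$ satisfy $C(A)=C(B)$ whenever $A,B$ have the same diameter, and $\lambda(B):=\sum_{T\in\mathcal{B},\,B\subseteq T}C(T)<\infty$ for all $B$. For $f\in\mathcal{D}$, $$Lf(x)=\sum_{B\in\mathcal{B}(x)}C(B)\Big(f(x)-\frac1{m(B)}\int_B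 f\,dm\Big).$$ $L$ and $H=L+V$ are essentially self-adjoint on $\mathcal{D}$ in $L^2(X,m)$; the same letters denote their closures. A horocycle $\mathcal{H}\subset\mathcal{B}$ is the family of all balls of $\mathcal{B}$ having one fixed common diameter; it is a partition of $X$. For $T\in\mathcal{B}$ let $T'$ denote the smallest ball of $\mathcal{B}$ strictly containing $T$, and $f_T=\frac{1_T}{m(T)}-\frac{1_{T'}}{m(T')}$. With closed linear spans in $L^2(X,m)$: $\mathcal{L}_+=\mathrm{span}\{1_B:B\in\mathcal{H}\}$; $\mathcal{L}_B=\mathrm{span}\{f_T:T\in\mathcal{B},\ T\subsetneq B\}$ for $B\in\mathcal{H}$; $\mathcal{L}_-=L^2(X,m)\ominus\mathcal{L}_+=\bigoplus_{B\in\mathcal{H}}\mathcal{L}_B$. These subspaces are invariant for $L$ and $H$. $L_B$ is the restriction of $L$ to $\mathcal{L}_B$ and $H_-$ the restriction of $H$ to $\mathcal{L}_-$. By homogeneity, $\mathrm{Spec}(L_B)$ is the same set for all $B\in\mathcal{H}$. $\mathfrak{S}_{\mathcal{H}}+\mathfrak{R}_V$ is the set of sums $s+r$ with $s\in\mathfrak{S}_{\mathcal{H}}$, $r\in\mathfrak{R}_V$; the bar denotes closure in $\mathbb{R}$. A self-adjoint operator has pure point spectrum if the Hilbert space has an orthonormal basis of its eigenvectors. *)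

theory Defs
  imports "HOL-Analysis.Analysis"
begin

section \<open>Homogeneous ultrametric measure spaces\<close>

definition isometries :: "('a::metric_space \<Rightarrow> 'a) set" where
  "isometries = {g. bij g \<and> (\<forall>x y. dist (g x) (g y) = dist x y)}"

text \<open>Balls are sets: equal balls with different centres or radii are identified.\<close>

definition balls :: "'a::metric_space set set" where
  "balls = {cball x r | x r. r > 0}"

definition radon_measure :: "'a::metric_space measure \<Rightarrow> bool" where
  "radon_measure m \<longleftrightarrow>
     sets m = sets borel \<and>
     (\<forall>K. compact K \<longrightarrow> emeasure m K < \<infinity>) \<and>
     (\<forall>A\<in>sets borel. emeasure m A = (SUP K \<in> {K. compact K \<and> K \<subseteq> A}. emeasure m K))"

text \<open>The space \<open>X\<close> is the whole type \<open>'a\<close>.\<close>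

locale homogeneous_ultrametric_measure_space =
  fixes m :: "'a::metric_space measure"
  assumes ultrametric: "\<And>x y z :: 'a. dist x y \<le> max (dist x z) (dist z y)"
    and noncompact: "\<not> compact (UNIV :: 'a set)"
    and compact_balls: "\<And>(x::'a) r. compact (cball x r)"
    and transitive: "\<And>x y :: 'a. \<exists>g\<in>isometries. g x = y"
    and radon: "radon_measure m"
    and full_support: "\<And>U. open U \<Longrightarrow> U \<noteq> {} \<Longrightarrow> emeasure m U > 0"
    and invariant: "\<And>g A. g \<in> isometries \<Longrightarrow> A \<in> sets borel \<Longrightarrow> emeasure m (g ` A) = emeasure m A"
    and normalized: "\<And>B. B \<in> balls \<Longrightarrow> diameter B > 0 \<Longrightarrow> emeasure m B = ennreal (diameter B)"

definition horocycle :: "'a::metric_space set set \<Rightarrow> bool" where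
  "horocycle \<H> \<longleftrightarrow> (\<exists>B\<in>(balls :: 'a set set). \<H> = {A\<in>balls. diameter A = diameter B})"

text \<open>The ball \<open>T'\<close>.\<close>

definition parent :: "'a::metric_space set \<Rightarrow> 'a set" where
  "parent T = (THE S. S \<in> balls \<and> T \<subset> S \<and> (\<forall>U\<in>balls. T \<subset> U \<longrightarrow> S \<subseteq> U))"


section \<open>The Hilbert space of square integrable complex functions\<close>

text \<open>
  Elements of \<open>L\<^sup>2(X,m)\<close> are represented by functions, and almost everywhere equal functions are
  not identified. All subspaces and closed operators below are saturated with respect to almost
  everywhere equality.
\<close>

definition L2 :: "'a measure \<Rightarrow> ('a \<Rightarrow> complex) set" where
  "L2 m = {f \<in> borel_measurable m. integrable m (\<lambda>x. (cmod (f x))\<^sup>2)}"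

definition L2_inner :: "'a measure \<Rightarrow> ('a \<Rightarrow> complex) \<Rightarrow> ('a \<Rightarrow> complex) \<Rightarrow> complex" where
  "L2_inner m f g = (LINT x|m. f x * cnj (g x))"

definition L2_norm :: "'a measure \<Rightarrow> ('a \<Rightarrow> complex) \<Rightarrow> real" where
  "L2_norm m f = sqrt (LINT x|m. (cmod (f x))\<^sup>2)"

definition lin_span :: "('a \<Rightarrow> complex) set \<Rightarrow> ('a \<Rightarrow> complex) set" where
  "lin_span S = {\<lambda>x. \<Sum>u\<in>F. c u * u x | F c. finite F \<and> F \<subseteq> S}"

definition closed_span :: "'a measure \<Rightarrow> ('a \<Rightarrow> complex) set \<Rightarrow> ('a \<Rightarrow> complex) set" where
  "closed_span m S =
     {f \<in> L2 m. \<forall>e>0. \<exists>g \<in> L2 m \<inter> lin_span S. L2_norm m (\<lambda>x. f x - g x) < e}"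

definition orth_complement :: "'a measure \<Rightarrow> ('a \<Rightarrow> complex) set \<Rightarrow> ('a \<Rightarrow> complex) set" where
  "orth_complement m M = {f \<in> L2 m. \<forall>g\<in>M. L2_inner m f g = 0}"


section \<open>Unbounded operators, given by their graphs\<close>

type_synonym 'a operator = "(('a \<Rightarrow> complex) \<times> ('a \<Rightarrow> complex)) set"

definition op_closure :: "'a measure \<Rightarrow> 'a operator \<Rightarrow> 'a operator" where
  "op_closure m A =
     {(f, g). f \<in> L2 m \<and> g \<in> L2 m \<and>
        (\<forall>e>0. \<exists>(f', g') \<in> A.
           L2_norm m (\<lambda>x. f x - f' x) < e \<and> L2_norm m (\<lambda>x. g x - g' x) < e)}"

definition op_restrict :: "'a operator \<Rightarrow> ('a \<Rightarrow> complex) set \<Rightarrow> 'a operator" where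
  "op_restrict A M = {(f, g) \<in> A. f \<in> M}"

text \<open>
  \<open>z\<close> is in the resolvent set of the operator \<open>A\<close> in the closed subspace \<open>M\<close> iff \<open>A - z\<close> maps the
  domain of \<open>A\<close> bijectively onto \<open>M\<close> with bounded inverse. Injectivity and boundedness of the inverse
  are together the estimate in the last line.
\<close>

definition resolvent_set :: "'a measure \<Rightarrow> ('a \<Rightarrow> complex) set \<Rightarrow> 'a operator \<Rightarrow> complex set" where
  "resolvent_set m M A =
     {z. (\<forall>(f, g) \<in> A. f \<in> M \<and> (\<lambda>x. g x - z * f x) \<in> M) \<and>
         (\<forall>h\<in>M. \<exists>(f, g) \<in> A. AE x in m. g x - z * f x = h x) \<and>
         (\<exists>K. \<forall>(f, g) \<in> A. L2_norm m f \<le> K * L2_norm m (\<lambda>x. g x - z * f x))}"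

definition spectrum :: "'a measure \<Rightarrow> ('a \<Rightarrow> complex) set \<Rightarrow> 'a operator \<Rightarrow> complex set" where
  "spectrum m M A = - resolvent_set m M A"

definition self_adjoint :: "'a measure \<Rightarrow> ('a \<Rightarrow> complex) set \<Rightarrow> 'a operator \<Rightarrow> bool" where
  "self_adjoint m M A \<longleftrightarrow>
     A \<subseteq> M \<times> M \<and> closed_span m (Domain A) = M \<and>
     A = {(u, v). u \<in> M \<and> v \<in> M \<and> (\<forall>(f, g) \<in> A. L2_inner m g u = L2_inner m f v)}"

definition orthonormal_basis :: "'a measure \<Rightarrow> ('a \<Rightarrow> complex) set \<Rightarrow> ('a \<Rightarrow> complex) set \<Rightarrow> bool" where
  "orthonormal_basis m M E \<longleftrightarrow>
     E \<subseteq> M \<and> (\<forall>u\<in>E. \<forall>v\<in>E. L2_inner m u v = (if u = v then 1 else 0)) \<and> closed_span m E = M"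

definition pure_point_spectrum :: "'a measure \<Rightarrow> ('a \<Rightarrow> complex) set \<Rightarrow> 'a operator \<Rightarrow> bool" where
  "pure_point_spectrum m M A \<longleftrightarrow>
     self_adjoint m M A \<and>
     (\<exists>E. orthonormal_basis m M E \<and> (\<forall>u\<in>E. \<exists>z. (u, \<lambda>x. z * u x) \<in> A))"


section \<open>Hierarchical Laplacians and Schroedinger operators\<close>

text \<open>Only the values of \<open>C\<close> on balls are relevant.\<close>

definition homogeneous_choice_function :: "('a::metric_space set \<Rightarrow> real) \<Rightarrow> bool" where
  "homogeneous_choice_function C \<longleftrightarrow>
     (\<forall>B\<in>balls. C B > 0) \<and>
     (\<forall>A\<in>balls. \<forall>B\<in>balls. diameter A = diameter B \<longrightarrow> C A = C B) \<and>
     (\<forall>B\<in>balls. C summable_on {T\<in>balls. B \<subseteq> T})"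

definition test_functions :: "('a::metric_space \<Rightarrow> complex) set" where
  "test_functions =
     {f. (\<forall>x. \<exists>U. open U \<and> x \<in> U \<and> f constant_on U) \<and> compact (closure {x. f x \<noteq> 0})}"

definition hier_laplacian ::
    "'a::metric_space measure \<Rightarrow> ('a set \<Rightarrow> real) \<Rightarrow> ('a \<Rightarrow> complex) \<Rightarrow> 'a \<Rightarrow> complex" where
  "hier_laplacian m C f x =
     (\<Sum>\<^sub>\<infinity>B\<in>{B\<in>balls. x \<in> B}.
        of_real (C B) * (f x - of_real (1 / measure m B) * (LINT y:B|m. f y)))"

definition laplacian_op :: "'a::metric_space measure \<Rightarrow> ('a set \<Rightarrow> real) \<Rightarrow> 'a operator" where
  "laplacian_op m C = op_closure m {(f, hier_laplacian m C f) | f. f \<in> test_functions}"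

definition schroedinger_op ::
    "'a::metric_space measure \<Rightarrow> ('a set \<Rightarrow> real) \<Rightarrow> ('a \<Rightarrow> real) \<Rightarrow> 'a operator" where
  "schroedinger_op m C V =
     op_closure m {(f, \<lambda>x. hier_laplacian m C f x + of_real (V x) * f x) | f. f \<in> test_functions}"

text \<open>Since \<open>\<H>\<close> is a partition of the space, exactly one summand can be nonzero at each point.\<close>

definition horocycle_potential :: "'a set set \<Rightarrow> ('a set \<Rightarrow> real) \<Rightarrow> 'a \<Rightarrow> real" where
  "horocycle_potential \<H> \<sigma> x = (\<Sum>\<^sub>\<infinity>B\<in>\<H>. \<sigma> B * indicator B x)"

definition ball_difference :: "'a::metric_space measure \<Rightarrow> 'a set \<Rightarrow> 'a \<Rightarrow> complex" where
  "ball_difference m T x =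
     indicator T x / of_real (measure m T) - indicator (parent T) x / of_real (measure m (parent T))"

definition L_plus :: "'a measure \<Rightarrow> 'a set set \<Rightarrow> ('a \<Rightarrow> complex) set" where
  "L_plus m \<H> = closed_span m {indicator B | B. B \<in> \<H>}"

definition L_minus :: "'a measure \<Rightarrow> 'a set set \<Rightarrow> ('a \<Rightarrow> complex) set" where
  "L_minus m \<H> = orth_complement m (L_plus m \<H>)"

definition L_ball :: "'a::metric_space measure \<Rightarrow> 'a set \<Rightarrow> ('a \<Rightarrow> complex) set" where
  "L_ball m B = closed_span m {ball_difference m T | T. T \<in> balls \<and> T \<subset> B}"

definition laplacian_ball ::
    "'a::metric_space measure \<Rightarrow> ('a set \<Rightarrow> real) \<Rightarrow> 'a set \<Rightarrow> 'a operator" where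
  "laplacian_ball m C B = op_restrict (laplacian_op m C) (L_ball m B)"

definition schroedinger_minus ::
    "'a::metric_space measure \<Rightarrow> ('a set \<Rightarrow> real) \<Rightarrow> 'a set set \<Rightarrow> ('a set \<Rightarrow> real) \<Rightarrow> 'a operator" where
  "schroedinger_minus m C \<H> \<sigma> =
     op_restrict (schroedinger_op m C (horocycle_potential \<H> \<sigma>)) (L_minus m \<H>)"

end

theory Submission
  imports Defs
begin

text \<open>
  The operator \<open>H\<^sub>-\<close> is diagonal in an orthonormal basis of compactly supported eigenfunctions. For a ball \<open>T\<close>
  with parent \<open>T'\<close>, the function \<open>f\<^sub>T\<close> is an eigenfunction of the Laplacian with eigenvalue \<open>\<lambda>(T')\<close>: the balls
  disjoint from \<open>T'\<close> or inside a child of \<open>T'\<close> see a constant function, and on each of the balls \<open>U\<close> that contain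
  \<open>T'\<close> the mean value of \<open>f\<^sub>T\<close> is zero, so that \<open>U\<close> contributes \<open>C(U) f\<^sub>T\<close>. If \<open>T'\<close> lies in a ball \<open>B\<close> of the
  horocycle, then \<open>V\<close> is the constant \<open>\<sigma>(B)\<close> on the support of \<open>f\<^sub>T\<close>, and \<open>f\<^sub>T\<close> is an eigenfunction of \<open>H\<close> with
  eigenvalue \<open>\<lambda>(T') + \<sigma>(B)\<close>. Functions \<open>f\<^sub>T\<close> with different parents are orthogonal, and those with the same
  parent, which are finitely many, share the eigenvalue; so an orthonormal basis of eigenfunctions arises by
  orthonormalizing the \<open>f\<^sub>T\<close> parent by parent.

  By homogeneity an isometry moves any ball of the horocycle to any other and preserves \<open>\<lambda>\<close>. Hence the set
  \<open>\<Lambda>\<close> of the numbers \<open>\<lambda>(S)\<close>, where \<open>S\<close> runs over the balls of positive diameter inside \<open>B\<close>, does not depend on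
  \<open>B\<close>. The spectrum of a diagonal operator is the closure of its set of eigenvalues, which gives
  \<open>Spec(L\<^sub>B) = closure \<Lambda>\<close> and \<open>Spec(H\<^sub>-) = closure (\<Lambda> + range V)\<close>, and the latter is the closure of
  \<open>closure \<Lambda> + range V\<close>.

  The analytic content is that the operators, which are closures of operators on test functions, really are
  these diagonal operators, with their maximal domains. This is \<open>restricted_closure_diagonal\<close>, an abstract
  statement about a symmetric operator with eigenvectors in its domain, applied in \<open>diagonalization\<close>. Its
  hypotheses are that the Laplacian maps test functions to square integrable functions
  (\<open>hier_laplacian_indicator_L2\<close>) and is symmetric on them (\<open>hier_laplacian_indicator_symmetric\<close>), and that the
  eigenfunctions together with indicators of some balls are total (\<open>orthogonal_to_small_balls_imp_zero\<close> and
  \<open>orthogonal_below_ball\<close>). The Hilbert space facts behind it rest on the completeness of \<open>L\<^sup>2\<close>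
  (\<open>L2_complete\<close>).
\<close>

section \<open>Square integrable functions as a Hilbert space\<close>

lemma L2D:
  assumes "f \<in> L2 m"
  shows "f \<in> borel_measurable m" "integrable m (\<lambda>x. (cmod (f x))\<^sup>2)"
  using assms by (auto simp: L2_def)

lemma L2_bound:
  assumes f: "f \<in> L2 m" and g: "g \<in> L2 m" and h: "h \<in> borel_measurable m"
    and le: "\<And>x. (cmod (h x))\<^sup>2 \<le> a * (cmod (f x))\<^sup>2 + b * (cmod (g x))\<^sup>2"
  shows "h \<in> L2 m"
proof -
  have "integrable m (\<lambda>x. a * (cmod (f x))\<^sup>2 + b * (cmod (g x))\<^sup>2)"
    using L2D[OF f] L2D[OF g] by auto
  then have "integrable m (\<lambda>x. (cmod (h x))\<^sup>2)"
    by (rule Bochner_Integration.integrable_bound)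
       (use h le in \<open>auto intro!: AE_I2 intro: order_trans[OF _ abs_ge_self]\<close>)
  with h show ?thesis by (auto simp: L2_def)
qed

lemma L2_add:
  assumes f: "f \<in> L2 m" and g: "g \<in> L2 m"
  shows "(\<lambda>x. f x + g x) \<in> L2 m"
proof (rule L2_bound[OF f g, of _ 2 2])
  show "(\<lambda>x. f x + g x) \<in> borel_measurable m"
    using L2D[OF f] L2D[OF g] by auto
  fix x
  have "(cmod (f x + g x))\<^sup>2 \<le> (cmod (f x) + cmod (g x))\<^sup>2"
    by (intro power_mono norm_triangle_ineq) auto
  also have "\<dots> \<le> 2 * (cmod (f x))\<^sup>2 + 2 * (cmod (g x))\<^sup>2"
    using sum_squares_bound[of "cmod (f x)" "cmod (g x)"] by (simp add: power2_sum)
  finally show "(cmod (f x + g x))\<^sup>2 \<le> 2 * (cmod (f x))\<^sup>2 + 2 * (cmod (g x))\<^sup>2" .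
qed

lemma L2_cmult:
  assumes f: "f \<in> L2 m"
  shows "(\<lambda>x. c * f x) \<in> L2 m"
proof (rule L2_bound[OF f f, of _ "(cmod c)\<^sup>2" 0])
  show "(\<lambda>x. c * f x) \<in> borel_measurable m"
    using L2D[OF f] by auto
qed (auto simp: norm_mult power_mult_distrib)

lemma L2_diff:
  assumes "f \<in> L2 m" "g \<in> L2 m"
  shows "(\<lambda>x. f x - g x) \<in> L2 m"
  using L2_add[OF assms(1) L2_cmult[OF assms(2), of "-1"]] by simp

lemma L2_zero: "(\<lambda>x. 0) \<in> L2 m"
  by (auto simp: L2_def)

lemma L2_sum:
  assumes "\<And>i. i \<in> I \<Longrightarrow> f i \<in> L2 m"
  shows "(\<lambda>x. \<Sum>i\<in>I. f i x) \<in> L2 m"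
  using assms
proof (induction I rule: infinite_finite_induct)
  case (insert i I)
  then show ?case using L2_add[of "f i" m "\<lambda>x. \<Sum>i\<in>I. f i x"] by auto
qed (auto simp: L2_zero)

lemma borel_measurable_cnj':
  assumes "g \<in> borel_measurable m"
  shows "(\<lambda>x. cnj (g x)) \<in> borel_measurable m"
  using measurable_compose[OF assms borel_measurable_continuous_onI[OF continuous_on_cnj[OF continuous_on_id]]]
  by simp

lemma L2_inner_integrable:
  assumes f: "f \<in> L2 m" and g: "g \<in> L2 m"
  shows "integrable m (\<lambda>x. f x * cnj (g x))"
proof -
  have m: "(\<lambda>x. f x * cnj (g x)) \<in> borel_measurable m"
    using borel_measurable_times[OF L2D(1)[OF f] borel_measurable_cnj'[OF L2D(1)[OF g]]] .
  have "integrable m (\<lambda>x. (cmod (f x))\<^sup>2 + (cmod (g x))\<^sup>2)"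
    using L2D[OF f] L2D[OF g] by auto
  then show ?thesis
  proof (rule Bochner_Integration.integrable_bound[OF _ m], intro AE_I2)
    fix x
    have "0 \<le> cmod (f x) * cmod (g x)" by simp
    then have "cmod (f x) * cmod (g x) \<le> (cmod (f x))\<^sup>2 + (cmod (g x))\<^sup>2"
      using sum_squares_bound[of "cmod (f x)" "cmod (g x)"] by linarith
    then show "cmod (f x * cnj (g x)) \<le> norm ((cmod (f x))\<^sup>2 + (cmod (g x))\<^sup>2)"
      by (simp add: norm_mult)
  qed
qed

lemma L2_inner_add_left:
  assumes "f \<in> L2 m" "g \<in> L2 m" "h \<in> L2 m"
  shows "L2_inner m (\<lambda>x. f x + g x) h = L2_inner m f h + L2_inner m g h"
  using L2_inner_integrable[OF assms(1,3)] L2_inner_integrable[OF assms(2,3)]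
  by (simp add: L2_inner_def distrib_right)

lemma L2_inner_diff_left:
  assumes "f \<in> L2 m" "g \<in> L2 m" "h \<in> L2 m"
  shows "L2_inner m (\<lambda>x. f x - g x) h = L2_inner m f h - L2_inner m g h"
  using L2_inner_integrable[OF assms(1,3)] L2_inner_integrable[OF assms(2,3)]
  by (simp add: L2_inner_def left_diff_distrib)

lemma L2_inner_cmult_left: "L2_inner m (\<lambda>x. c * f x) h = c * L2_inner m f h"
  by (simp add: L2_inner_def mult.assoc)

lemma L2_inner_commute: "L2_inner m f g = cnj (L2_inner m g f)"
  unfolding L2_inner_def by (subst Bochner_Integration.integral_cnj[symmetric]) (simp add: mult.commute)

lemma L2_inner_sum_left:
  assumes "\<And>i. i \<in> I \<Longrightarrow> f i \<in> L2 m" "h \<in> L2 m"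
  shows "L2_inner m (\<lambda>x. \<Sum>i\<in>I. f i x) h = (\<Sum>i\<in>I. L2_inner m (f i) h)"
  using assms L2_inner_integrable[of _ m h]
  by (simp add: L2_inner_def sum_distrib_right)

lemma L2_inner_add_right:
  assumes "f \<in> L2 m" "g \<in> L2 m" "h \<in> L2 m"
  shows "L2_inner m h (\<lambda>x. f x + g x) = L2_inner m h f + L2_inner m h g"
  using L2_inner_add_left[OF assms] by (metis L2_inner_commute complex_cnj_add)

lemma L2_inner_diff_right:
  assumes "f \<in> L2 m" "g \<in> L2 m" "h \<in> L2 m"
  shows "L2_inner m h (\<lambda>x. f x - g x) = L2_inner m h f - L2_inner m h g"
  using L2_inner_diff_left[OF assms] by (metis L2_inner_commute complex_cnj_diff)

lemma L2_inner_cmult_right: "L2_inner m h (\<lambda>x. c * f x) = cnj c * L2_inner m h f"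
  by (metis L2_inner_cmult_left L2_inner_commute complex_cnj_mult)

lemma L2_inner_sum_right:
  assumes "\<And>i. i \<in> I \<Longrightarrow> f i \<in> L2 m" "h \<in> L2 m"
  shows "L2_inner m h (\<lambda>x. \<Sum>i\<in>I. f i x) = (\<Sum>i\<in>I. L2_inner m h (f i))"
proof -
  have l: "L2_inner m (\<lambda>x. \<Sum>i\<in>I. f i x) h = (\<Sum>i\<in>I. L2_inner m (f i) h)"
    by (rule L2_inner_sum_left) (use assms in auto)
  have "L2_inner m h (\<lambda>x. \<Sum>i\<in>I. f i x) = cnj (\<Sum>i\<in>I. L2_inner m (f i) h)"
    unfolding l[symmetric] by (rule L2_inner_commute)
  also have "\<dots> = (\<Sum>i\<in>I. L2_inner m h (f i))"
    unfolding cnj_sum by (intro sum.cong refl L2_inner_commute[symmetric])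
  finally show ?thesis .
qed

lemma L2_inner_self: "L2_inner m f f = of_real ((L2_norm m f)\<^sup>2)"
proof -
  have "L2_inner m f f = (LINT x|m. complex_of_real ((cmod (f x))\<^sup>2))"
    unfolding L2_inner_def complex_norm_square by simp
  also have "\<dots> = of_real (LINT x|m. (cmod (f x))\<^sup>2)"
    by (rule integral_complex_of_real)
  finally show ?thesis by (simp add: L2_norm_def)
qed

lemma L2_norm_nonneg [simp]: "0 \<le> L2_norm m f"
  by (simp add: L2_norm_def)

lemma L2_norm_zero [simp]: "L2_norm m (\<lambda>x. 0) = 0"
  by (simp add: L2_norm_def)

lemma L2_norm_cmult: "L2_norm m (\<lambda>x. c * f x) = cmod c * L2_norm m f"
  by (simp add: L2_norm_def norm_mult power_mult_distrib real_sqrt_mult)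

lemma L2_norm_minus_commute: "L2_norm m (\<lambda>x. f x - g x) = L2_norm m (\<lambda>x. g x - f x)"
  by (simp add: L2_norm_def norm_minus_commute)

lemma L2_norm_eq_0_iff:
  assumes "f \<in> L2 m"
  shows "L2_norm m f = 0 \<longleftrightarrow> (AE x in m. f x = 0)"
  using integral_nonneg_eq_0_iff_AE[OF L2D(2)[OF assms]] by (simp add: L2_norm_def)

lemma L2_norm_diff_square:
  assumes "f \<in> L2 m" "g \<in> L2 m"
  shows "(L2_norm m (\<lambda>x. f x - g x))\<^sup>2 =
    (L2_norm m f)\<^sup>2 - 2 * Re (L2_inner m f g) + (L2_norm m g)\<^sup>2"
proof -
  have "complex_of_real ((L2_norm m (\<lambda>x. f x - g x))\<^sup>2) =
     L2_inner m f f - L2_inner m f g - (L2_inner m g f - L2_inner m g g)"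
    unfolding L2_inner_self[symmetric]
    by (simp add: L2_inner_diff_left L2_inner_diff_right L2_diff assms)
  then have "Re (complex_of_real ((L2_norm m (\<lambda>x. f x - g x))\<^sup>2)) =
     Re (L2_inner m f f - L2_inner m f g - (L2_inner m g f - L2_inner m g g))" by simp
  then show ?thesis
    using L2_inner_commute[of m g f] by (simp add: L2_inner_self)
qed

lemma L2_Cauchy_Schwarz:
  assumes f: "f \<in> L2 m" and g: "g \<in> L2 m"
  shows "cmod (L2_inner m f g) \<le> L2_norm m f * L2_norm m g"
proof (cases "L2_norm m g = 0")
  case True
  then have "AE x in m. g x = 0" using L2_norm_eq_0_iff[OF g] by simp
  then have "L2_inner m f g = (LINT x|m. 0)"
    unfolding L2_inner_def
    using L2_inner_integrable[OF f g] by (intro integral_cong_AE) auto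
  then show ?thesis by simp
next
  case False
  define n where "n = (L2_norm m g)\<^sup>2"
  define i where "i = L2_inner m f g"
  have n: "n > 0" using False L2_norm_nonneg[of m g] by (simp add: n_def)
  \<comment> \<open>the subtracted multiple of \<open>g\<close> is the orthogonal projection of \<open>f\<close>\<close>
  have "0 \<le> (L2_norm m (\<lambda>x. f x - (i / of_real n) * g x))\<^sup>2" by simp
  also have "\<dots> = (L2_norm m f)\<^sup>2 - 2 * Re (cnj (i / of_real n) * i) + (cmod (i / of_real n) * L2_norm m g)\<^sup>2"
    by (subst L2_norm_diff_square[OF f L2_cmult[OF g]])
       (simp only: L2_norm_cmult L2_inner_cmult_right i_def)
  also have "Re (cnj (i / of_real n) * i) = (cmod i)\<^sup>2 / n"
  proof -
    have "cnj (i / of_real n) * i = of_real ((cmod i)\<^sup>2 / n)"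
      unfolding of_real_divide complex_norm_square by simp
    then show ?thesis by (simp only: Re_complex_of_real)
  qed
  also have "(cmod (i / of_real n) * L2_norm m g)\<^sup>2 = (cmod i)\<^sup>2 / n"
    using n by (simp add: norm_divide power_mult_distrib power_divide n_def[symmetric])
       (simp add: power2_eq_square)
  finally have "(cmod i)\<^sup>2 / n \<le> (L2_norm m f)\<^sup>2" by simp
  then have "(cmod i)\<^sup>2 \<le> (L2_norm m f * L2_norm m g)\<^sup>2"
    using n by (simp add: divide_le_eq power_mult_distrib n_def)
  then show ?thesis
    unfolding i_def by (rule power2_le_imp_le) simp
qed

lemma L2_norm_triangle:
  assumes f: "f \<in> L2 m" and g: "g \<in> L2 m"
  shows "L2_norm m (\<lambda>x. f x - g x) \<le> L2_norm m f + L2_norm m g"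
proof (rule power2_le_imp_le)
  have "- Re (L2_inner m f g) \<le> L2_norm m f * L2_norm m g"
    using L2_Cauchy_Schwarz[OF f g] abs_Re_le_cmod[of "L2_inner m f g"] by linarith
  then show "(L2_norm m (\<lambda>x. f x - g x))\<^sup>2 \<le> (L2_norm m f + L2_norm m g)\<^sup>2"
    by (simp add: L2_norm_diff_square[OF f g] power2_sum)
qed simp

lemma L2_norm_triangle_add:
  assumes f: "f \<in> L2 m" and g: "g \<in> L2 m"
  shows "L2_norm m (\<lambda>x. f x + g x) \<le> L2_norm m f + L2_norm m g"
  using L2_norm_triangle[OF f L2_cmult[OF g, of "-1"]] L2_norm_cmult[of m "-1" g] by simp

lemma L2_dist_triangle:
  assumes "f \<in> L2 m" "g \<in> L2 m" "h \<in> L2 m"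
  shows "L2_norm m (\<lambda>x. f x - h x) \<le> L2_norm m (\<lambda>x. f x - g x) + L2_norm m (\<lambda>x. g x - h x)"
  using L2_norm_triangle_add[OF L2_diff[OF assms(1,2)] L2_diff[OF assms(2,3)]] by simp

lemma L2_limit:
  assumes "\<And>n. s n \<in> L2 m" and "f \<in> L2 m" and "g \<in> L2 m"
    and "(\<lambda>n. L2_norm m (\<lambda>x. s n x - f x)) \<longlonglongrightarrow> 0"
  shows "(\<lambda>n. L2_inner m (s n) g) \<longlonglongrightarrow> L2_inner m f g"
proof -
  have "(\<lambda>n. L2_norm m (\<lambda>x. s n x - f x) * L2_norm m g) \<longlonglongrightarrow> 0"
    using tendsto_mult_right[OF assms(4), of "L2_norm m g"] by simp
  then have "(\<lambda>n. L2_inner m (s n) g - L2_inner m f g) \<longlonglongrightarrow> 0"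
    by (rule Lim_null_comparison[rotated])
       (use L2_Cauchy_Schwarz[OF L2_diff[OF assms(1) assms(2)] assms(3)] in
         \<open>auto simp: L2_inner_diff_left assms\<close>)
  then show ?thesis by (simp add: LIM_zero_iff)
qed

text \<open>
  Along a sequence whose steps shrink geometrically the weighted series of squared steps has a finite
  integral, so almost every point sees steps of size \<open>O(2 powr (- n / 2))\<close>; this gives the pointwise
  limit, and Fatou's lemma turns it into a limit in the norm.
\<close>

lemma L2_complete:
  assumes s: "\<And>n. s n \<in> L2 m"
    and step: "\<And>n. L2_norm m (\<lambda>x. s (Suc n) x - s n x) \<le> (1/4) ^ n"
  shows "\<exists>f\<in>L2 m. (\<lambda>n. L2_norm m (\<lambda>x. s n x - f x)) \<longlonglongrightarrow> 0"
proof -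
  define d where "d n x = s (Suc n) x - s n x" for n x
  have [measurable]: "s n \<in> borel_measurable m" for n by (rule L2D(1)[OF s])
  have dL: "d n \<in> L2 m" for n unfolding d_def[abs_def] by (rule L2_diff[OF s s])
  have [measurable]: "d n \<in> borel_measurable m" for n by (rule L2D(1)[OF dL])
  have nn: "(\<integral>\<^sup>+x. ennreal ((cmod (h x))\<^sup>2) \<partial>m) = ennreal ((L2_norm m h)\<^sup>2)" if "h \<in> L2 m" for h
    using nn_integral_eq_integral[OF L2D(2)[OF that]] by (simp add: L2_norm_def)
  have tele: "L2_norm m (\<lambda>x. s (n + k) x - s n x) \<le> 2 * (1/4)^n" for n k
  proof -
    have "L2_norm m (\<lambda>x. s (n + k) x - s n x) \<le> (\<Sum>i<k. (1/4)^(n+i))"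
    proof (induction k)
      case (Suc k)
      have "L2_norm m (\<lambda>x. s (n + Suc k) x - s n x) \<le>
          L2_norm m (\<lambda>x. s (n + Suc k) x - s (n + k) x) + L2_norm m (\<lambda>x. s (n + k) x - s n x)"
        by (rule L2_dist_triangle[OF s s s])
      with Suc step[of "n+k"] show ?case by simp
    qed simp
    also have "\<dots> = (1/4)^n * (\<Sum>i<k. (1/4)^i)" by (simp add: power_add sum_distrib_left)
    also have "\<dots> \<le> (1/4)^n * 2"
    proof (intro mult_left_mono)
      have "0 \<le> (1/4::real) ^ k" by simp
      moreover have "(\<Sum>i<k. (1/4::real) ^ i) = 4/3 - 4/3 * (1/4) ^ k"
        by (induction k) auto
      ultimately show "(\<Sum>i<k. (1/4::real) ^ i) \<le> 2" by linarith
    qed simp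
    finally show ?thesis by simp
  qed
  have fin: "(\<integral>\<^sup>+x. (\<Sum>n. ennreal (2 ^ n * (cmod (d n x))\<^sup>2)) \<partial>m) < \<infinity>"
  proof -
    have "(\<integral>\<^sup>+x. (\<Sum>n. ennreal (2 ^ n * (cmod (d n x))\<^sup>2)) \<partial>m) =
        (\<Sum>n. \<integral>\<^sup>+x. ennreal (2 ^ n * (cmod (d n x))\<^sup>2) \<partial>m)"
      by (rule nn_integral_suminf) measurable
    also have "\<dots> = (\<Sum>n. ennreal (2 ^ n * (L2_norm m (d n))\<^sup>2))"
      by (simp add: ennreal_mult nn_integral_cmult nn[OF dL])
    also have "\<dots> \<le> (\<Sum>n. ennreal ((1/2) ^ n))"
    proof (intro suminf_le allI ennreal_leI)
      fix n
      have "2 ^ n * (L2_norm m (d n))\<^sup>2 \<le> 2 ^ n * ((1/4) ^ n)\<^sup>2"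
        using step[of n] by (intro mult_left_mono power_mono) (auto simp: d_def[abs_def])
      also have "\<dots> = (1/8) ^ n" by (simp add: power_mult_distrib[symmetric] power2_eq_square)
      also have "\<dots> \<le> (1/2) ^ n" by (intro power_mono) auto
      finally show "2 ^ n * (L2_norm m (d n))\<^sup>2 \<le> (1/2) ^ n" .
    qed auto
    also have "\<dots> < \<infinity>"
      by (subst suminf_ennreal2) (auto simp: summable_geometric)
    finally show ?thesis .
  qed
  have "AE x in m. (\<Sum>n. ennreal (2 ^ n * (cmod (d n x))\<^sup>2)) \<noteq> \<infinity>"
    by (rule nn_integral_PInf_AE) (use fin in \<open>auto\<close>)
  then have conv: "AE x in m. convergent (\<lambda>n. s n x)"
  proof eventually_elim
    case (elim x)
    note fin = elim
    have "summable (\<lambda>n. 2 ^ n * (cmod (d n x))\<^sup>2)"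
      by (rule summable_suminf_not_top) (use fin in auto)
    then have "(\<lambda>n. 2 ^ n * (cmod (d n x))\<^sup>2) \<longlonglongrightarrow> 0" by (rule summable_LIMSEQ_zero)
    then have "Bseq (\<lambda>n. 2 ^ n * (cmod (d n x))\<^sup>2)"
      by (intro convergent_imp_Bseq convergentI)
    then obtain K where K: "K > 0" "\<And>n. norm (2 ^ n * (cmod (d n x))\<^sup>2) \<le> K"
      unfolding Bseq_def by auto
    have power_commutes_exp: "(a ^ n)\<^sup>2 = (a\<^sup>2) ^ n" for a :: real and n
      by (simp only: power_mult[symmetric] mult.commute)
    have bd: "cmod (d n x) \<le> sqrt K * (1 / sqrt 2) ^ n" for n
    proof (rule power2_le_imp_le)
      have "(cmod (d n x))\<^sup>2 \<le> K / 2 ^ n" using K(2)[of n] by (simp add: field_simps)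
      also have "\<dots> = (sqrt K * (1 / sqrt 2) ^ n)\<^sup>2"
      proof -
        have "((1 / sqrt 2) ^ n)\<^sup>2 = ((1 / sqrt 2)\<^sup>2) ^ n" by (rule power_commutes_exp)
        then show ?thesis using K(1) by (simp only: power_mult_distrib) (simp add: power_divide)
      qed
      finally show "(cmod (d n x))\<^sup>2 \<le> (sqrt K * (1 / sqrt 2) ^ n)\<^sup>2" .
    qed (use K in auto)
    have "summable (\<lambda>n. sqrt K * (1 / sqrt 2) ^ n)"
      by (intro summable_mult summable_geometric) auto
    then have "summable (\<lambda>n. d n x)"
      by (rule summable_comparison_test'[where N=0]) (use bd in auto)
    then have "convergent (\<lambda>n. \<Sum>k<n. d k x)" by (simp add: summable_iff_convergent)
    moreover have "(\<Sum>k<n. d k x) = s n x - s 0 x" for n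
      unfolding d_def by (rule sum_lessThan_telescope)
    ultimately have "convergent (\<lambda>n. s n x - s 0 x)" by simp
    then have "convergent (\<lambda>n. (s n x - s 0 x) + s 0 x)" by (intro convergent_add convergent_const)
    then show "convergent (\<lambda>n. s n x)" by simp
  qed
  define f where "f x = lim (\<lambda>n. s n x)" for x
  have fm [measurable]: "f \<in> borel_measurable m"
    unfolding f_def[abs_def] by (rule borel_measurable_lim_metric) measurable
  have lim: "AE x in m. (\<lambda>n. s n x) \<longlonglongrightarrow> f x"
    using conv by eventually_elim (simp add: f_def convergent_LIMSEQ_iff)
  have est: "(\<integral>\<^sup>+x. ennreal ((cmod (s n x - f x))\<^sup>2) \<partial>m) \<le> ennreal ((2 * (1/4)^n)\<^sup>2)" for n
  proof -
    have "(\<integral>\<^sup>+x. ennreal ((cmod (s n x - f x))\<^sup>2) \<partial>m) =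
        (\<integral>\<^sup>+x. liminf (\<lambda>k. ennreal ((cmod (s (n + k) x - s n x))\<^sup>2)) \<partial>m)"
    proof (rule nn_integral_cong_AE, use lim in eventually_elim)
      fix x assume "(\<lambda>k. s k x) \<longlonglongrightarrow> f x"
      then have "(\<lambda>k. s (n + k) x) \<longlonglongrightarrow> f x"
        using LIMSEQ_ignore_initial_segment[of "\<lambda>k. s k x" "f x" n] by (simp add: add.commute)
      then have "(\<lambda>k. ennreal ((cmod (s (n + k) x - s n x))\<^sup>2)) \<longlonglongrightarrow> ennreal ((cmod (f x - s n x))\<^sup>2)"
        by (intro tendsto_intros)
      then show "ennreal ((cmod (s n x - f x))\<^sup>2) = liminf (\<lambda>k. ennreal ((cmod (s (n + k) x - s n x))\<^sup>2))"
        by (subst lim_imp_Liminf[OF sequentially_bot]) (simp_all add: norm_minus_commute)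
    qed
    also have "\<dots> \<le> liminf (\<lambda>k. \<integral>\<^sup>+x. ennreal ((cmod (s (n + k) x - s n x))\<^sup>2) \<partial>m)"
      by (rule nn_integral_liminf) measurable
    also have "\<dots> = liminf (\<lambda>k. ennreal ((L2_norm m (\<lambda>x. s (n + k) x - s n x))\<^sup>2))"
      by (simp add: nn L2_diff s)
    also have "\<dots> \<le> liminf (\<lambda>k::nat. ennreal ((2 * (1/4)^n)\<^sup>2))"
      by (intro Liminf_mono always_eventually allI ennreal_leI power_mono tele) auto
    also have "\<dots> = ennreal ((2 * (1/4)^n)\<^sup>2)" by (simp add: Liminf_const)
    finally show ?thesis .
  qed
  have dif: "(\<lambda>x. s n x - f x) \<in> L2 m" for n
  proof -
    have "(\<integral>\<^sup>+x. ennreal (norm ((cmod (s n x - f x))\<^sup>2)) \<partial>m) < \<infinity>"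
      using le_less_trans[OF est[of n] ennreal_less_top] by simp
    then have "integrable m (\<lambda>x. (cmod (s n x - f x))\<^sup>2)"
      by (intro integrableI_bounded) measurable
    then show ?thesis by (simp add: L2_def)
  qed
  have fL: "f \<in> L2 m" using L2_diff[OF s dif, of 0 0] by simp
  have le: "L2_norm m (\<lambda>x. s n x - f x) \<le> 2 * (1/4)^n" for n
  proof (rule power2_le_imp_le)
    show "(L2_norm m (\<lambda>x. s n x - f x))\<^sup>2 \<le> (2 * (1/4)^n)\<^sup>2"
      using est[of n] unfolding nn[OF dif] by (subst (asm) ennreal_le_iff) simp_all
  qed simp
  have "(\<lambda>n. 2 * (1/4::real)^n) \<longlonglongrightarrow> 0"
    using tendsto_mult_right_zero[OF LIMSEQ_realpow_zero[of "1/4::real"], of 2] by simp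
  then have "(\<lambda>n. L2_norm m (\<lambda>x. s n x - f x)) \<longlonglongrightarrow> 0"
    by (rule Lim_null_comparison[rotated]) (use le in \<open>simp add: always_eventually\<close>)
  with fL show ?thesis by blast
qed


section \<open>Linear spans and their closures\<close>

lemma lin_span_base: "u \<in> S \<Longrightarrow> u \<in> lin_span S"
  unfolding lin_span_def by (rule CollectI, rule exI[of _ "{u}"], rule exI[of _ "\<lambda>_. 1"]) auto

lemma lin_span_zero: "(\<lambda>x. 0) \<in> lin_span S"
  unfolding lin_span_def by (rule CollectI, rule exI[of _ "{}"]) auto

lemma lin_span_cmult: "f \<in> lin_span S \<Longrightarrow> (\<lambda>x. c * f x) \<in> lin_span S"
proof -
  assume "f \<in> lin_span S"
  then obtain F d where F: "finite F" "F \<subseteq> S" "f = (\<lambda>x. \<Sum>u\<in>F. d u * u x)"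
    unfolding lin_span_def by blast
  then have "(\<lambda>x. c * f x) = (\<lambda>x. \<Sum>u\<in>F. (c * d u) * u x)"
    by (simp add: sum_distrib_left mult.assoc)
  with F(1,2) show ?thesis unfolding lin_span_def
    by (intro CollectI exI[of _ F] exI[of _ "\<lambda>u. c * d u"]) auto
qed

lemma lin_span_add:
  assumes "f \<in> lin_span S" "g \<in> lin_span S"
  shows "(\<lambda>x. f x + g x) \<in> lin_span S"
proof -
  obtain F c where F: "finite F" "F \<subseteq> S" "f = (\<lambda>x. \<Sum>u\<in>F. c u * u x)"
    using assms(1) unfolding lin_span_def by blast
  obtain G d where G: "finite G" "G \<subseteq> S" "g = (\<lambda>x. \<Sum>u\<in>G. d u * u x)"
    using assms(2) unfolding lin_span_def by blast
  define e where "e u = (if u \<in> F then c u else 0) + (if u \<in> G then d u else 0)" for u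
  have "f x + g x = (\<Sum>u\<in>F \<union> G. e u * u x)" for x
  proof -
    have "f x = (\<Sum>u\<in>F \<union> G. (if u \<in> F then c u else 0) * u x)"
      unfolding F(3) by (rule sum.mono_neutral_cong_left) (use F G in auto)
    moreover have "g x = (\<Sum>u\<in>F \<union> G. (if u \<in> G then d u else 0) * u x)"
      unfolding G(3) by (rule sum.mono_neutral_cong_left) (use F G in auto)
    ultimately show ?thesis
      by (simp only: e_def distrib_right sum.distrib)
  qed
  then show ?thesis
    unfolding lin_span_def using F(1,2) G(1,2)
    by (intro CollectI exI[of _ "F \<union> G"] exI[of _ e]) auto
qed

lemma sum_in_linear_subspace:
  assumes "\<And>i. i \<in> I \<Longrightarrow> f i \<in> N" and "(\<lambda>x. 0) \<in> N"
    and "\<And>f g. f \<in> N \<Longrightarrow> g \<in> N \<Longrightarrow> (\<lambda>x. f x + g x) \<in> N"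
    and "\<And>c f. f \<in> N \<Longrightarrow> (\<lambda>x. c * f x) \<in> N"
  shows "(\<lambda>x. \<Sum>i\<in>I. c i * f i x) \<in> (N :: ('a \<Rightarrow> complex) set)"
  using assms(1)
proof (induction I rule: infinite_finite_induct)
  case (insert i I)
  have "(\<lambda>x. c i * f i x + (\<Sum>i\<in>I. c i * f i x)) \<in> N"
    by (rule assms(3)) (use insert assms(4) in auto)
  with insert show ?case by simp
qed (use assms(2) in auto)

lemma lin_span_minimal:
  assumes "S \<subseteq> N" and "(\<lambda>x. 0) \<in> N"
    and "\<And>f g. f \<in> N \<Longrightarrow> g \<in> N \<Longrightarrow> (\<lambda>x. f x + g x) \<in> N"
    and "\<And>c f. f \<in> N \<Longrightarrow> (\<lambda>x. c * f x) \<in> N"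
  shows "lin_span S \<subseteq> N"
proof
  fix f assume "f \<in> lin_span S"
  then obtain F c where F: "finite F" "F \<subseteq> S" "f = (\<lambda>x. \<Sum>u\<in>F. c u * u x)"
    unfolding lin_span_def by blast
  show "f \<in> N" unfolding F(3)
    by (rule sum_in_linear_subspace) (use F assms in auto)
qed

lemma lin_span_mono: "S \<subseteq> S' \<Longrightarrow> lin_span S \<subseteq> lin_span S'"
  unfolding lin_span_def by blast

lemma lin_span_L2: "S \<subseteq> L2 m \<Longrightarrow> lin_span S \<subseteq> L2 m"
  by (rule lin_span_minimal) (auto simp: L2_zero L2_add L2_cmult)

lemma closed_span_L2: "f \<in> closed_span m S \<Longrightarrow> f \<in> L2 m"
  by (simp add: closed_span_def)

lemma lin_span_closed_span:
  assumes "f \<in> lin_span S" "f \<in> L2 m"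
  shows "f \<in> closed_span m S"
  unfolding closed_span_def using assms by (auto intro!: bexI[of _ f])

lemma closed_span_base: "S \<subseteq> L2 m \<Longrightarrow> S \<subseteq> closed_span m S"
  using lin_span_base lin_span_closed_span by blast

lemma closed_span_zero: "(\<lambda>x. 0) \<in> closed_span m S"
  by (rule lin_span_closed_span[OF lin_span_zero L2_zero])

lemma closed_span_add:
  assumes "f \<in> closed_span m S" "g \<in> closed_span m S"
  shows "(\<lambda>x. f x + g x) \<in> closed_span m S"
proof -
  have L: "f \<in> L2 m" "g \<in> L2 m" using assms by (auto dest: closed_span_L2)
  have "\<exists>h \<in> L2 m \<inter> lin_span S. L2_norm m (\<lambda>x. f x + g x - h x) < e" if "e > 0" for e
  proof -
    obtain f' where f': "f' \<in> L2 m" "f' \<in> lin_span S" "L2_norm m (\<lambda>x. f x - f' x) < e/2"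
      using assms(1) half_gt_zero[OF \<open>e > 0\<close>] unfolding closed_span_def by blast
    obtain g' where g': "g' \<in> L2 m" "g' \<in> lin_span S" "L2_norm m (\<lambda>x. g x - g' x) < e/2"
      using assms(2) half_gt_zero[OF \<open>e > 0\<close>] unfolding closed_span_def by blast
    have "L2_norm m (\<lambda>x. (f x - f' x) + (g x - g' x)) < e"
      using L2_norm_triangle_add[OF L2_diff[OF L(1) f'(1)] L2_diff[OF L(2) g'(1)]] f'(3) g'(3) by simp
    then have "L2_norm m (\<lambda>x. f x + g x - (f' x + g' x)) < e" by (simp add: algebra_simps)
    then show ?thesis
      using L2_add[OF f'(1) g'(1)] lin_span_add[OF f'(2) g'(2)] by (intro bexI[of _ "\<lambda>x. f' x + g' x"]) auto
  qed
  then show ?thesis using L2_add[OF L] by (simp add: closed_span_def)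
qed

lemma closed_span_cmult:
  assumes "f \<in> closed_span m S"
  shows "(\<lambda>x. c * f x) \<in> closed_span m S"
proof -
  have L: "f \<in> L2 m" using assms by (rule closed_span_L2)
  have "\<exists>h \<in> L2 m \<inter> lin_span S. L2_norm m (\<lambda>x. c * f x - h x) < e" if "e > 0" for e
  proof -
    have pos: "e / (cmod c + 1) > 0" using \<open>e > 0\<close> by (simp add: add_nonneg_pos)
    then obtain f' where f': "f' \<in> L2 m \<inter> lin_span S" "L2_norm m (\<lambda>x. f x - f' x) < e / (cmod c + 1)"
      using assms unfolding closed_span_def by blast
    have "L2_norm m (\<lambda>x. c * f x - c * f' x) = cmod c * L2_norm m (\<lambda>x. f x - f' x)"
      by (simp add: L2_norm_cmult right_diff_distrib[symmetric])
    also have "\<dots> \<le> (cmod c) * (e / (cmod c + 1))"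
      by (intro mult_left_mono) (use f' in auto)
    also have "\<dots> < (cmod c + 1) * (e / (cmod c + 1))"
      using pos by (intro mult_strict_right_mono) auto
    also have "\<dots> = e" by (simp add: add_nonneg_eq_0_iff)
    finally show ?thesis
      using f' lin_span_cmult[of f' S c] L2_cmult[of f' m c] by (intro bexI[of _ "\<lambda>x. c * f' x"]) auto
  qed
  then show ?thesis using L2_cmult[OF L] by (simp add: closed_span_def)
qed

lemma closed_span_diff:
  assumes "f \<in> closed_span m S" "g \<in> closed_span m S"
  shows "(\<lambda>x. f x - g x) \<in> closed_span m S"
  using closed_span_add[OF assms(1) closed_span_cmult[OF assms(2), of "-1"]] by simp

lemma closed_span_closed:
  assumes f: "f \<in> L2 m" and approx: "\<And>e. e > 0 \<Longrightarrow> \<exists>g\<in>closed_span m S. L2_norm m (\<lambda>x. f x - g x) < e"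
  shows "f \<in> closed_span m S"
proof -
  have "\<exists>h \<in> L2 m \<inter> lin_span S. L2_norm m (\<lambda>x. f x - h x) < e" if "e > 0" for e
  proof -
    obtain g where g: "g \<in> closed_span m S" "L2_norm m (\<lambda>x. f x - g x) < e/2"
      using approx[of "e/2"] \<open>e > 0\<close> by auto
    obtain h where h: "h \<in> L2 m \<inter> lin_span S" "L2_norm m (\<lambda>x. g x - h x) < e/2"
      using g(1) half_gt_zero[OF \<open>e > 0\<close>] unfolding closed_span_def by blast
    have "L2_norm m (\<lambda>x. f x - h x) < e"
      using L2_dist_triangle[OF f closed_span_L2[OF g(1)], of h] h g(2) by auto
    with h show ?thesis by blast
  qed
  with f show ?thesis by (simp add: closed_span_def)
qed

lemma closed_span_minimal:
  assumes "S \<subseteq> closed_span m S'"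
  shows "closed_span m S \<subseteq> closed_span m S'"
proof
  fix f assume f: "f \<in> closed_span m S"
  have "lin_span S \<subseteq> closed_span m S'"
    using assms by (rule lin_span_minimal) (auto intro: closed_span_zero closed_span_add closed_span_cmult)
  with f show "f \<in> closed_span m S'"
    by (intro closed_span_closed) (unfold closed_span_def, blast+)
qed

lemma closed_span_orthogonal:
  assumes S: "S \<subseteq> L2 m" and h: "h \<in> L2 m" and orth: "\<And>g. g \<in> S \<Longrightarrow> L2_inner m g h = 0"
    and f: "f \<in> closed_span m S"
  shows "L2_inner m f h = 0"
proof (rule ccontr)
  assume neq: "L2_inner m f h \<noteq> 0"
  have span: "L2_inner m g h = 0" if "g \<in> lin_span S" for g
  proof -
    obtain F c where F: "finite F" "F \<subseteq> S" "g = (\<lambda>x. \<Sum>u\<in>F. c u * u x)"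
      using \<open>g \<in> lin_span S\<close> unfolding lin_span_def by blast
    have "L2_inner m g h = (\<Sum>u\<in>F. L2_inner m (\<lambda>x. c u * u x) h)"
      unfolding F(3) by (rule L2_inner_sum_left) (use F S h in \<open>auto intro: L2_cmult\<close>)
    also have "\<dots> = 0" using F orth by (simp add: L2_inner_cmult_left subset_iff)
    finally show ?thesis .
  qed
  define e where "e = cmod (L2_inner m f h) / (L2_norm m h + 1)"
  have "e > 0" using neq by (simp add: e_def add_nonneg_pos)
  then obtain g where g: "g \<in> L2 m" "g \<in> lin_span S" "L2_norm m (\<lambda>x. f x - g x) < e"
    using f unfolding closed_span_def by blast
  have fL: "f \<in> L2 m" using f by (rule closed_span_L2)
  have "cmod (L2_inner m f h) = cmod (L2_inner m (\<lambda>x. f x - g x) h)"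
    using span[OF g(2)] by (simp add: L2_inner_diff_left fL g h)
  also have "\<dots> \<le> L2_norm m (\<lambda>x. f x - g x) * L2_norm m h"
    by (rule L2_Cauchy_Schwarz[OF L2_diff[OF fL g(1)] h])
  also have "\<dots> \<le> e * L2_norm m h" using g(3) by (intro mult_right_mono) auto
  also have "\<dots> < e * (L2_norm m h + 1)" using \<open>e > 0\<close> by simp
  also have "\<dots> = cmod (L2_inner m f h)"
    unfolding e_def using L2_norm_nonneg[of m h] by (simp add: add_nonneg_eq_0_iff)
  finally show False by simp
qed


section \<open>Orthonormal systems\<close>

locale orthonormal_system =
  fixes m :: "'a measure" and E :: "('a \<Rightarrow> complex) set"
  assumes system_L2: "E \<subseteq> L2 m"
    and inner_system: "\<And>u v. u \<in> E \<Longrightarrow> v \<in> E \<Longrightarrow> L2_inner m u v = (if u = v then 1 else 0)"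
begin

lemma comb_L2: "F \<subseteq> E \<Longrightarrow> (\<lambda>x. \<Sum>u\<in>F. c u * u x) \<in> L2 m"
  using system_L2 by (intro L2_sum L2_cmult) auto

lemma comb_closed_span: "finite F \<Longrightarrow> F \<subseteq> E \<Longrightarrow> (\<lambda>x. \<Sum>u\<in>F. c u * u x) \<in> closed_span m E"
  by (rule lin_span_closed_span[OF _ comb_L2]) (auto simp: lin_span_def)

lemma inner_comb:
  assumes "finite F" "F \<subseteq> E" "e \<in> E"
  shows "L2_inner m (\<lambda>x. \<Sum>u\<in>F. c u * u x) e = (if e \<in> F then c e else 0)"
proof -
  have "L2_inner m (\<lambda>x. \<Sum>u\<in>F. c u * u x) e = (\<Sum>u\<in>F. L2_inner m (\<lambda>x. c u * u x) e)"
    by (rule L2_inner_sum_left) (use system_L2 assms in \<open>auto intro: L2_cmult\<close>)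
  also have "\<dots> = (\<Sum>u\<in>F. if u = e then c u else 0)"
    using assms by (intro sum.cong refl) (auto simp: L2_inner_cmult_left inner_system)
  also have "\<dots> = (if e \<in> F then c e else 0)" using assms by simp
  finally show ?thesis .
qed

lemma inner_comb_right:
  assumes "finite F" "F \<subseteq> E" "f \<in> L2 m"
  shows "L2_inner m f (\<lambda>x. \<Sum>u\<in>F. c u * u x) = (\<Sum>u\<in>F. cnj (c u) * L2_inner m f u)"
proof -
  have "L2_inner m f (\<lambda>x. \<Sum>u\<in>F. c u * u x) = (\<Sum>u\<in>F. L2_inner m f (\<lambda>x. c u * u x))"
    by (rule L2_inner_sum_right) (use system_L2 assms in \<open>auto intro: L2_cmult\<close>)
  then show ?thesis by (simp add: L2_inner_cmult_right)
qed

lemma norm_comb: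
  assumes "finite F" "F \<subseteq> E"
  shows "(L2_norm m (\<lambda>x. \<Sum>u\<in>F. c u * u x))\<^sup>2 = (\<Sum>u\<in>F. (cmod (c u))\<^sup>2)"
proof -
  have "complex_of_real ((L2_norm m (\<lambda>x. \<Sum>u\<in>F. c u * u x))\<^sup>2) = (\<Sum>u\<in>F. cnj (c u) * c u)"
    unfolding L2_inner_self[symmetric] inner_comb_right[OF assms comb_L2[OF assms(2)]]
    using assms(2) by (intro sum.cong refl) (auto simp: inner_comb[OF assms])
  also have "\<dots> = complex_of_real (\<Sum>u\<in>F. (cmod (c u))\<^sup>2)"
    by (simp only: of_real_sum complex_norm_square mult.commute)
  finally show ?thesis by (simp only: of_real_eq_iff)
qed

text \<open>
  Completing the square coefficient by coefficient: the Fourier coefficients give the best approximation, and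
  Bessel's inequality is the case in which the last sum vanishes.
\<close>

lemma dist_comb:
  assumes F: "finite F" "F \<subseteq> E" and f: "f \<in> L2 m"
  shows "(L2_norm m (\<lambda>x. f x - (\<Sum>u\<in>F. c u * u x)))\<^sup>2 =
    (L2_norm m f)\<^sup>2 - (\<Sum>u\<in>F. (cmod (L2_inner m f u))\<^sup>2) + (\<Sum>u\<in>F. (cmod (L2_inner m f u - c u))\<^sup>2)"
proof -
  have sq: "(cmod (a - b))\<^sup>2 = (cmod a)\<^sup>2 - 2 * Re (cnj b * a) + (cmod b)\<^sup>2" for a b
    by (simp add: cmod_power2 power2_diff algebra_simps)
  show ?thesis
    unfolding L2_norm_diff_square[OF f comb_L2[OF F(2)]] norm_comb[OF F] inner_comb_right[OF F f] sq
    by (simp add: sum.distrib sum_subtractf sum_distrib_left)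
qed

lemma bessel:
  assumes "finite F" "F \<subseteq> E" "f \<in> L2 m"
  shows "(\<Sum>u\<in>F. (cmod (L2_inner m f u))\<^sup>2) \<le> (L2_norm m f)\<^sup>2"
  using dist_comb[OF assms, of "L2_inner m f"]
    zero_le_power2[of "L2_norm m (\<lambda>x. f x - (\<Sum>u\<in>F. L2_inner m f u * u x))"] by simp

text \<open>
  The approximation persists for all larger finite sets, so finitely many functions can be
  approximated along the same set of basis vectors.
\<close>

lemma fourier_approximation:
  assumes f: "f \<in> closed_span m E" and "\<epsilon> > 0"
  shows "\<exists>F. finite F \<and> F \<subseteq> E \<and> (\<forall>G. finite G \<longrightarrow> F \<subseteq> G \<longrightarrow> G \<subseteq> E \<longrightarrow>
    L2_norm m (\<lambda>x. f x - (\<Sum>u\<in>G. L2_inner m f u * u x)) < \<epsilon>)"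
proof -
  have fL: "f \<in> L2 m" using f by (rule closed_span_L2)
  obtain g where g: "g \<in> lin_span E" "L2_norm m (\<lambda>x. f x - g x) < \<epsilon>"
    using f \<open>\<epsilon> > 0\<close> unfolding closed_span_def by blast
  obtain F c where F: "finite F" "F \<subseteq> E" "g = (\<lambda>x. \<Sum>u\<in>F. c u * u x)"
    using g(1) unfolding lin_span_def by blast
  have "L2_norm m (\<lambda>x. f x - (\<Sum>u\<in>G. L2_inner m f u * u x)) < \<epsilon>"
    if G: "finite G" "F \<subseteq> G" "G \<subseteq> E" for G
  proof -
    have "(L2_norm m (\<lambda>x. f x - (\<Sum>u\<in>G. L2_inner m f u * u x)))\<^sup>2 =
        (L2_norm m f)\<^sup>2 - (\<Sum>u\<in>G. (cmod (L2_inner m f u))\<^sup>2)"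
      using dist_comb[OF G(1,3) fL] by simp
    also have "\<dots> \<le> (L2_norm m f)\<^sup>2 - (\<Sum>u\<in>F. (cmod (L2_inner m f u))\<^sup>2)"
      using G by (intro diff_left_mono sum_mono2) auto
    also have "\<dots> \<le> (L2_norm m (\<lambda>x. f x - g x))\<^sup>2"
      unfolding F(3) dist_comb[OF F(1,2) fL] by (simp add: sum_nonneg)
    finally have "L2_norm m (\<lambda>x. f x - (\<Sum>u\<in>G. L2_inner m f u * u x)) \<le> L2_norm m (\<lambda>x. f x - g x)"
      by (rule power2_le_imp_le) simp
    with g(2) show ?thesis by simp
  qed
  with F show ?thesis by blast
qed

text \<open>
  Finite sets whose mass comes within \<open>16 powr (- n)\<close> of the supremum leave at most that mass outside; the
  corresponding partial sums therefore have steps of norm at most \<open>4 powr (- n)\<close>. A coefficient outside all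
  these sets must vanish, for the same reason.
\<close>

lemma riesz_fischer:
  assumes bound: "\<And>F. finite F \<Longrightarrow> F \<subseteq> E \<Longrightarrow> (\<Sum>e\<in>F. (cmod (c e))\<^sup>2) \<le> K"
  shows "\<exists>f\<in>closed_span m E. \<forall>e\<in>E. L2_inner m f e = c e"
proof -
  have sq: "(1/16) ^ n = ((1/4 :: real) ^ n)\<^sup>2" for n
  proof -
    have "((1/4 :: real) ^ n)\<^sup>2 = ((1/4)\<^sup>2) ^ n" by (simp only: power_mult[symmetric] mult.commute)
    then show ?thesis by (simp add: power_divide)
  qed
  define \<Sigma> where "\<Sigma> F = (\<Sum>e\<in>F. (cmod (c e))\<^sup>2)" for F
  define \<F> where "\<F> = {F. finite F \<and> F \<subseteq> E}"
  have bdd: "bdd_above (\<Sigma> ` \<F>)"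
    using bound by (auto simp: \<Sigma>_def \<F>_def bdd_above_def)
  define s where "s = Sup (\<Sigma> ` \<F>)"
  have le: "\<Sigma> F \<le> s" if "F \<in> \<F>" for F
    unfolding s_def using bdd that by (intro cSup_upper) auto
  have "\<exists>F\<in>\<F>. s - (1/16)^n < \<Sigma> F" for n
  proof -
    have "{} \<in> \<F>" by (simp add: \<F>_def)
    then have "\<exists>y\<in>\<Sigma> ` \<F>. s - (1/16)^n < y"
      using bdd less_cSup_iff[of "\<Sigma> ` \<F>" "s - (1/16)^n"] by (auto simp: s_def)
    then show ?thesis by blast
  qed
  then obtain A where A: "\<And>n. A n \<in> \<F>" "\<And>n. s - (1/16)^n < \<Sigma> (A n)" by metis
  define G where "G n = (\<Union>k\<le>n. A k)" for n :: nat
  have G: "finite (G n)" "G n \<subseteq> E" for n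
    using A(1) by (auto simp: G_def \<F>_def)
  have GF: "G n \<in> \<F>" for n using G by (simp add: \<F>_def)
  have big: "s - (1/16)^n < \<Sigma> (G n)" for n
  proof -
    have "\<Sigma> (A n) \<le> \<Sigma> (G n)"
      unfolding \<Sigma>_def using G(1) by (intro sum_mono2) (auto simp: G_def)
    with A(2)[of n] show ?thesis by simp
  qed
  have mono: "G n \<subseteq> G (Suc n)" for n unfolding G_def by (rule UN_mono) auto
  \<comment> \<open>what lies outside \<open>G n\<close> carries little mass\<close>
  have rest: "\<Sigma> F \<le> (1/16)^n" if F: "F \<in> \<F>" "F \<inter> G n = {}" for F n
  proof -
    have "\<Sigma> F + \<Sigma> (G n) = \<Sigma> (F \<union> G n)"
      unfolding \<Sigma>_def using F G by (subst sum.union_disjoint) (auto simp: \<F>_def)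
    also have "\<dots> \<le> s" using F(1) GF[of n] by (intro le) (auto simp: \<F>_def)
    finally show ?thesis using big[of n] by simp
  qed
  define S where "S n x = (\<Sum>e\<in>G n. c e * e x)" for n x
  have SL: "S n \<in> L2 m" for n unfolding S_def[abs_def] by (rule comb_L2[OF G(2)])
  have "L2_norm m (\<lambda>x. S (Suc n) x - S n x) \<le> (1/4)^n" for n
  proof (rule power2_le_imp_le)
    have "(\<lambda>x. S (Suc n) x - S n x) = (\<lambda>x. \<Sum>e\<in>G (Suc n) - G n. c e * e x)"
      unfolding S_def using sum_diff[OF G(1) mono, of "\<lambda>e. c e * e _"] by simp
    moreover have "G (Suc n) - G n \<in> \<F>" using GF[of "Suc n"] by (auto simp: \<F>_def)
    ultimately have "(L2_norm m (\<lambda>x. S (Suc n) x - S n x))\<^sup>2 = \<Sigma> (G (Suc n) - G n)"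
      by (simp add: norm_comb \<F>_def \<Sigma>_def)
    also have "\<dots> \<le> (1/16)^n"
      by (rule rest) (use GF[of "Suc n"] in \<open>auto simp: \<F>_def\<close>)
    also have "\<dots> = ((1/4)^n)\<^sup>2" by (rule sq)
    finally show "(L2_norm m (\<lambda>x. S (Suc n) x - S n x))\<^sup>2 \<le> ((1/4)^n)\<^sup>2" .
  qed simp
  with SL have "\<exists>f\<in>L2 m. (\<lambda>n. L2_norm m (\<lambda>x. S n x - f x)) \<longlonglongrightarrow> 0"
    by (rule L2_complete[where s=S])
  then obtain f where f: "f \<in> L2 m" and lim: "(\<lambda>n. L2_norm m (\<lambda>x. S n x - f x)) \<longlonglongrightarrow> 0" by blast
  have "f \<in> closed_span m E"
  proof (rule closed_span_closed[OF f])
    fix \<epsilon> :: real assume "\<epsilon> > 0"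
    with lim have "\<forall>\<^sub>F n in sequentially. L2_norm m (\<lambda>x. S n x - f x) < \<epsilon>"
      by (rule order_tendstoD)
    then obtain n where "L2_norm m (\<lambda>x. S n x - f x) < \<epsilon>"
      by (auto simp: eventually_sequentially)
    moreover have "S n \<in> closed_span m E"
      unfolding S_def[abs_def] by (rule comb_closed_span[OF G])
    ultimately show "\<exists>g\<in>closed_span m E. L2_norm m (\<lambda>x. f x - g x) < \<epsilon>"
      by (auto simp: L2_norm_minus_commute[of m f])
  qed
  moreover have "L2_inner m f e = c e" if e: "e \<in> E" for e
  proof -
    have "cmod (L2_inner m (S n) e - c e) \<le> (1/4)^n" for n
    proof (cases "e \<in> G n")
      case True
      then show ?thesis unfolding S_def[abs_def] using G e by (simp add: inner_comb)
    next
      case False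
      then have "\<Sigma> {e} \<le> (1/16)^n" using e by (intro rest) (auto simp: \<F>_def)
      also have "\<dots> = ((1/4)^n)\<^sup>2" by (rule sq)
      finally have "cmod (c e) \<le> (1/4)^n"
        unfolding \<Sigma>_def by (intro power2_le_imp_le[of "cmod (c e)"]) simp_all
      with False show ?thesis unfolding S_def[abs_def] using G e by (simp add: inner_comb)
    qed
    then have "(\<lambda>n. L2_inner m (S n) e - c e) \<longlonglongrightarrow> 0"
      by (intro Lim_null_comparison[OF _ LIMSEQ_realpow_zero[of "1/4"]]) auto
    then have "(\<lambda>n. L2_inner m (S n) e) \<longlonglongrightarrow> c e" by (simp add: LIM_zero_iff)
    moreover have "(\<lambda>n. L2_inner m (S n) e) \<longlonglongrightarrow> L2_inner m f e"
      using SL f lim e system_L2 by (intro L2_limit) auto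
    ultimately show ?thesis using LIMSEQ_unique by blast
  qed
  ultimately show ?thesis by blast
qed

lemma projection:
  assumes "h \<in> L2 m"
  shows "\<exists>p\<in>closed_span m E. \<forall>e\<in>E. L2_inner m p e = L2_inner m h e"
  by (rule riesz_fischer) (rule bessel[OF _ _ assms])

lemma multiplier:
  assumes h: "h \<in> L2 m" and bound: "\<And>e. e \<in> E \<Longrightarrow> cmod (\<phi> e) \<le> K"
  shows "\<exists>f\<in>closed_span m E. \<forall>e\<in>E. L2_inner m f e = \<phi> e * L2_inner m h e"
proof (rule riesz_fischer)
  fix F assume F: "finite F" "F \<subseteq> E"
  have "(\<Sum>e\<in>F. (cmod (\<phi> e * L2_inner m h e))\<^sup>2) \<le> (\<Sum>e\<in>F. K\<^sup>2 * (cmod (L2_inner m h e))\<^sup>2)"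
    using F bound by (intro sum_mono) (auto simp: norm_mult power_mult_distrib intro!: mult_right_mono power_mono)
  also have "\<dots> = K\<^sup>2 * (\<Sum>e\<in>F. (cmod (L2_inner m h e))\<^sup>2)" by (simp add: sum_distrib_left)
  also have "\<dots> \<le> K\<^sup>2 * (L2_norm m h)\<^sup>2" by (intro mult_left_mono bessel F h) auto
  finally show "(\<Sum>e\<in>F. (cmod (\<phi> e * L2_inner m h e))\<^sup>2) \<le> K\<^sup>2 * (L2_norm m h)\<^sup>2" .
qed

text \<open>
  Domination of the coefficients gives domination of the norms; this is what bounds the inverse of a diagonal
  operator.
\<close>

lemma norm_le_coefficients:
  assumes f: "f \<in> closed_span m E" and h: "h \<in> L2 m" and "K \<ge> 0"
    and le: "\<And>e. e \<in> E \<Longrightarrow> cmod (L2_inner m f e) \<le> K * cmod (L2_inner m h e)"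
  shows "L2_norm m f \<le> K * L2_norm m h"
proof (rule field_le_epsilon)
  fix \<epsilon> :: real assume "\<epsilon> > 0"
  have fL: "f \<in> L2 m" using f by (rule closed_span_L2)
  obtain F where F: "finite F" "F \<subseteq> E"
    and less: "L2_norm m (\<lambda>x. f x - (\<Sum>u\<in>F. L2_inner m f u * u x)) < \<epsilon>"
    using fourier_approximation[OF f \<open>\<epsilon> > 0\<close>] by blast
  define g where "g x = (\<Sum>u\<in>F. L2_inner m f u * u x)" for x
  have gL: "g \<in> L2 m" unfolding g_def[abs_def] by (rule comb_L2[OF F(2)])
  have "(L2_norm m g)\<^sup>2 = (\<Sum>u\<in>F. (cmod (L2_inner m f u))\<^sup>2)"
    unfolding g_def[abs_def] by (rule norm_comb[OF F])
  also have "\<dots> \<le> (\<Sum>u\<in>F. (K * cmod (L2_inner m h u))\<^sup>2)"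
    using F le by (intro sum_mono power_mono) auto
  also have "\<dots> = K\<^sup>2 * (\<Sum>u\<in>F. (cmod (L2_inner m h u))\<^sup>2)"
    by (simp add: power_mult_distrib sum_distrib_left)
  also have "\<dots> \<le> K\<^sup>2 * (L2_norm m h)\<^sup>2"
    by (intro mult_left_mono bessel F h) auto
  also have "\<dots> = (K * L2_norm m h)\<^sup>2" by (simp add: power_mult_distrib)
  finally have "L2_norm m g \<le> K * L2_norm m h"
    by (rule power2_le_imp_le) (use \<open>K \<ge> 0\<close> in auto)
  moreover have "L2_norm m f \<le> L2_norm m (\<lambda>x. f x - g x) + L2_norm m g"
    using L2_norm_triangle_add[OF L2_diff[OF fL gL] gL] by simp
  ultimately show "L2_norm m f \<le> K * L2_norm m h + \<epsilon>"
    using less unfolding g_def[abs_def] by linarith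
qed

lemma closed_span_coefficients_zero:
  assumes f: "f \<in> closed_span m E" and "\<And>e. e \<in> E \<Longrightarrow> L2_inner m f e = 0"
  shows "L2_norm m f = 0"
  using norm_le_coefficients[OF f L2_zero, of 0] assms(2) L2_norm_nonneg[of m f] by simp

end


text \<open>
  One Gram-Schmidt step; a vector whose remainder has norm zero adds nothing to the system.
\<close>

lemma gram_schmidt:
  assumes "finite F" "F \<subseteq> L2 m"
  shows "\<exists>E. finite E \<and> orthonormal_system m E \<and> E \<subseteq> lin_span F \<and> F \<subseteq> closed_span m E"
  using assms
proof (induction F rule: finite_induct)
  case empty
  show ?case by (intro exI[of _ "{}"]) (auto simp: orthonormal_system_def)
next
  case (insert v F)
  then obtain E where fin: "finite E" and "orthonormal_system m E"
    and span: "E \<subseteq> lin_span F" "F \<subseteq> closed_span m E" by auto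
  interpret orthonormal_system m E by fact
  have vL: "v \<in> L2 m" using insert.prems by simp
  define p where "p = (\<lambda>x. \<Sum>e\<in>E. L2_inner m v e * e x)"
  define w where "w x = v x - p x" for x
  have p: "p \<in> closed_span m E" unfolding p_def by (rule comb_closed_span[OF fin order_refl])
  have pL: "p \<in> L2 m" using p by (rule closed_span_L2)
  have wL: "w \<in> L2 m" unfolding w_def[abs_def] by (rule L2_diff[OF vL pL])
  have worth: "L2_inner m w e = 0" if "e \<in> E" for e
  proof -
    have "L2_inner m w e = L2_inner m v e - L2_inner m p e"
      unfolding w_def[abs_def] using that system_L2 by (intro L2_inner_diff_left vL pL) auto
    then show ?thesis unfolding p_def using that by (simp add: inner_comb[OF fin order_refl])
  qed
  show ?case
  proof (cases "L2_norm m w = 0")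
    case True
    then have "v \<in> closed_span m E"
      using p unfolding w_def[abs_def] by (intro closed_span_closed[OF vL] bexI[of _ p]) simp_all
    moreover have "E \<subseteq> lin_span (insert v F)" using span(1) lin_span_mono[of F "insert v F"] by blast
    ultimately show ?thesis using fin span(2) \<open>orthonormal_system m E\<close> by (intro exI[of _ E]) auto
  next
    case False
    define e0 where "e0 x = of_real (1 / L2_norm m w) * w x" for x
    have e0L: "e0 \<in> L2 m" unfolding e0_def[abs_def] by (rule L2_cmult[OF wL])
    have left: "L2_inner m e0 e = 0" if "e \<in> E" for e
      unfolding e0_def[abs_def] L2_inner_cmult_left worth[OF that] by simp
    have right: "L2_inner m e e0 = 0" if "e \<in> E" for e
      using left[OF that] L2_inner_commute[of m e e0] by simp
    have self: "L2_inner m e0 e0 = 1"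
    proof -
      have "L2_norm m e0 = 1"
        unfolding e0_def[abs_def] L2_norm_cmult norm_of_real using False by simp
      then show ?thesis unfolding L2_inner_self by simp
    qed
    have new: "orthonormal_system m (insert e0 E)"
    proof
      show "insert e0 E \<subseteq> L2 m" using system_L2 e0L by simp
      fix u v assume "u \<in> insert e0 E" "v \<in> insert e0 E"
      then show "L2_inner m u v = (if u = v then 1 else 0)"
        using self left right inner_system by (metis insertE zero_neq_one)
    qed
    have "e0 \<in> lin_span (insert v F)"
    proof -
      have "p \<in> lin_span (insert v F)"
        unfolding p_def
        by (rule sum_in_linear_subspace)
           (use span(1) lin_span_mono[of F "insert v F"] in \<open>auto intro: lin_span_zero lin_span_add lin_span_cmult\<close>)
      from lin_span_add[OF lin_span_base[of v "insert v F"] lin_span_cmult[OF this, of "-1"]]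
      have "w \<in> lin_span (insert v F)" unfolding w_def[abs_def] by simp
      then show ?thesis unfolding e0_def[abs_def] by (rule lin_span_cmult)
    qed
    moreover have "E \<subseteq> lin_span (insert v F)" using span(1) lin_span_mono[of F "insert v F"] by blast
    moreover have "closed_span m E \<subseteq> closed_span m (insert e0 E)"
    proof (rule closed_span_minimal)
      show "E \<subseteq> closed_span m (insert e0 E)"
        using closed_span_base[OF orthonormal_system.system_L2[OF new]] by blast
    qed
    moreover have "v \<in> closed_span m (insert e0 E)"
    proof -
      have "v = (\<lambda>x. of_real (L2_norm m w) * e0 x + p x)"
        using False by (simp add: e0_def w_def fun_eq_iff)
      moreover have "e0 \<in> closed_span m (insert e0 E)"
        using closed_span_base[OF orthonormal_system.system_L2[OF new]] by blast
      moreover have "p \<in> closed_span m (insert e0 E)"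
        using p \<open>closed_span m E \<subseteq> closed_span m (insert e0 E)\<close> by blast
      ultimately show ?thesis using closed_span_add closed_span_cmult by metis
    qed
    ultimately show ?thesis
      using fin new span(2) by (intro exI[of _ "insert e0 E"]) auto
  qed
qed


section \<open>Diagonal operators\<close>

text \<open>
  The multiplication operator \<open>e \<mapsto> \<mu>(e) e\<close> on its maximal domain: a function belongs to the domain as soon as
  some element of the closed span has the coefficients multiplied by \<open>\<mu>\<close>.
\<close>

definition diagonal_operator ::
    "'a measure \<Rightarrow> ('a \<Rightarrow> complex) set \<Rightarrow> (('a \<Rightarrow> complex) \<Rightarrow> real) \<Rightarrow> 'a operator" where
  "diagonal_operator m E \<mu> = {(f, g). f \<in> closed_span m E \<and> g \<in> closed_span m E \<and>
     (\<forall>e\<in>E. L2_inner m g e = of_real (\<mu> e) * L2_inner m f e)}"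

context orthonormal_system
begin

lemma eigenvector_diagonal_operator:
  assumes "e \<in> E"
  shows "(e, \<lambda>x. of_real (\<mu> e) * e x) \<in> diagonal_operator m E \<mu>"
  using assms closed_span_base[OF system_L2]
  by (auto simp: diagonal_operator_def L2_inner_cmult_left inner_system intro!: closed_span_cmult)

text \<open>
  Only \<open>u\<close> and \<open>v\<close> are replaced by finite partial sums. On these both sides agree coefficient by coefficient, and
  the errors are controlled by the fixed norms of \<open>g\<close> and \<open>f\<close>; the eigenvalues need not be bounded.
\<close>

lemma diagonal_operator_symmetric:
  assumes fg: "(f, g) \<in> diagonal_operator m E \<mu>" and uv: "(u, v) \<in> diagonal_operator m E \<mu>"
  shows "L2_inner m g u = L2_inner m f v"
proof -
  have mem: "f \<in> closed_span m E" "g \<in> closed_span m E" "u \<in> closed_span m E" "v \<in> closed_span m E"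
    and co: "\<And>e. e \<in> E \<Longrightarrow> L2_inner m g e = of_real (\<mu> e) * L2_inner m f e"
      "\<And>e. e \<in> E \<Longrightarrow> L2_inner m v e = of_real (\<mu> e) * L2_inner m u e"
    using fg uv by (auto simp: diagonal_operator_def)
  have L: "f \<in> L2 m" "g \<in> L2 m" "u \<in> L2 m" "v \<in> L2 m" using mem by (auto dest: closed_span_L2)
  have "cmod (L2_inner m g u - L2_inner m f v) \<le> 0 + \<epsilon>" if "\<epsilon> > 0" for \<epsilon>
  proof -
    define K where "K = L2_norm m g + L2_norm m f + 1"
    have "K > 0" by (simp add: K_def add_nonneg_pos)
    then have "\<epsilon> / K > 0" using that by simp
    obtain F1 where F1: "finite F1" "F1 \<subseteq> E" "\<And>G. finite G \<Longrightarrow> F1 \<subseteq> G \<Longrightarrow> G \<subseteq> E \<Longrightarrow>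
        L2_norm m (\<lambda>x. u x - (\<Sum>e\<in>G. L2_inner m u e * e x)) < \<epsilon> / K"
      using fourier_approximation[OF mem(3) \<open>\<epsilon> / K > 0\<close>] by blast
    obtain F2 where F2: "finite F2" "F2 \<subseteq> E" "\<And>G. finite G \<Longrightarrow> F2 \<subseteq> G \<Longrightarrow> G \<subseteq> E \<Longrightarrow>
        L2_norm m (\<lambda>x. v x - (\<Sum>e\<in>G. L2_inner m v e * e x)) < \<epsilon> / K"
      using fourier_approximation[OF mem(4) \<open>\<epsilon> / K > 0\<close>] by blast
    define G where "G = F1 \<union> F2"
    have G: "finite G" "G \<subseteq> E" using F1 F2 by (auto simp: G_def)
    define u' where "u' = (\<lambda>x. \<Sum>e\<in>G. L2_inner m u e * e x)"
    define v' where "v' = (\<lambda>x. \<Sum>e\<in>G. L2_inner m v e * e x)"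
    have less: "L2_norm m (\<lambda>x. u x - u' x) < \<epsilon> / K" "L2_norm m (\<lambda>x. v x - v' x) < \<epsilon> / K"
      using F1(3)[OF G(1) _ G(2)] F2(3)[OF G(1) _ G(2)] by (auto simp: G_def u'_def v'_def)
    have L': "u' \<in> L2 m" "v' \<in> L2 m" unfolding u'_def v'_def by (auto intro: comb_L2[OF G(2)])
    have "L2_inner m g u' = L2_inner m f v'"
      unfolding u'_def v'_def inner_comb_right[OF G L(2)] inner_comb_right[OF G L(1)]
      using G(2) co by (intro sum.cong refl) auto
    then have "L2_inner m g u - L2_inner m f v =
        L2_inner m g (\<lambda>x. u x - u' x) - L2_inner m f (\<lambda>x. v x - v' x)"
      by (simp add: L2_inner_diff_right L L')
    then have "cmod (L2_inner m g u - L2_inner m f v) \<le>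
        cmod (L2_inner m g (\<lambda>x. u x - u' x)) + cmod (L2_inner m f (\<lambda>x. v x - v' x))"
      by (simp add: norm_triangle_ineq4)
    also have "\<dots> \<le> L2_norm m g * L2_norm m (\<lambda>x. u x - u' x) + L2_norm m f * L2_norm m (\<lambda>x. v x - v' x)"
      by (intro add_mono L2_Cauchy_Schwarz L L2_diff L')
    also have "\<dots> \<le> L2_norm m g * (\<epsilon> / K) + L2_norm m f * (\<epsilon> / K)"
      using less by (intro add_mono mult_left_mono) auto
    also have "\<dots> \<le> K * (\<epsilon> / K)"
      unfolding K_def distrib_right[symmetric]
      using \<open>\<epsilon> / K > 0\<close> unfolding K_def by (intro mult_right_mono) auto
    also have "\<dots> = \<epsilon>" using \<open>K > 0\<close> by simp
    finally show ?thesis by simp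
  qed
  then have "cmod (L2_inner m g u - L2_inner m f v) \<le> 0" by (rule field_le_epsilon)
  then show ?thesis by simp
qed

lemma diagonal_operator_self_adjoint: "self_adjoint m (closed_span m E) (diagonal_operator m E \<mu>)"
proof -
  let ?A = "diagonal_operator m E \<mu>"
  let ?M = "closed_span m E"
  have sub: "?A \<subseteq> ?M \<times> ?M" by (auto simp: diagonal_operator_def)
  have "Domain ?A \<subseteq> ?M" using sub by auto
  then have "closed_span m (Domain ?A) \<subseteq> ?M" by (rule closed_span_minimal)
  moreover have "?M \<subseteq> closed_span m (Domain ?A)"
  proof (rule closed_span_minimal)
    have "Domain ?A \<subseteq> L2 m" using \<open>Domain ?A \<subseteq> ?M\<close> closed_span_L2 by blast
    then show "E \<subseteq> closed_span m (Domain ?A)"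
      using closed_span_base eigenvector_diagonal_operator by blast
  qed
  moreover have "?A = {(u, v). u \<in> ?M \<and> v \<in> ?M \<and> (\<forall>(f, g) \<in> ?A. L2_inner m g u = L2_inner m f v)}"
    (is "_ = ?R")
  proof (intro set_eqI iffI)
    fix p assume p: "p \<in> ?A"
    obtain u v where uv: "p = (u, v)" by (cases p)
    show "p \<in> ?R"
      using p sub diagonal_operator_symmetric[of _ _ \<mu> u v] unfolding uv by auto
  next
    fix p assume p: "p \<in> ?R"
    obtain u v where uv: "p = (u, v)" by (cases p)
    have mem: "u \<in> ?M" "v \<in> ?M"
      and sym: "\<And>f g. (f, g) \<in> ?A \<Longrightarrow> L2_inner m g u = L2_inner m f v"
      using p unfolding uv by auto
    have "L2_inner m v e = of_real (\<mu> e) * L2_inner m u e" if e: "e \<in> E" for e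
    proof -
      have "of_real (\<mu> e) * L2_inner m e u = L2_inner m e v"
        using sym[OF eigenvector_diagonal_operator[OF e]] by (simp add: L2_inner_cmult_left)
      then have "cnj (of_real (\<mu> e) * L2_inner m e u) = cnj (L2_inner m e v)" by simp
      then show ?thesis
        using L2_inner_commute[of m v e] L2_inner_commute[of m u e] by simp
    qed
    with mem show "p \<in> ?A" unfolding uv diagonal_operator_def by auto
  qed
  ultimately show ?thesis using sub unfolding self_adjoint_def by blast
qed

lemma diagonal_operator_pure_point:
  "pure_point_spectrum m (closed_span m E) (diagonal_operator m E \<mu>)"
  unfolding pure_point_spectrum_def
proof (intro conjI exI[of _ E] ballI diagonal_operator_self_adjoint)
  show "orthonormal_basis m (closed_span m E) E"
    using closed_span_base[OF system_L2] inner_system by (auto simp: orthonormal_basis_def)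
  fix u assume "u \<in> E"
  then show "\<exists>z. (u, \<lambda>x. z * u x) \<in> diagonal_operator m E \<mu>"
    using eigenvector_diagonal_operator[of u \<mu>] by blast
qed

text \<open>
  The inverse of \<open>A - z\<close> multiplies the coefficients by \<open>1 / (\<mu>(e) - z)\<close>, and conversely the basis vectors
  themselves test how large the inverse is.
\<close>

lemma resolvent_set_diagonal_operator:
  "z \<in> resolvent_set m (closed_span m E) (diagonal_operator m E \<mu>) \<longleftrightarrow>
    (\<exists>\<delta>>0. \<forall>e\<in>E. \<delta> \<le> cmod (of_real (\<mu> e) - z))" (is "?L \<longleftrightarrow> ?R")
proof
  assume ?L
  then obtain K where K: "\<And>f g. (f, g) \<in> diagonal_operator m E \<mu> \<Longrightarrow>
      L2_norm m f \<le> K * L2_norm m (\<lambda>x. g x - z * f x)"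
    unfolding resolvent_set_def by blast
  have "1 / (\<bar>K\<bar> + 1) \<le> cmod (of_real (\<mu> e) - z)" if e: "e \<in> E" for e
  proof -
    have "complex_of_real ((L2_norm m e)\<^sup>2) = 1"
      unfolding L2_inner_self[symmetric] using e by (simp add: inner_system)
    then have "(L2_norm m e)\<^sup>2 = 1" by (simp only: of_real_eq_1_iff)
    then have 1: "L2_norm m e = 1" using L2_norm_nonneg[of m e] by (simp add: power2_eq_1_iff)
    have "1 \<le> K * L2_norm m (\<lambda>x. of_real (\<mu> e) * e x - z * e x)"
      using K[OF eigenvector_diagonal_operator[OF e]] 1 by simp
    also have "\<dots> = K * cmod (of_real (\<mu> e) - z)"
      using L2_norm_cmult[of m "of_real (\<mu> e) - z" e] 1 by (simp add: left_diff_distrib)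
    also have "\<dots> \<le> (\<bar>K\<bar> + 1) * cmod (of_real (\<mu> e) - z)"
      by (intro mult_right_mono) auto
    finally show ?thesis by (simp add: divide_le_eq mult.commute)
  qed
  then show ?R by (intro exI[of _ "1 / (\<bar>K\<bar> + 1)"]) auto
next
  assume ?R
  then obtain \<delta> where \<delta>: "\<delta> > 0" "\<And>e. e \<in> E \<Longrightarrow> \<delta> \<le> cmod (of_real (\<mu> e) - z)" by blast
  let ?A = "diagonal_operator m E \<mu>"
  let ?M = "closed_span m E"
  show ?L unfolding resolvent_set_def
  proof (intro CollectI conjI)
    show "\<forall>(f, g)\<in>?A. f \<in> ?M \<and> (\<lambda>x. g x - z * f x) \<in> ?M"
      by (auto simp: diagonal_operator_def intro: closed_span_diff closed_span_cmult)
    show "\<forall>h\<in>?M. \<exists>(f, g)\<in>?A. AE x in m. g x - z * f x = h x"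
    proof
      fix h assume h: "h \<in> ?M"
      have hL: "h \<in> L2 m" using h by (rule closed_span_L2)
      have "cmod (1 / (of_real (\<mu> e) - z)) \<le> 1 / \<delta>" if "e \<in> E" for e
        using \<delta>(1) \<delta>(2)[OF that] by (simp add: norm_divide frac_le)
      from multiplier[where \<phi>="\<lambda>e. 1 / (of_real (\<mu> e) - z)", OF hL this] obtain f where f: "f \<in> ?M"
        and co: "\<And>e. e \<in> E \<Longrightarrow> L2_inner m f e = 1 / (of_real (\<mu> e) - z) * L2_inner m h e" by blast
      have fL: "f \<in> L2 m" using f by (rule closed_span_L2)
      define g where "g x = z * f x + h x" for x
      have "L2_inner m g e = of_real (\<mu> e) * L2_inner m f e" if e: "e \<in> E" for e
      proof -
        have "of_real (\<mu> e) - z \<noteq> 0" using \<delta>(1) \<delta>(2)[OF e] by auto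
        then have "L2_inner m h e = (of_real (\<mu> e) - z) * L2_inner m f e"
          using co[OF e] by simp
        moreover have "L2_inner m g e = z * L2_inner m f e + L2_inner m h e"
          unfolding g_def[abs_def] using e system_L2
          by (subst L2_inner_add_left) (auto intro: L2_cmult fL hL simp: L2_inner_cmult_left)
        ultimately show ?thesis by (simp add: algebra_simps)
      qed
      moreover have "g \<in> ?M" unfolding g_def[abs_def] by (intro closed_span_add closed_span_cmult f h)
      ultimately have "(f, g) \<in> ?A" using f by (simp add: diagonal_operator_def)
      moreover have "AE x in m. g x - z * f x = h x" by (simp add: g_def)
      ultimately show "\<exists>(f, g)\<in>?A. AE x in m. g x - z * f x = h x" by blast
    qed
    have "L2_norm m f \<le> 1 / \<delta> * L2_norm m (\<lambda>x. g x - z * f x)" if fg: "(f, g) \<in> ?A" for f g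
    proof (rule norm_le_coefficients)
      have mem: "f \<in> ?M" "g \<in> ?M" using fg by (auto simp: diagonal_operator_def)
      have L: "f \<in> L2 m" "g \<in> L2 m" using mem by (auto dest: closed_span_L2)
      show "f \<in> ?M" "(\<lambda>x. g x - z * f x) \<in> L2 m" "0 \<le> 1 / \<delta>"
        using mem L \<delta>(1) by (auto intro: L2_diff L2_cmult)
      fix e assume e: "e \<in> E"
      have "L2_inner m (\<lambda>x. g x - z * f x) e = (of_real (\<mu> e) - z) * L2_inner m f e"
        using fg e system_L2
        by (subst L2_inner_diff_left)
           (auto intro: L2_cmult L simp: L2_inner_cmult_left diagonal_operator_def left_diff_distrib)
      then have "cmod (L2_inner m (\<lambda>x. g x - z * f x) e) = cmod (of_real (\<mu> e) - z) * cmod (L2_inner m f e)"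
        by (simp add: norm_mult)
      also have "\<dots> \<ge> \<delta> * cmod (L2_inner m f e)" using \<delta>(2)[OF e] by (intro mult_right_mono) auto
      finally show "cmod (L2_inner m f e) \<le> 1 / \<delta> * cmod (L2_inner m (\<lambda>x. g x - z * f x) e)"
        using \<delta>(1) by (simp add: field_simps)
    qed
    then show "\<exists>K. \<forall>(f, g)\<in>?A. L2_norm m f \<le> K * L2_norm m (\<lambda>x. g x - z * f x)" by blast
  qed
qed

theorem spectrum_diagonal_operator:
  "spectrum m (closed_span m E) (diagonal_operator m E \<mu>) = complex_of_real ` closure (\<mu> ` E)"
proof -
  have "z \<in> complex_of_real ` closure (\<mu> ` E) \<longleftrightarrow> \<not> (\<exists>\<delta>>0. \<forall>e\<in>E. \<delta> \<le> cmod (of_real (\<mu> e) - z))" for z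
  proof
    assume "z \<in> complex_of_real ` closure (\<mu> ` E)"
    then obtain x where x: "z = of_real x" "x \<in> closure (\<mu> ` E)" by blast
    have "\<exists>e\<in>E. cmod (of_real (\<mu> e) - z) < \<delta>" if "\<delta> > 0" for \<delta>
    proof -
      obtain e where "e \<in> E" "dist (\<mu> e) x < \<delta>"
        using x(2) \<open>\<delta> > 0\<close> unfolding closure_approachable by blast
      moreover have "cmod (of_real (\<mu> e) - z) = dist (\<mu> e) x"
        unfolding x(1) of_real_diff[symmetric] norm_of_real by (simp add: dist_real_def)
      ultimately show ?thesis by (intro bexI[of _ e]) simp_all
    qed
    then show "\<not> (\<exists>\<delta>>0. \<forall>e\<in>E. \<delta> \<le> cmod (of_real (\<mu> e) - z))" by (meson not_le)
  next
    assume near: "\<not> (\<exists>\<delta>>0. \<forall>e\<in>E. \<delta> \<le> cmod (of_real (\<mu> e) - z))"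
    have "Im z = 0"
    proof (rule ccontr)
      assume "Im z \<noteq> 0"
      moreover have "\<bar>Im z\<bar> \<le> cmod (of_real (\<mu> e) - z)" for e
        using abs_Im_le_cmod[of "of_real (\<mu> e) - z"] by simp
      ultimately show False using near by (metis zero_less_abs_iff)
    qed
    then have z: "z = of_real (Re z)" by (simp add: complex_eq_iff)
    have "Re z \<in> closure (\<mu> ` E)"
      unfolding closure_approachable
    proof (intro allI impI)
      fix \<delta> :: real assume "\<delta> > 0"
      then obtain e where e: "e \<in> E" "cmod (of_real (\<mu> e) - z) < \<delta>" using near by (meson not_le)
      have "cmod (of_real (\<mu> e) - z) = dist (\<mu> e) (Re z)"
        by (subst z, unfold of_real_diff[symmetric] norm_of_real) (simp add: dist_real_def)
      with e show "\<exists>y\<in>\<mu> ` E. dist y (Re z) < \<delta>" by auto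
    qed
    with z show "z \<in> complex_of_real ` closure (\<mu> ` E)" by blast
  qed
  then show ?thesis
    unfolding spectrum_def by (intro set_eqI) (simp only: Compl_iff resolvent_set_diagonal_operator)
qed

end

section \<open>Closures of symmetric operators with eigenvectors\<close>

text \<open>
  The abstract form of the argument. If the eigenvectors \<open>E\<close> and the functions \<open>W\<close> lie in the domain of the
  symmetric operator \<open>T\<close>, are orthogonal to each other and are total together, then the orthogonal
  complement of \<open>W\<close> is the closed span of \<open>E\<close>; by symmetry \<open>T\<close> maps \<open>W\<close> into the orthogonal complement of
  \<open>E\<close>, so the closure of \<open>T\<close> leaves the closed span of \<open>E\<close> invariant and is diagonal there.
\<close>

locale symmetric_operator_with_eigenvectors = orthonormal_system +
  fixes D W :: "('a \<Rightarrow> complex) set" and T :: "('a \<Rightarrow> complex) \<Rightarrow> 'a \<Rightarrow> complex"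
    and \<mu> :: "('a \<Rightarrow> complex) \<Rightarrow> real"
  assumes domain_L2: "D \<subseteq> L2 m" and range_L2: "\<And>f. f \<in> D \<Longrightarrow> T f \<in> L2 m"
    and domain_zero: "(\<lambda>x. 0) \<in> D"
    and domain_add: "\<And>f g. f \<in> D \<Longrightarrow> g \<in> D \<Longrightarrow> (\<lambda>x. f x + g x) \<in> D"
    and domain_cmult: "\<And>c f. f \<in> D \<Longrightarrow> (\<lambda>x. c * f x) \<in> D"
    and operator_comb: "\<And>F c. finite F \<Longrightarrow> F \<subseteq> D \<Longrightarrow>
      T (\<lambda>x. \<Sum>u\<in>F. c u * u x) = (\<lambda>x. \<Sum>u\<in>F. c u * T u x)"
    and symmetric: "\<And>f g. f \<in> D \<Longrightarrow> g \<in> D \<Longrightarrow> L2_inner m (T f) g = L2_inner m f (T g)"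
    and system_domain: "E \<subseteq> D" and eigenvector: "\<And>e. e \<in> E \<Longrightarrow> T e = (\<lambda>x. of_real (\<mu> e) * e x)"
    and W_domain: "W \<subseteq> D" and W_orthogonal: "\<And>w e. w \<in> W \<Longrightarrow> e \<in> E \<Longrightarrow> L2_inner m e w = 0"
    and total: "\<And>f. f \<in> L2 m \<Longrightarrow> (\<And>u. u \<in> E \<union> W \<Longrightarrow> L2_inner m f u = 0) \<Longrightarrow> AE x in m. f x = 0"
begin

lemma orthogonal_to_W:
  assumes "f \<in> closed_span m E" "w \<in> W"
  shows "L2_inner m f w = 0"
  using closed_span_orthogonal[OF system_L2, of w] assms W_orthogonal W_domain domain_L2 by blast

lemma closed_span_if_orthogonal_to_W:
  assumes f: "f \<in> L2 m" and orth: "\<And>w. w \<in> W \<Longrightarrow> L2_inner m f w = 0"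
  shows "f \<in> closed_span m E"
proof -
  obtain p where p: "p \<in> closed_span m E" "\<And>e. e \<in> E \<Longrightarrow> L2_inner m p e = L2_inner m f e"
    using projection[OF f] by blast
  have pL: "p \<in> L2 m" using p(1) by (rule closed_span_L2)
  have "AE x in m. f x - p x = 0"
  proof (rule total[OF L2_diff[OF f pL]])
    fix u assume u: "u \<in> E \<union> W"
    then have "u \<in> L2 m" using W_domain domain_L2 system_L2 by blast
    then have "L2_inner m (\<lambda>x. f x - p x) u = L2_inner m f u - L2_inner m p u"
      by (rule L2_inner_diff_left[OF f pL])
    with u p(2) orth orthogonal_to_W[OF p(1)] show "L2_inner m (\<lambda>x. f x - p x) u = 0" by auto
  qed
  then have "L2_norm m (\<lambda>x. f x - p x) = 0"
    using L2_norm_eq_0_iff[OF L2_diff[OF f pL]] by simp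
  with p(1) show ?thesis by (intro closed_span_closed[OF f] bexI[of _ p]) simp_all
qed

lemma orth_complement_W: "orth_complement m (closed_span m W) = closed_span m E"
proof (intro set_eqI iffI)
  have WL: "W \<subseteq> L2 m" using W_domain domain_L2 by blast
  fix f
  { assume "f \<in> orth_complement m (closed_span m W)"
    then have "f \<in> L2 m" "\<And>w. w \<in> W \<Longrightarrow> L2_inner m f w = 0"
      using closed_span_base[OF WL] by (auto simp: orth_complement_def)
    then show "f \<in> closed_span m E" by (rule closed_span_if_orthogonal_to_W) }
  { assume f: "f \<in> closed_span m E"
    have fL: "f \<in> L2 m" using f by (rule closed_span_L2)
    have "L2_inner m w f = 0" if "w \<in> closed_span m W" for w
    proof (rule closed_span_orthogonal[OF WL fL _ that])
      fix g assume "g \<in> W"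
      then show "L2_inner m g f = 0"
        using orthogonal_to_W[OF f] L2_inner_commute[of m g f] by simp
    qed
    then have "L2_inner m f w = 0" if "w \<in> closed_span m W" for w
      using that L2_inner_commute[of m f w] by simp
    with fL show "f \<in> orth_complement m (closed_span m W)" by (simp add: orth_complement_def) }
qed

lemma closure_symmetric:
  assumes fg: "(f, g) \<in> op_closure m {(f, T f) | f. f \<in> D}" and h: "h \<in> D"
  shows "L2_inner m g h = L2_inner m f (T h)"
proof -
  have L: "f \<in> L2 m" "g \<in> L2 m" using fg by (auto simp: op_closure_def)
  have hL: "h \<in> L2 m" "T h \<in> L2 m" using h domain_L2 range_L2 by auto
  have "cmod (L2_inner m g h - L2_inner m f (T h)) \<le> 0 + \<epsilon>" if "\<epsilon> > 0" for \<epsilon>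
  proof -
    define K where "K = L2_norm m h + L2_norm m (T h) + 1"
    have "K > 0" by (simp add: K_def add_nonneg_pos)
    then have "\<epsilon> / K > 0" using that by simp
    with fg obtain u where u: "u \<in> D" "L2_norm m (\<lambda>x. f x - u x) < \<epsilon> / K"
        "L2_norm m (\<lambda>x. g x - T u x) < \<epsilon> / K"
      unfolding op_closure_def by blast
    have uL: "u \<in> L2 m" "T u \<in> L2 m" using u domain_L2 range_L2 by auto
    have "L2_inner m g h - L2_inner m f (T h) =
        L2_inner m (\<lambda>x. g x - T u x) h - L2_inner m (\<lambda>x. f x - u x) (T h)"
      using symmetric[OF u(1) h] by (simp add: L2_inner_diff_left L hL uL)
    then have "cmod (L2_inner m g h - L2_inner m f (T h)) \<le>
        cmod (L2_inner m (\<lambda>x. g x - T u x) h) + cmod (L2_inner m (\<lambda>x. f x - u x) (T h))"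
      by (simp add: norm_triangle_ineq4)
    also have "\<dots> \<le> L2_norm m (\<lambda>x. g x - T u x) * L2_norm m h + L2_norm m (\<lambda>x. f x - u x) * L2_norm m (T h)"
      by (intro add_mono L2_Cauchy_Schwarz L L2_diff uL hL)
    also have "\<dots> \<le> \<epsilon> / K * L2_norm m h + \<epsilon> / K * L2_norm m (T h)"
      using u by (intro add_mono mult_right_mono) auto
    also have "\<dots> \<le> \<epsilon> / K * K"
      unfolding distrib_left[symmetric] using \<open>\<epsilon> / K > 0\<close>
      by (intro mult_left_mono) (auto simp: K_def)
    also have "\<dots> = \<epsilon>" using \<open>K > 0\<close> by simp
    finally show ?thesis by simp
  qed
  then have "cmod (L2_inner m g h - L2_inner m f (T h)) \<le> 0" by (rule field_le_epsilon)
  then show ?thesis by simp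
qed

theorem restricted_closure_diagonal:
  "op_restrict (op_closure m {(f, T f) | f. f \<in> D}) (closed_span m E) = diagonal_operator m E \<mu>"
proof (intro set_eqI iffI; clarify)
  fix f g
  assume "(f, g) \<in> op_restrict (op_closure m {(f, T f) | f. f \<in> D}) (closed_span m E)"
  then have fg: "(f, g) \<in> op_closure m {(f, T f) | f. f \<in> D}" and f: "f \<in> closed_span m E"
    by (auto simp: op_restrict_def)
  have L: "f \<in> L2 m" "g \<in> L2 m" using fg by (auto simp: op_closure_def)
  have "L2_inner m g w = 0" if w: "w \<in> W" for w
  proof -
    have wD: "w \<in> D" using w W_domain by blast
    have "L2_inner m e (T w) = 0" if e: "e \<in> E" for e
    proof -
      have "L2_inner m e (T w) = L2_inner m (T e) w"
        using symmetric e wD system_domain by (metis subsetD)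
      also have "\<dots> = 0"
        using e w by (simp add: eigenvector L2_inner_cmult_left W_orthogonal)
      finally show ?thesis .
    qed
    then have "L2_inner m f (T w) = 0"
      by (rule closed_span_orthogonal[OF system_L2 range_L2[OF wD] _ f])
    then show ?thesis using closure_symmetric[OF fg wD] by simp
  qed
  then have "g \<in> closed_span m E" by (rule closed_span_if_orthogonal_to_W[OF L(2)])
  moreover have "L2_inner m g e = of_real (\<mu> e) * L2_inner m f e" if e: "e \<in> E" for e
    using closure_symmetric[OF fg, of e] e system_domain
    by (auto simp: eigenvector L2_inner_cmult_right)
  ultimately show "(f, g) \<in> diagonal_operator m E \<mu>"
    using f by (simp add: diagonal_operator_def)
next
  fix f g
  assume "(f, g) \<in> diagonal_operator m E \<mu>"
  then have f: "f \<in> closed_span m E" and g: "g \<in> closed_span m E"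
    and co: "\<And>e. e \<in> E \<Longrightarrow> L2_inner m g e = of_real (\<mu> e) * L2_inner m f e"
    by (auto simp: diagonal_operator_def)
  have "\<exists>u\<in>D. L2_norm m (\<lambda>x. f x - u x) < \<epsilon> \<and> L2_norm m (\<lambda>x. g x - T u x) < \<epsilon>" if "\<epsilon> > 0" for \<epsilon>
  proof -
    obtain F1 where F1: "finite F1" "F1 \<subseteq> E" "\<And>G. finite G \<Longrightarrow> F1 \<subseteq> G \<Longrightarrow> G \<subseteq> E \<Longrightarrow>
        L2_norm m (\<lambda>x. f x - (\<Sum>e\<in>G. L2_inner m f e * e x)) < \<epsilon>"
      using fourier_approximation[OF f \<open>\<epsilon> > 0\<close>] by blast
    obtain F2 where F2: "finite F2" "F2 \<subseteq> E" "\<And>G. finite G \<Longrightarrow> F2 \<subseteq> G \<Longrightarrow> G \<subseteq> E \<Longrightarrow>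
        L2_norm m (\<lambda>x. g x - (\<Sum>e\<in>G. L2_inner m g e * e x)) < \<epsilon>"
      using fourier_approximation[OF g \<open>\<epsilon> > 0\<close>] by blast
    define G where "G = F1 \<union> F2"
    have G: "finite G" "G \<subseteq> E" using F1 F2 by (auto simp: G_def)
    define u where "u = (\<lambda>x. \<Sum>e\<in>G. L2_inner m f e * e x)"
    have "T u = (\<lambda>x. \<Sum>e\<in>G. L2_inner m f e * T e x)"
      unfolding u_def using G system_domain by (intro operator_comb) auto
    also have "\<dots> = (\<lambda>x. \<Sum>e\<in>G. L2_inner m g e * e x)"
      using G(2) by (intro ext sum.cong refl) (auto simp: eigenvector co)
    finally have "T u = (\<lambda>x. \<Sum>e\<in>G. L2_inner m g e * e x)" .
    moreover have "u \<in> D"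
      unfolding u_def by (rule sum_in_linear_subspace)
        (use G system_domain domain_zero domain_add domain_cmult in auto)
    ultimately show ?thesis
      using F1(3)[OF G(1) _ G(2)] F2(3)[OF G(1) _ G(2)]
      by (intro bexI[of _ u]) (auto simp: G_def u_def)
  qed
  then have "(f, g) \<in> op_closure m {(f, T f) | f. f \<in> D}"
    using closed_span_L2[OF f] closed_span_L2[OF g] unfolding op_closure_def by blast
  with f show "(f, g) \<in> op_restrict (op_closure m {(f, T f) | f. f \<in> D}) (closed_span m E)"
    by (simp add: op_restrict_def)
qed

end


section \<open>Geometry of balls\<close>

context homogeneous_ultrametric_measure_space
begin

lemma cball_recentre:
  fixes x y :: 'a
  assumes "y \<in> cball x r"
  shows "cball y r = cball x r"
proof -
  have "cball u r \<subseteq> cball v r" if "dist u v \<le> r" for u v :: 'a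
  proof
    fix z assume "z \<in> cball u r"
    then show "z \<in> cball v r"
      using ultrametric[of v z u] that by (simp add: dist_commute)
  qed
  then show ?thesis using assms by (metis dist_commute mem_cball subset_antisym)
qed

lemma cball_in_balls: "r > 0 \<Longrightarrow> cball x r \<in> balls"
  unfolding balls_def by blast

lemma ball_compact: "(B :: 'a set) \<in> balls \<Longrightarrow> compact B"
  using compact_balls by (auto simp: balls_def)

lemma ball_bounded: "(B :: 'a set) \<in> balls \<Longrightarrow> bounded B"
  using ball_compact compact_imp_bounded by blast

lemma ball_nonempty: "(B :: 'a set) \<in> balls \<Longrightarrow> B \<noteq> {}"
  by (auto simp: balls_def cball_eq_empty)

lemma ball_centre:
  fixes B :: "'a set"
  assumes "B \<in> balls" "x \<in> B"
  shows "\<exists>r>0. B = cball x r"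
  using assms cball_recentre unfolding balls_def by blast

lemma cball_open:
  fixes x :: 'a
  assumes "r > 0"
  shows "open (cball x r)"
  unfolding open_contains_cball using assms cball_recentre by blast

lemma ball_open: "(B :: 'a set) \<in> balls \<Longrightarrow> open B"
  using cball_open by (auto simp: balls_def)

lemma diameter_ball_nonneg: "(B :: 'a set) \<in> balls \<Longrightarrow> 0 \<le> diameter B"
  by (rule diameter_ge_0[OF ball_bounded])

text \<open>
  Every point of a ball is a centre, and the diameter is the smallest radius. Balls through a common point
  are thus determined by their diameters.
\<close>

lemma ball_eq_cball_diameter:
  fixes B :: "'a set"
  assumes B: "B \<in> balls" and x: "x \<in> B"
  shows "B = cball x (diameter B)"
proof
  show "B \<subseteq> cball x (diameter B)"
    using diameter_bounded_bound[OF ball_bounded[OF B] x] by auto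
  obtain r where r: "r > 0" "B = cball x r" using ball_centre[OF assms] by blast
  obtain y z where yz: "y \<in> B" "z \<in> B" "dist y z = diameter B"
    using diameter_compact_attained[OF ball_compact[OF B] ball_nonempty[OF B]] by blast
  then have "diameter B \<le> r"
    using ultrametric[of y z x] r by (simp add: dist_commute)
  then show "cball x (diameter B) \<subseteq> B" using r(2) by auto
qed

lemma balls_eqI:
  fixes A B :: "'a set"
  assumes "A \<in> balls" "B \<in> balls" "x \<in> A" "x \<in> B" "diameter A = diameter B"
  shows "A = B"
  using ball_eq_cball_diameter[of A x] ball_eq_cball_diameter[of B x] assms by simp

lemma balls_nested:
  fixes A B :: "'a set"
  assumes "A \<in> balls" "B \<in> balls" "x \<in> A" "x \<in> B"
  shows "A \<subseteq> B \<or> B \<subseteq> A"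
proof (cases "diameter A \<le> diameter B")
  case True
  then have "cball x (diameter A) \<subseteq> cball x (diameter B)" by auto
  then show ?thesis using ball_eq_cball_diameter[of A x] ball_eq_cball_diameter[of B x] assms by simp
next
  case False
  then have "cball x (diameter B) \<subseteq> cball x (diameter A)" by auto
  then show ?thesis using ball_eq_cball_diameter[of A x] ball_eq_cball_diameter[of B x] assms by simp
qed

lemma balls_nested':
  fixes A B :: "'a set"
  assumes "A \<in> balls" "B \<in> balls" "A \<inter> B \<noteq> {}"
  shows "A \<subseteq> B \<or> B \<subseteq> A"
  using assms balls_nested by blast

lemma diameter_strict_mono:
  fixes A B :: "'a set"
  assumes "A \<in> balls" "B \<in> balls" "A \<subset> B"
  shows "diameter A < diameter B"
proof -
  have "diameter A \<le> diameter B"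
    using assms ball_bounded by (intro diameter_subset) auto
  moreover have "diameter A \<noteq> diameter B"
    using assms balls_eqI ball_nonempty by (metis all_not_in_conv psubsetD psubset_eq)
  ultimately show ?thesis by simp
qed

text \<open>A ball between \<open>A\<close> and a compact \<open>K\<close> is a union of members of one finite cover of \<open>K\<close> by balls of the size of \<open>A\<close>.\<close>

lemma finite_balls_between:
  fixes A K :: "'a set"
  assumes A: "A \<in> balls" and K: "compact K"
  shows "finite {U \<in> balls. A \<subseteq> U \<and> U \<subseteq> K}"
proof -
  obtain x \<delta> where \<delta>: "\<delta> > 0" "A = cball x \<delta>" using A unfolding balls_def by blast
  have "K \<subseteq> (\<Union>y\<in>K. cball y \<delta>)" using \<delta>(1) by force
  then obtain F where F: "finite F" "K \<subseteq> (\<Union>y\<in>F. cball y \<delta>)"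
    using compactE_image[OF K, of K "\<lambda>y. cball y \<delta>"] cball_open[OF \<delta>(1)] by metis
  have incl: "cball y \<delta> \<subseteq> U" if U: "U \<in> balls" "A \<subseteq> U" "z \<in> U" "z \<in> cball y \<delta>" for U y z
  proof -
    obtain r where r: "r > 0" "U = cball x r"
      using ball_centre[OF U(1), of x] U(2) \<delta> by force
    have zr: "U = cball z r" "cball y \<delta> = cball z \<delta>"
      using U(3,4) cball_recentre unfolding r(2) by blast+
    show ?thesis
    proof (cases "\<delta> \<le> r")
      case True
      then show ?thesis using zr by auto
    next
      case False
      then have "U \<subseteq> A" unfolding r(2) \<delta>(2) by auto
      then have "U = A" using U(2) by blast
      then show ?thesis using cball_recentre[of z x \<delta>] U(3) zr(2) \<delta>(2) by simp
    qed
  qed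
  have "inj_on (\<lambda>U. {y\<in>F. cball y \<delta> \<inter> U \<noteq> {}}) {U \<in> balls. A \<subseteq> U \<and> U \<subseteq> K}"
  proof (rule inj_onI)
    fix U V
    assume U: "U \<in> {U \<in> balls. A \<subseteq> U \<and> U \<subseteq> K}" and V: "V \<in> {U \<in> balls. A \<subseteq> U \<and> U \<subseteq> K}"
      and eq: "{y\<in>F. cball y \<delta> \<inter> U \<noteq> {}} = {y\<in>F. cball y \<delta> \<inter> V \<noteq> {}}"
    have "W = (\<Union>y\<in>{y\<in>F. cball y \<delta> \<inter> W \<noteq> {}}. cball y \<delta>)"
      if W: "W \<in> {U \<in> balls. A \<subseteq> U \<and> U \<subseteq> K}" for W
    proof
      show "W \<subseteq> (\<Union>y\<in>{y\<in>F. cball y \<delta> \<inter> W \<noteq> {}}. cball y \<delta>)"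
        using W F(2) by blast
      show "(\<Union>y\<in>{y\<in>F. cball y \<delta> \<inter> W \<noteq> {}}. cball y \<delta>) \<subseteq> W"
        using W incl by blast
    qed
    from this[OF U] this[OF V] eq show "U = V" by simp
  qed
  moreover have "(\<lambda>U. {y\<in>F. cball y \<delta> \<inter> U \<noteq> {}}) ` {U \<in> balls. A \<subseteq> U \<and> U \<subseteq> K} \<subseteq> Pow F" by auto
  ultimately show ?thesis using F(1) by (meson finite_Pow_iff inj_on_finite)
qed

lemma larger_ball_through:
  fixes T :: "'a set"
  assumes T: "T \<in> balls"
  shows "\<exists>R\<in>balls. T \<subseteq> R \<and> z \<in> R"
proof -
  obtain x where x: "x \<in> T" using ball_nonempty[OF T] by blast
  obtain r where r: "r > 0" "T = cball x r" using ball_centre[OF T x] by blast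
  then show ?thesis
    by (intro bexI[of _ "cball x (max r (dist x z))"] cball_in_balls) auto
qed

text \<open>
  A compact ball is not the whole space, so a larger ball exists, and between the two there are only
  finitely many balls.
\<close>

lemma parent_properties:
  fixes T :: "'a set"
  assumes T: "T \<in> balls"
  shows "parent T \<in> balls \<and> T \<subset> parent T \<and> (\<forall>U\<in>balls. T \<subset> U \<longrightarrow> parent T \<subseteq> U)"
proof -
  have "T \<noteq> UNIV" using ball_compact[OF T] noncompact by auto
  then obtain z where z: "z \<notin> T" by blast
  obtain R where R: "R \<in> balls" "T \<subseteq> R" "z \<in> R" using larger_ball_through[OF T] by blast
  define \<U> where "\<U> = {U \<in> balls. T \<subset> U \<and> U \<subseteq> R}"
  have "finite \<U>"
    using finite_balls_between[OF T ball_compact[OF R(1)]] by (rule rev_finite_subset) (auto simp: \<U>_def)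
  moreover have "R \<in> \<U>" using R z by (auto simp: \<U>_def)
  ultimately obtain S where S: "S \<in> \<U>" "\<And>U. U \<in> \<U> \<Longrightarrow> U \<subseteq> S \<Longrightarrow> S = U"
    using finite_has_minimal[of \<U>] by blast
  have least: "S \<subseteq> U" if U: "U \<in> balls" "T \<subset> U" for U
  proof -
    obtain x where "x \<in> T" using ball_nonempty[OF T] by blast
    then have "S \<subseteq> U \<or> U \<subseteq> S" using balls_nested[of S U x] S(1) U by (auto simp: \<U>_def)
    moreover have "S = U" if "U \<subseteq> S"
    proof (rule S(2)[OF _ that])
      show "U \<in> \<U>" using that S(1) U unfolding \<U>_def by blast
    qed
    ultimately show ?thesis by blast
  qed
  have "parent T = S"
    unfolding parent_def
  proof (rule the_equality)
    show "S \<in> balls \<and> T \<subset> S \<and> (\<forall>U\<in>balls. T \<subset> U \<longrightarrow> S \<subseteq> U)"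
      using S(1) least by (auto simp: \<U>_def)
  next
    fix S' assume "S' \<in> balls \<and> T \<subset> S' \<and> (\<forall>U\<in>balls. T \<subset> U \<longrightarrow> S' \<subseteq> U)"
    then show "S' = S" using S(1) least by (auto simp: \<U>_def)
  qed
  then show ?thesis using S(1) least by (auto simp: \<U>_def)
qed

lemma parent_ball: "(T :: 'a set) \<in> balls \<Longrightarrow> parent T \<in> balls"
  and parent_psubset: "(T :: 'a set) \<in> balls \<Longrightarrow> T \<subset> parent T"
  and parent_least: "(T :: 'a set) \<in> balls \<Longrightarrow> U \<in> balls \<Longrightarrow> T \<subset> U \<Longrightarrow> parent T \<subseteq> U"
  using parent_properties by blast+

lemma diameter_parent_pos: "(T :: 'a set) \<in> balls \<Longrightarrow> 0 < diameter (parent T)"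
  using diameter_strict_mono[OF _ parent_ball parent_psubset] diameter_ball_nonneg[of T] by force

text \<open>
  The child is a maximal ball among the finitely many proper subballs of \<open>S\<close> that contain a small ball around \<open>x\<close>.
\<close>

lemma child_through:
  fixes S :: "'a set"
  assumes S: "S \<in> balls" and pos: "diameter S > 0" and x: "x \<in> S"
  shows "\<exists>T\<in>balls. x \<in> T \<and> parent T = S"
proof -
  obtain y z where yz: "y \<in> S" "z \<in> S" "dist y z = diameter S"
    using diameter_compact_attained[OF ball_compact[OF S] ball_nonempty[OF S]] by blast
  then obtain w where w: "w \<in> S" "w \<noteq> x" using pos by (metis dist_self order_less_irrefl)
  define T0 where "T0 = cball x (dist x w / 2)"
  have T0: "T0 \<in> balls" "x \<in> T0" "w \<notin> T0"
    using w by (auto simp: T0_def intro!: cball_in_balls)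
  then have sub: "T0 \<subset> S" using balls_nested[OF T0(1) S T0(2) x] w by blast
  define \<U> where "\<U> = {U \<in> balls. T0 \<subseteq> U \<and> U \<subset> S}"
  have "finite \<U>"
    using finite_balls_between[OF T0(1) ball_compact[OF S]] by (rule rev_finite_subset) (auto simp: \<U>_def)
  moreover have "T0 \<in> \<U>" using T0 sub by (auto simp: \<U>_def)
  ultimately obtain T where T: "T \<in> \<U>" "\<And>U. U \<in> \<U> \<Longrightarrow> T \<subseteq> U \<Longrightarrow> T = U"
    using finite_has_maximal[of \<U>] by blast
  have TB: "T \<in> balls" "T0 \<subseteq> T" "T \<subset> S" using T(1) by (auto simp: \<U>_def)
  have "parent T = S"
  proof (rule ccontr)
    assume "parent T \<noteq> S"
    then have "parent T \<subset> S" using parent_least[OF TB(1) S TB(3)] by blast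
    then have "parent T \<in> \<U>"
      using TB parent_ball[OF TB(1)] parent_psubset[OF TB(1)] by (auto simp: \<U>_def)
    then have "T = parent T" using T(2) parent_psubset[OF TB(1)] by blast
    then show False using parent_psubset[OF TB(1)] by blast
  qed
  then show ?thesis using TB T0(2) by blast
qed

lemma siblings_disjoint:
  fixes T U :: "'a set"
  assumes "T \<in> balls" "U \<in> balls" "parent T = parent U" "T \<noteq> U"
  shows "T \<inter> U = {}"
proof (rule ccontr)
  assume "T \<inter> U \<noteq> {}"
  then have "T \<subset> U \<or> U \<subset> T" using balls_nested'[of T U] assms by blast
  then show False
    using parent_least[OF assms(1,2)] parent_least[OF assms(2,1)] parent_psubset[OF assms(1)]
      parent_psubset[OF assms(2)] assms(3) by blast
qed

text \<open>
  The children are disjoint nonempty open sets covering a compact set.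
\<close>

lemma finite_children:
  fixes S :: "'a set"
  assumes S: "S \<in> balls"
  shows "finite {T \<in> balls. parent T = S}" (is "finite ?C")
proof (cases "?C = {}")
  case False
  then have pos: "diameter S > 0" using diameter_parent_pos by blast
  have "S \<subseteq> \<Union>?C"
  proof
    fix x assume "x \<in> S"
    from child_through[OF S pos this] show "x \<in> \<Union>?C" by blast
  qed
  then obtain \<F> where \<F>: "\<F> \<subseteq> ?C" "finite \<F>" "S \<subseteq> \<Union>\<F>"
  proof (rule compactE[OF ball_compact[OF S]])
    show "open B" if "B \<in> ?C" for B using that ball_open by simp
  qed
  have "?C \<subseteq> \<F>"
  proof
    fix T assume T: "T \<in> ?C"
    obtain x where x: "x \<in> T" using T ball_nonempty by blast
    then have "x \<in> S" using T parent_psubset by blast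
    then obtain U where U: "U \<in> \<F>" "x \<in> U" using \<F>(3) by blast
    then have "T = U" using siblings_disjoint[of T U] T \<F>(1) x by blast
    with U show "T \<in> \<F>" by simp
  qed
  with \<F>(2) show ?thesis by (rule rev_finite_subset)
qed (simp only: finite.emptyI)


section \<open>Isometries and horocycles\<close>

lemma isometry_cball:
  assumes "g \<in> isometries"
  shows "g ` cball x r = cball (g x) r"
proof -
  have g: "surj g" "\<And>x y. dist (g x) (g y) = dist x y" using assms by (auto simp: isometries_def bij_def)
  show ?thesis
  proof
    show "cball (g x) r \<subseteq> g ` cball x r"
    proof
      fix z assume z: "z \<in> cball (g x) r"
      obtain w where "z = g w" using g(1) by blast
      with z show "z \<in> g ` cball x r" by (auto simp: g(2))
    qed
  qed (auto simp: g(2))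
qed

lemma isometry_ball: "g \<in> isometries \<Longrightarrow> B \<in> balls \<Longrightarrow> g ` B \<in> balls"
  unfolding balls_def by (auto simp: isometry_cball) blast

lemma isometry_inv: "g \<in> isometries \<Longrightarrow> inv g \<in> isometries"
proof -
  assume "g \<in> isometries"
  then have g: "bij g" "\<And>x y. dist (g x) (g y) = dist x y" by (auto simp: isometries_def)
  have "dist (inv g x) (inv g y) = dist x y" for x y
    using g(2)[of "inv g x" "inv g y"] by (simp add: surj_f_inv_f[OF bij_is_surj[OF g(1)]])
  with bij_imp_bij_inv[OF g(1)] show ?thesis by (simp add: isometries_def)
qed

lemma diameter_isometry:
  fixes B :: "'a set"
  assumes g: "g \<in> isometries"
  shows "diameter (g ` B) = diameter B"
proof -
  have d: "dist (g x) (g y) = dist x y" for x y using g by (auto simp: isometries_def)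
  have "(SUP (x, y)\<in>g ` B \<times> g ` B. dist x y) = (SUP (x, y)\<in>B \<times> B. dist x y)"
    by (rule arg_cong[of _ _ Sup]) (force simp: d image_iff)
  then show ?thesis unfolding diameter_def by simp
qed

lemma diameter_cball_cong: "diameter (cball (x::'a) r) = diameter (cball (y::'a) r)"
proof -
  obtain g where "g \<in> isometries" "g x = y" using transitive by blast
  then show ?thesis using diameter_isometry[of g "cball x r"] isometry_cball[of g x r] by simp
qed

lemma horocycle_eq_cballs:
  fixes \<H> :: "'a set set"
  assumes "horocycle \<H>"
  shows "\<exists>r>0. \<H> = range (\<lambda>x. cball x r)"
proof -
  obtain B :: "'a set" where B: "B \<in> balls" "\<H> = {A\<in>balls. diameter A = diameter B}"
    using assms unfolding horocycle_def by blast
  obtain x r where r: "r > 0" "B = cball x r" using B(1) unfolding balls_def by blast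
  have "A \<in> \<H> \<longleftrightarrow> A \<in> range (\<lambda>x. cball x r)" for A
  proof
    assume "A \<in> \<H>"
    then have A: "A \<in> balls" "diameter A = diameter B" using B by auto
    obtain a where a: "a \<in> A" using ball_nonempty[OF A(1)] by blast
    have "A = cball a r"
    proof (rule balls_eqI[OF A(1) cball_in_balls[OF r(1)] a])
      show "a \<in> cball a r" using r(1) by simp
      show "diameter A = diameter (cball a r)"
        using A(2) diameter_cball_cong[of a r x] r(2) by simp
    qed
    then show "A \<in> range (\<lambda>x. cball x r)" by blast
  next
    assume "A \<in> range (\<lambda>x. cball x r)"
    then show "A \<in> \<H>"
      unfolding B(2) r(2) using cball_in_balls[OF r(1)] diameter_cball_cong[of _ r x] by blast
  qed
  with r(1) show ?thesis by blast
qed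


section \<open>Indicators of balls are total\<close>

lemma sets_m: "sets m = sets borel" and space_m: "space m = UNIV"
  using radon sets_eq_imp_space_eq[of m borel] by (auto simp: radon_measure_def)

lemma ball_sets: "B \<in> balls \<Longrightarrow> B \<in> sets m"
  using ball_open by (simp add: sets_m borel_open)

lemma emeasure_ball_finite: "B \<in> balls \<Longrightarrow> emeasure m B < \<infinity>"
  using ball_compact radon by (simp add: radon_measure_def)

lemma measure_ball_pos:
  assumes "B \<in> balls"
  shows "measure m B > 0"
  using full_support[OF ball_open[OF assms] ball_nonempty[OF assms]] emeasure_ball_finite[OF assms]
  by (simp add: measure_def enn2real_positive_iff)

lemma sigma_finite_m: "sigma_finite_measure m"
proof
  fix x0 :: 'a
  have "range (\<lambda>n::nat. cball x0 (real n + 1)) \<subseteq> balls" by (auto intro: cball_in_balls)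
  moreover have "\<Union>(range (\<lambda>n::nat. cball x0 (real n + 1))) = UNIV"
  proof -
    have "x \<in> \<Union>(range (\<lambda>n::nat. cball x0 (real n + 1)))" for x
    proof -
      obtain n :: nat where "dist x0 x \<le> real n" using real_arch_simple by blast
      then show ?thesis by (auto intro!: exI[of _ n])
    qed
    then show ?thesis by blast
  qed
  moreover have "countable (range (\<lambda>n::nat. cball x0 (real n + 1)))" by simp
  ultimately show "\<exists>A. countable A \<and> A \<subseteq> sets m \<and> \<Union>A = space m \<and> (\<forall>a\<in>A. emeasure m a \<noteq> \<infinity>)"
    using ball_sets emeasure_ball_finite space_m
    by (intro exI[of _ "range (\<lambda>n::nat. cball x0 (real n + 1))"]) (auto simp: less_top[symmetric] subset_iff)
qed

text \<open>
  The space is a countable union of compact balls, and each of these is covered by finitely many balls of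
  radius \<open>1 / (k + 1)\<close>; any ball of that radius is centred at each of its points.
\<close>

lemma countable_ball_base:
  "\<exists>\<K>\<subseteq>balls. countable \<K> \<and> (\<forall>U::'a set. open U \<longrightarrow> (\<forall>x\<in>U. \<exists>K\<in>\<K>. x \<in> K \<and> K \<subseteq> U))"
proof -
  fix x0 :: 'a
  have "\<exists>F. finite F \<and> cball x0 (real n) \<subseteq> (\<Union>y\<in>F. cball y (1 / Suc k))" for n k :: nat
  proof -
    have "cball x0 (real n) \<subseteq> (\<Union>y\<in>cball x0 (real n). cball y (1 / Suc k))" by force
    then show ?thesis
      using compactE_image[OF compact_balls, of "cball x0 (real n)" "\<lambda>y. cball y (1 / Suc k)" x0 "real n"]
        cball_open[of "1 / Suc k"] by (metis of_nat_0_less_iff zero_less_Suc zero_less_divide_1_iff)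
  qed
  then obtain F where F: "\<And>n k. finite (F n k)" "\<And>n k. cball x0 (real n) \<subseteq> (\<Union>y\<in>F n k. cball y (1 / Suc k))"
    by metis
  define \<K> where "\<K> = (\<Union>n. \<Union>k. (\<lambda>y. cball y (1 / Suc k)) ` F n k)"
  have "\<exists>K\<in>\<K>. x \<in> K \<and> K \<subseteq> U" if U: "open U" "x \<in> U" for U x
  proof -
    obtain \<epsilon> where \<epsilon>: "\<epsilon> > 0" "cball x \<epsilon> \<subseteq> U" using U open_contains_cball by blast
    obtain k :: nat where k: "1 / Suc k < \<epsilon>" using nat_approx_posE[OF \<epsilon>(1)] by blast
    obtain n :: nat where "dist x0 x \<le> real n" using real_arch_simple by blast
    then obtain y where y: "y \<in> F n k" "x \<in> cball y (1 / Suc k)" using F(2)[of n k] by auto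
    then have "cball y (1 / Suc k) = cball x (1 / Suc k)" using cball_recentre by blast
    also have "\<dots> \<subseteq> U" using k \<epsilon>(2) by (metis order_less_imp_le order_trans subset_cball)
    finally have "cball y (1 / Suc k) \<subseteq> U" .
    moreover have "cball y (1 / Suc k) \<in> \<K>" using y(1) unfolding \<K>_def by blast
    ultimately show ?thesis using y(2) by blast
  qed
  moreover have "\<K> \<subseteq> balls" unfolding \<K>_def by (auto intro!: cball_in_balls)
  moreover have "countable \<K>" unfolding \<K>_def using F(1) by (intro countable_UN countable_image) (auto intro: countable_finite)
  ultimately show ?thesis by blast
qed

lemma sets_m_eq_sigma_balls: "sets m = sigma_sets UNIV (insert {} balls)"
proof -
  obtain \<K> where \<K>: "\<K> \<subseteq> balls" "countable \<K>"
      "\<And>U x. open U \<Longrightarrow> x \<in> U \<Longrightarrow> \<exists>K\<in>\<K>. x \<in> K \<and> K \<subseteq> (U :: 'a set)"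
    using countable_ball_base by blast
  have "sets borel = sigma_sets UNIV {S :: 'a set. open S}" by (simp add: borel_def)
  also have "\<dots> = sigma_sets UNIV (insert {} balls)"
  proof (rule sigma_sets_eqI)
    fix U :: "'a set" assume "U \<in> {S. open S}"
    then have "U = \<Union>{K\<in>\<K>. K \<subseteq> U}" using \<K>(3) by blast
    moreover have "\<Union>{K\<in>\<K>. K \<subseteq> U} \<in> sigma_sets UNIV (insert {} balls)"
      using \<K>(1,2) by (intro sigma_sets_UNION) (auto intro: countable_subset)
    ultimately show "U \<in> sigma_sets UNIV (insert {} balls)" by simp
  next
    fix B :: "'a set" assume "B \<in> insert {} balls"
    then show "B \<in> sigma_sets UNIV {S. open S}" using ball_open by (intro sigma_sets.Basic) auto
  qed
  finally show ?thesis by (simp add: sets_m)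
qed

lemma indicator_ball_L2: "B \<in> balls \<Longrightarrow> indicator B \<in> L2 m"
proof -
  assume B: "B \<in> balls"
  have "(indicator B :: 'a \<Rightarrow> complex) \<in> borel_measurable m" using ball_sets[OF B] by simp
  moreover have "integrable m (\<lambda>x. (cmod (indicator B x))\<^sup>2)"
  proof -
    have "(\<lambda>x. (cmod (indicator B x))\<^sup>2) = (indicator B :: 'a \<Rightarrow> real)"
      by (auto simp: indicator_def)
    then show ?thesis
      using ball_sets[OF B] emeasure_ball_finite[OF B] by (simp add: integrable_indicator_iff less_top)
  qed
  ultimately show ?thesis by (simp add: L2_def)
qed

lemma inner_indicator: "L2_inner m f (indicator B) = (LINT x:B|m. f x)"
  unfolding L2_inner_def set_lebesgue_integral_def
  by (intro Bochner_Integration.integral_cong refl) (auto simp: indicator_def)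

text \<open>Intersecting balls are nested, so balls form a \<open>\<pi>\<close>-system generating the Borel sets.\<close>

lemma orthogonal_to_balls_imp_zero:
  assumes f: "f \<in> L2 m" and orth: "\<And>B. B \<in> balls \<Longrightarrow> L2_inner m f (indicator B) = 0"
  shows "AE x in m. f x = 0"
proof -
  interpret sigma_finite_measure m by (rule sigma_finite_m)
  fix x0 :: 'a
  have zero: "AE x in m. x \<in> B0 \<longrightarrow> f x = 0" if B0: "B0 \<in> balls" for B0
  proof -
    define h where "h x = indicator B0 x *\<^sub>R f x" for x
    have int: "integrable m h"
    proof -
      have "h = (\<lambda>x. f x * cnj (indicator B0 x))" by (auto simp: h_def indicator_def)
      then show ?thesis using L2_inner_integrable[OF f indicator_ball_L2[OF B0]] by simp
    qed
    have set_int: "set_integrable m A h" if "A \<in> sets m" for A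
      unfolding set_integrable_def using that int by (rule integrable_mult_indicator)
    have total: "(LINT x|m. h x) = 0"
      using orth[OF B0] unfolding inner_indicator set_lebesgue_integral_def h_def .
    have "set_lebesgue_integral m A h = 0" if A: "A \<in> sets m" for A
    proof -
      have stable: "Int_stable (insert {} balls :: 'a set set)"
        unfolding Int_stable_def
      proof (intro ballI)
        fix A B :: "'a set" assume "A \<in> insert {} balls" "B \<in> insert {} balls"
        then have "A \<inter> B = {} \<or> A \<inter> B = A \<or> A \<inter> B = B" using balls_nested'[of A B] by blast
        then show "A \<inter> B \<in> insert {} balls"
          using \<open>A \<in> insert {} balls\<close> \<open>B \<in> insert {} balls\<close> by (elim disjE) simp_all
      qed
      have "A \<in> sigma_sets UNIV (insert {} balls)" using A by (simp add: sets_m_eq_sigma_balls)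
      moreover have "insert {} balls \<subseteq> Pow (UNIV :: 'a set)" by simp
      ultimately have "A \<in> sigma_sets UNIV (insert {} balls)" "insert {} balls \<subseteq> Pow (UNIV :: 'a set)" by auto
      from stable this(2,1) show ?thesis
      proof (induction rule: sigma_sets_induct_disjoint)
        case (basic A)
        have "A \<inter> B0 = {} \<or> A \<inter> B0 \<in> balls"
        proof (cases "A \<inter> B0 = {}")
          case False
          then have "A \<in> balls" using basic by auto
          with False B0 have "A \<subseteq> B0 \<or> B0 \<subseteq> A" by (intro balls_nested')
          with \<open>A \<in> balls\<close> B0 show ?thesis by (metis inf.absorb1 inf.absorb2)
        qed simp
        moreover have "set_lebesgue_integral m A h = (LINT x:A \<inter> B0|m. f x)"
          unfolding set_lebesgue_integral_def h_def
          by (intro Bochner_Integration.integral_cong refl) (auto simp: indicator_def)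
        moreover have "(LINT x:A \<inter> B0|m. f x) = 0"
          using calculation(1)
        proof
          assume "A \<inter> B0 = {}"
          then show ?thesis by (simp add: set_lebesgue_integral_def)
        next
          assume "A \<inter> B0 \<in> balls"
          from orth[OF this] show ?thesis unfolding inner_indicator .
        qed
        ultimately show ?case by simp
      next
        case empty
        then show ?case by (simp add: set_lebesgue_integral_def)
      next
        case (compl A)
        then have A: "A \<in> sets m" by (simp add: sets_m_eq_sigma_balls)
        have "set_lebesgue_integral m (UNIV - A) h = (LINT x|m. h x - indicator A x *\<^sub>R h x)"
          unfolding set_lebesgue_integral_def
          by (intro Bochner_Integration.integral_cong refl) (auto simp: indicator_def)
        also have "\<dots> = (LINT x|m. h x) - set_lebesgue_integral m A h"
          unfolding set_lebesgue_integral_def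
          using int set_int[OF A] by (intro Bochner_Integration.integral_diff) (auto simp: set_integrable_def)
        finally show ?case using compl.IH total by simp
      next
        case (union A)
        have A: "A i \<in> sets m" for i using union.hyps(2) by (auto simp: sets_m_eq_sigma_balls)
        have "set_lebesgue_integral m (\<Union>i. A i) h = (\<Sum>i. set_lebesgue_integral m (A i) h)"
          by (rule lebesgue_integral_countable_add)
             (use A union.hyps(1) set_int[of "\<Union>i. A i"] in \<open>auto simp: disjoint_family_on_def\<close>)
        then show ?case using union.IH by simp
      qed
    qed
    then have "AE x in m. h x = 0" by (intro density_zero int)
    then show ?thesis by eventually_elim (auto simp: h_def)
  qed
  have "AE x in m. \<forall>n::nat. x \<in> cball x0 (real n + 1) \<longrightarrow> f x = 0"
    unfolding AE_all_countable by (intro allI zero cball_in_balls) simp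
  then show ?thesis
  proof eventually_elim
    case (elim x)
    obtain n :: nat where "dist x0 x \<le> real n" using real_arch_simple by blast
    then have "x \<in> cball x0 (real n + 1)" by simp
    with elim show ?case by blast
  qed
qed

end


section \<open>Test functions\<close>

context homogeneous_ultrametric_measure_space
begin

text \<open>
  Compactness of the support makes the radius of constancy uniform: a point at distance at most \<open>\<delta>\<close> from \<open>x\<close> lies in
  the same member of a finite cover of the support as \<open>x\<close>.
\<close>

lemma test_function_iff:
  fixes f :: "'a \<Rightarrow> complex"
  shows "f \<in> test_functions \<longleftrightarrow>
    (\<exists>\<delta>>0. \<forall>x y. dist x y \<le> \<delta> \<longrightarrow> f x = f y) \<and> bounded {x. f x \<noteq> 0}"
proof
  assume f: "f \<in> test_functions"
  define K where "K = closure {x. f x \<noteq> 0}"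
  have K: "compact K" using f by (simp add: test_functions_def K_def)
  have out: "f x = 0" if "x \<notin> K" for x
    using that closure_subset[of "{x. f x \<noteq> 0}"] by (auto simp: K_def)
  have "\<exists>r>0. \<forall>y\<in>cball x r. f y = f x" for x
  proof -
    obtain U where U: "open U" "x \<in> U" "f constant_on U"
      using f unfolding test_functions_def by blast
    then obtain r where r: "r > 0" "cball x r \<subseteq> U" using open_contains_cball by blast
    from U(3) obtain c where c: "\<And>y. y \<in> U \<Longrightarrow> f y = c" by (auto simp: constant_on_def)
    have "\<forall>y\<in>cball x r. f y = f x" using c r(2) U(2) by (metis subsetD)
    with r(1) show ?thesis by blast
  qed
  then obtain r where r: "\<And>x. r x > 0" "\<And>x y. y \<in> cball x (r x) \<Longrightarrow> f y = f x" by metis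
  have "K \<subseteq> (\<Union>x\<in>K. cball x (r x))" using r(1) by (force intro: less_imp_le)
  then obtain F where F: "finite F" "K \<subseteq> (\<Union>x\<in>F. cball x (r x))"
    using compactE_image[OF K, of K "\<lambda>x. cball x (r x)"] cball_open[OF r(1)] by metis
  define \<delta> where "\<delta> = Min (insert 1 (r ` F))"
  have pos: "\<delta> > 0" using F(1) r(1) by (simp add: \<delta>_def)
  have le: "\<delta> \<le> r x" if "x \<in> F" for x using F(1) that by (simp add: \<delta>_def)
  have near: "f x = f y" if x: "x \<in> K" and d: "dist x y \<le> \<delta>" for x y
  proof -
    obtain z where z: "z \<in> F" "x \<in> cball z (r z)" using F(2) x by blast
    have "y \<in> cball x (r z)" using d le[OF z(1)] by simp
    then have "y \<in> cball z (r z)" using cball_recentre[OF z(2)] by simp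
    then show ?thesis using r(2) z(2) by metis
  qed
  have "f x = f y" if d: "dist x y \<le> \<delta>" for x y
  proof (cases "x \<in> K \<or> y \<in> K")
    case True
    then show ?thesis using near[of x y] near[of y x] d by (auto simp: dist_commute)
  next
    case False
    then show ?thesis using out by simp
  qed
  moreover have "bounded {x. f x \<noteq> 0}"
    using compact_imp_bounded[OF K] closure_subset unfolding K_def by (rule bounded_subset)
  ultimately show "(\<exists>\<delta>>0. \<forall>x y. dist x y \<le> \<delta> \<longrightarrow> f x = f y) \<and> bounded {x. f x \<noteq> 0}"
    using pos by blast
next
  assume "(\<exists>\<delta>>0. \<forall>x y. dist x y \<le> \<delta> \<longrightarrow> f x = f y) \<and> bounded {x. f x \<noteq> 0}"
  then obtain \<delta> where \<delta>: "\<delta> > 0" "\<And>x y. dist x y \<le> \<delta> \<Longrightarrow> f x = f y"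
    and b: "bounded {x. f x \<noteq> 0}" by blast
  have "\<exists>U. open U \<and> x \<in> U \<and> f constant_on U" for x
    using \<delta> cball_open[OF \<delta>(1), of x] by (intro exI[of _ "cball x \<delta>"]) (auto simp: constant_on_def intro!: exI[of _ "f x"])
  moreover have "compact (closure {x. f x \<noteq> 0})"
  proof -
    obtain x0 R where "{x. f x \<noteq> 0} \<subseteq> cball x0 R"
      using b unfolding bounded_def by (auto simp: subset_iff)
    then have "closure {x. f x \<noteq> 0} \<subseteq> cball x0 R" by (rule closure_minimal) simp
    then have "closure {x. f x \<noteq> 0} = cball x0 R \<inter> closure {x. f x \<noteq> 0}" by blast
    then show ?thesis using compact_Int_closed[OF compact_balls closed_closure] by metis
  qed
  ultimately show "f \<in> test_functions" by (simp add: test_functions_def)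
qed

lemma test_zero: "(\<lambda>x. 0) \<in> (test_functions :: ('a \<Rightarrow> complex) set)"
  by (auto simp: test_function_iff intro!: exI[of _ 1])

lemma test_cmult: "f \<in> test_functions \<Longrightarrow> (\<lambda>x. c * f x) \<in> (test_functions :: ('a \<Rightarrow> complex) set)"
  unfolding test_function_iff by (auto intro: bounded_subset)

lemma test_add:
  assumes "f \<in> test_functions" "g \<in> test_functions"
  shows "(\<lambda>x. f x + g x) \<in> (test_functions :: ('a \<Rightarrow> complex) set)"
proof -
  obtain \<delta> where \<delta>: "\<delta> > 0" "\<And>x y. dist x y \<le> \<delta> \<Longrightarrow> f x = f y" and bf: "bounded {x. f x \<noteq> 0}"
    using assms(1) unfolding test_function_iff by blast
  obtain \<epsilon> where \<epsilon>: "\<epsilon> > 0" "\<And>x y. dist x y \<le> \<epsilon> \<Longrightarrow> g x = g y" and bg: "bounded {x. g x \<noteq> 0}"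
    using assms(2) unfolding test_function_iff by blast
  have "\<forall>x y. dist x y \<le> min \<delta> \<epsilon> \<longrightarrow> f x + g x = f y + g y"
    using \<delta>(2) \<epsilon>(2) by (metis min.boundedE)
  moreover have "min \<delta> \<epsilon> > 0" using \<delta>(1) \<epsilon>(1) by simp
  moreover have "bounded {x. f x + g x \<noteq> 0}"
    by (rule bounded_subset[OF iffD2[OF bounded_Un conjI[OF bf bg]]]) auto
  ultimately show ?thesis unfolding test_function_iff by blast
qed

lemma test_indicator:
  assumes "B \<in> balls"
  shows "(indicator B :: 'a \<Rightarrow> complex) \<in> test_functions"
proof -
  obtain b r where r: "r > 0" "B = cball b r" using assms unfolding balls_def by blast
  have "(x \<in> B) = (y \<in> B)" if "dist x y \<le> r" for x y
    using cball_recentre[of x b r] cball_recentre[of y b r] that unfolding r(2)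
    by (metis dist_commute mem_cball)
  then have "\<forall>x y. dist x y \<le> r \<longrightarrow> (indicator B x :: complex) = indicator B y"
    by (auto simp: indicator_def)
  moreover have "bounded {x. indicator B x \<noteq> (0 :: complex)}"
    using ball_bounded[OF assms] by (rule bounded_subset) (auto simp: indicator_def)
  ultimately show ?thesis using r(1) unfolding test_function_iff by blast
qed

text \<open>
  The balls of radius \<open>\<delta>\<close> partition the space, and \<open>f\<close> is constant on each of them. The radius may be any
  sufficiently small number, so two test functions can be decomposed along one partition.
\<close>

lemma test_function_decomposition:
  fixes f :: "'a \<Rightarrow> complex"
  assumes f: "f \<in> test_functions"
  shows "\<exists>\<delta>0>0. \<forall>\<delta>. 0 < \<delta> \<longrightarrow> \<delta> \<le> \<delta>0 \<longrightarrow>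
    (\<exists>\<K> c. finite \<K> \<and> \<K> \<subseteq> range (\<lambda>x. cball x \<delta>) \<and> f = (\<lambda>x. \<Sum>K\<in>\<K>. c K * indicator K x))"
proof -
  obtain \<delta>0 where \<delta>0: "\<delta>0 > 0" "\<And>x y. dist x y \<le> \<delta>0 \<Longrightarrow> f x = f y"
    and bd: "bounded {x. f x \<noteq> 0}"
    using f unfolding test_function_iff by blast
  obtain x0 R where R: "{x. f x \<noteq> 0} \<subseteq> cball x0 R"
    using bd unfolding bounded_def by (auto simp: subset_iff)
  have "\<exists>\<K> c. finite \<K> \<and> \<K> \<subseteq> range (\<lambda>x. cball x \<delta>) \<and> f = (\<lambda>x. \<Sum>K\<in>\<K>. c K * indicator K x)"
    if \<delta>: "0 < \<delta>" "\<delta> \<le> \<delta>0" for \<delta>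
  proof -
    have "cball x0 R \<subseteq> (\<Union>y\<in>cball x0 R. cball y \<delta>)" using \<delta>(1) by force
    then obtain F where F: "finite F" "cball x0 R \<subseteq> (\<Union>y\<in>F. cball y \<delta>)"
      using compactE_image[OF compact_balls, of "cball x0 R" "\<lambda>y. cball y \<delta>" x0 R] cball_open[OF \<delta>(1)] by metis
    define \<K> where "\<K> = (\<lambda>y. cball y \<delta>) ` F"
    define c where "c K = f (SOME y. y \<in> K)" for K
    have "f x = (\<Sum>K\<in>\<K>. c K * indicator K x)" for x
    proof -
      have "c K * indicator K x = (if K = cball x \<delta> then f x else 0)" if K: "K \<in> \<K>" for K
      proof (cases "x \<in> K")
        case True
        obtain y where y: "K = cball y \<delta>" using K by (auto simp: \<K>_def)
        have Kx: "K = cball x \<delta>" using cball_recentre[of x y \<delta>] True y by simp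
        have "(SOME y. y \<in> K) \<in> K" using True by (rule someI)
        then have "dist x (SOME y. y \<in> K) \<le> \<delta>0" using \<delta>(2) by (simp add: Kx)
        then show ?thesis using \<delta>0(2) True Kx by (simp add: c_def)
      next
        case False
        then have "K \<noteq> cball x \<delta>" using \<delta>(1) by auto
        with False show ?thesis by simp
      qed
      then have "(\<Sum>K\<in>\<K>. c K * indicator K x) = (\<Sum>K\<in>\<K>. if K = cball x \<delta> then f x else 0)"
        by (rule sum.cong[OF refl])
      also have "\<dots> = (if cball x \<delta> \<in> \<K> then f x else 0)"
        using F(1) by (simp add: \<K>_def)
      also have "\<dots> = f x"
      proof (cases "f x = 0")
        case False
        then have "x \<in> cball x0 R" using R by blast
        then obtain y where y: "y \<in> F" "x \<in> cball y \<delta>" using F(2) by blast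
        then have "cball x \<delta> \<in> \<K>" using cball_recentre[OF y(2)] by (auto simp: \<K>_def)
        then show ?thesis by simp
      qed simp
      finally show ?thesis by simp
    qed
    moreover have "finite \<K>" "\<K> \<subseteq> range (\<lambda>x. cball x \<delta>)" using F(1) by (auto simp: \<K>_def)
    ultimately show ?thesis by blast
  qed
  with \<delta>0(1) show ?thesis by blast
qed

lemma test_function_L2:
  assumes "f \<in> test_functions"
  shows "f \<in> L2 m"
proof -
  obtain \<delta> where \<delta>: "\<delta> > 0" "\<And>\<delta>'. 0 < \<delta>' \<Longrightarrow> \<delta>' \<le> \<delta> \<Longrightarrow>
      (\<exists>\<K> c. finite \<K> \<and> \<K> \<subseteq> range (\<lambda>x. cball x \<delta>') \<and> f = (\<lambda>x. \<Sum>K\<in>\<K>. c K * indicator K x))"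
    using test_function_decomposition[OF assms] by blast
  obtain \<K> c where K: "\<K> \<subseteq> range (\<lambda>x. cball x \<delta>)" "f = (\<lambda>x. \<Sum>K\<in>\<K>. c K * indicator K x)"
    using \<delta>(2)[OF \<delta>(1)] by blast
  show ?thesis unfolding K(2)
    by (intro L2_sum L2_cmult indicator_ball_L2) (use K(1) cball_in_balls[OF \<delta>(1)] in blast)
qed

text \<open>Small balls already span all test functions, in particular the indicators of the larger balls.\<close>

lemma orthogonal_to_small_balls_imp_zero:
  assumes f: "f \<in> L2 m" and "\<rho> > 0"
    and orth: "\<And>x \<delta>. 0 < \<delta> \<Longrightarrow> \<delta> \<le> \<rho> \<Longrightarrow> L2_inner m f (indicator (cball x \<delta>)) = 0"
  shows "AE x in m. f x = 0"
proof (rule orthogonal_to_balls_imp_zero[OF f])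
  fix B :: "'a set" assume B: "B \<in> balls"
  obtain \<delta>0 where \<delta>0: "\<delta>0 > 0" "\<And>\<delta>. 0 < \<delta> \<Longrightarrow> \<delta> \<le> \<delta>0 \<Longrightarrow>
      (\<exists>\<K> c. finite \<K> \<and> \<K> \<subseteq> range (\<lambda>x. cball x \<delta>) \<and> (indicator B :: 'a \<Rightarrow> complex) = (\<lambda>x. \<Sum>K\<in>\<K>. c K * indicator K x))"
    using test_function_decomposition[OF test_indicator[OF B]] by blast
  define \<delta> where "\<delta> = min \<delta>0 \<rho>"
  have \<delta>: "0 < \<delta>" "\<delta> \<le> \<delta>0" "\<delta> \<le> \<rho>" using \<delta>0(1) \<open>\<rho> > 0\<close> by (auto simp: \<delta>_def)
  obtain \<K> c where K: "\<K> \<subseteq> range (\<lambda>x. cball x \<delta>)"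
      "(indicator B :: 'a \<Rightarrow> complex) = (\<lambda>x. \<Sum>K\<in>\<K>. c K * indicator K x)"
    using \<delta>0(2)[OF \<delta>(1,2)] by blast
  have KB: "K \<in> balls" if "K \<in> \<K>" for K using that K(1) cball_in_balls[OF \<delta>(1)] by blast
  have "L2_inner m f (indicator B) = (\<Sum>K\<in>\<K>. L2_inner m f (\<lambda>x. c K * indicator K x))"
    unfolding K(2) by (rule L2_inner_sum_right) (use f KB in \<open>auto intro: L2_cmult indicator_ball_L2\<close>)
  also have "\<dots> = 0"
  proof (rule sum.neutral, rule ballI)
    fix K assume "K \<in> \<K>"
    then obtain x where "K = cball x \<delta>" using K(1) by blast
    then show "L2_inner m f (\<lambda>x. c K * indicator K x) = 0"
      using orth[OF \<delta>(1,3)] by (simp add: L2_inner_cmult_right)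
  qed
  finally show "L2_inner m f (indicator B) = 0" .
qed


section \<open>Differences of normalized indicators\<close>

lemma inner_indicators:
  assumes "A \<in> balls" "B \<in> balls"
  shows "L2_inner m (indicator A) (indicator B) = of_real (measure m (A \<inter> B))"
proof -
  have "L2_inner m (indicator A) (indicator B) = (LINT x|m. complex_of_real (indicator (A \<inter> B) x))"
    unfolding L2_inner_def by (intro Bochner_Integration.integral_cong refl) (auto simp: indicator_def)
  also have "\<dots> = of_real (LINT x|m. indicator (A \<inter> B) x)" by (rule integral_complex_of_real)
  also have "(LINT x|m. indicator (A \<inter> B) x) = measure m (A \<inter> B)" by (simp add: space_m)
  finally show ?thesis .
qed

lemma ball_difference_eq:
  "ball_difference m T = (\<lambda>x. of_real (1 / measure m T) * indicator T x -
     of_real (1 / measure m (parent T)) * indicator (parent T) x)"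
  by (intro ext) (simp add: ball_difference_def)

lemma ball_difference_test:
  fixes T :: "'a set"
  assumes "T \<in> balls"
  shows "ball_difference m T \<in> test_functions"
  using test_add[OF test_cmult[OF test_indicator[OF assms], of "of_real (1 / measure m T)"]
      test_cmult[OF test_indicator[OF parent_ball[OF assms]], of "- of_real (1 / measure m (parent T))"]]
  by (simp add: ball_difference_eq)

lemma ball_difference_L2: "T \<in> balls \<Longrightarrow> ball_difference m T \<in> L2 m"
  by (rule test_function_L2[OF ball_difference_test])

lemma ball_difference_outside:
  fixes T :: "'a set"
  assumes "T \<in> balls" "x \<notin> parent T"
  shows "ball_difference m T x = 0"
  using assms parent_psubset[OF assms(1)] by (auto simp: ball_difference_def indicator_def)

lemma inner_ball_difference_left:
  assumes T: "T \<in> balls" and f: "f \<in> L2 m"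
  shows "L2_inner m (ball_difference m T) f = of_real (1 / measure m T) * L2_inner m (indicator T) f -
    of_real (1 / measure m (parent T)) * L2_inner m (indicator (parent T)) f"
  unfolding ball_difference_eq L2_inner_cmult_left[symmetric]
  by (rule L2_inner_diff_left[OF L2_cmult[OF indicator_ball_L2[OF T]]
      L2_cmult[OF indicator_ball_L2[OF parent_ball[OF T]]] f])

lemma inner_ball_difference_right:
  assumes T: "T \<in> balls" and f: "f \<in> L2 m"
  shows "L2_inner m f (ball_difference m T) = of_real (1 / measure m T) * L2_inner m f (indicator T) -
    of_real (1 / measure m (parent T)) * L2_inner m f (indicator (parent T))"
  using arg_cong[OF inner_ball_difference_left[OF T f], of cnj]
  by (simp add: L2_inner_commute[of m f])

lemma inner_ball_difference_indicator:
  fixes A T :: "'a set"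
  assumes A: "A \<in> balls" and T: "T \<in> balls"
  shows "L2_inner m (ball_difference m T) (indicator A) =
    of_real (measure m (T \<inter> A) / measure m T - measure m (parent T \<inter> A) / measure m (parent T))"
  unfolding inner_ball_difference_left[OF T indicator_ball_L2[OF A]]
  by (simp add: inner_indicators A T parent_ball[OF T])

text \<open>
  The function \<open>f\<^sub>T\<close> lives on the parent of \<open>T\<close> and has integral zero.
\<close>

lemma inner_ball_difference_indicator_zero:
  fixes A T :: "'a set"
  assumes A: "A \<in> balls" and T: "T \<in> balls" and "\<not> A \<subset> parent T"
  shows "L2_inner m (ball_difference m T) (indicator A) = 0"
proof -
  have "parent T \<subseteq> A \<or> parent T \<inter> A = {}"
    using balls_nested'[of "parent T" A] parent_ball[OF T] A assms(3) by blast
  then show ?thesis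
  proof
    assume "parent T \<subseteq> A"
    then have "T \<inter> A = T" "parent T \<inter> A = parent T" using parent_psubset[OF T] by auto
    then show ?thesis
      unfolding inner_ball_difference_indicator[OF A T]
      using measure_ball_pos[OF T] measure_ball_pos[OF parent_ball[OF T]] by simp
  next
    assume "parent T \<inter> A = {}"
    then have "T \<inter> A = {}" "parent T \<inter> A = {}" using parent_psubset[OF T] by auto
    then show ?thesis unfolding inner_ball_difference_indicator[OF A T] by simp
  qed
qed

text \<open>
  If the parents are different, one function is constant on the support of the other: the supports are
  disjoint, or one of them lies in a child of the other.
\<close>

lemma ball_differences_orthogonal:
  fixes T U :: "'a set"
  assumes T: "T \<in> balls" and U: "U \<in> balls" and "parent T \<noteq> parent U"
  shows "L2_inner m (ball_difference m T) (ball_difference m U) = 0"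
proof -
  have *: "L2_inner m (ball_difference m T) (ball_difference m U) = 0"
    if T: "T \<in> balls" and U: "U \<in> balls" and neq: "parent T \<noteq> parent U"
      and nsub: "\<not> parent U \<subset> parent T" for T U :: "'a set"
  proof -
    note P = parent_ball[OF T] parent_ball[OF U]
    have "\<not> U \<subset> parent T"
      using parent_least[OF U P(1)] neq nsub by blast
    then have "L2_inner m (ball_difference m T) (indicator U) = 0"
      by (rule inner_ball_difference_indicator_zero[OF U T])
    moreover have "L2_inner m (ball_difference m T) (indicator (parent U)) = 0"
      by (rule inner_ball_difference_indicator_zero[OF P(2) T nsub])
    ultimately show ?thesis
      unfolding inner_ball_difference_right[OF U ball_difference_L2[OF T]] by simp
  qed
  show ?thesis
  proof (cases "parent U \<subset> parent T")
    case True
    then have "L2_inner m (ball_difference m U) (ball_difference m T) = 0"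
      using * U T assms(3) by (metis psubset_imp_subset subset_antisym subset_not_subset_eq)
    then show ?thesis using L2_inner_commute[of m "ball_difference m T" "ball_difference m U"] by simp
  next
    case False
    then show ?thesis using *[OF T U assms(3)] by blast
  qed
qed

text \<open>
  Orthogonality to all \<open>f\<^sub>T\<close> below \<open>B\<close> says that the average of \<open>f\<close> does not change from a ball to its
  parent, up to \<open>B\<close>; there the average is zero.
\<close>

lemma orthogonal_below_ball:
  fixes A B :: "'a set"
  assumes f: "f \<in> L2 m" and B: "B \<in> balls" and fB: "L2_inner m f (indicator B) = 0"
    and fT: "\<And>T. T \<in> balls \<Longrightarrow> T \<subset> B \<Longrightarrow> L2_inner m f (ball_difference m T) = 0"
  shows "A \<in> balls \<Longrightarrow> A \<subseteq> B \<Longrightarrow> L2_inner m f (indicator A) = 0"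
proof (induction "card {U \<in> balls. A \<subseteq> U \<and> U \<subseteq> B}" arbitrary: A rule: less_induct)
  case less
  show ?case
  proof (cases "A = B")
    case False
    note A = less.prems(1) and P = parent_ball[OF less.prems(1)]
    have AB: "A \<subset> B" using False less.prems by blast
    have PB: "parent A \<subseteq> B" by (rule parent_least[OF A B AB])
    have "{U \<in> balls. parent A \<subseteq> U \<and> U \<subseteq> B} \<subset> {U \<in> balls. A \<subseteq> U \<and> U \<subseteq> B}"
      using parent_psubset[OF A] A AB by blast
    then have "card {U \<in> balls. parent A \<subseteq> U \<and> U \<subseteq> B} < card {U \<in> balls. A \<subseteq> U \<and> U \<subseteq> B}"
      by (intro psubset_card_mono finite_balls_between A ball_compact B)
    then have "L2_inner m f (indicator (parent A)) = 0" by (rule less.hyps[OF _ P PB])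
    moreover have "L2_inner m f (ball_difference m A) =
        of_real (1 / measure m A) * L2_inner m f (indicator A) -
        of_real (1 / measure m (parent A)) * L2_inner m f (indicator (parent A))"
      by (rule inner_ball_difference_right[OF A f])
    ultimately show ?thesis using fT[OF A AB] measure_ball_pos[OF A] by simp
  qed (simp add: fB)
qed

end


section \<open>The Laplacian on test functions\<close>

locale homogeneous_hierarchical_laplacian = homogeneous_ultrametric_measure_space m
  for m :: "'a::metric_space measure" +
  fixes C :: "'a set \<Rightarrow> real"
  assumes choice: "homogeneous_choice_function C"
begin

definition superballs :: "'a set \<Rightarrow> 'a set set" where
  "superballs B = {T \<in> balls. B \<subseteq> T}"

definition eigenvalue :: "'a set \<Rightarrow> real" where
  "eigenvalue B = (\<Sum>\<^sub>\<infinity>T\<in>superballs B. C T)"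

text \<open>
  The summands of the Laplacian of \<open>f\<close>, and the form they take for the indicator of \<open>A\<close> on a ball that
  contains \<open>A\<close>.
\<close>

definition laplacian_term :: "('a \<Rightarrow> complex) \<Rightarrow> 'a \<Rightarrow> 'a set \<Rightarrow> complex" where
  "laplacian_term f x B = of_real (C B) * (f x - of_real (1 / measure m B) * (LINT y:B|m. f y))"

definition indicator_term :: "'a set \<Rightarrow> 'a \<Rightarrow> 'a set \<Rightarrow> complex" where
  "indicator_term A x T = of_real (C T) * (indicator A x - of_real (measure m A / measure m T) * indicator T x)"

lemma choice_pos: "B \<in> balls \<Longrightarrow> C B > 0"
  using choice[unfolded homogeneous_choice_function_def, THEN conjunct1, THEN bspec] .

lemma choice_cong: "A \<in> balls \<Longrightarrow> B \<in> balls \<Longrightarrow> diameter A = diameter B \<Longrightarrow> C A = C B"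
  using choice[unfolded homogeneous_choice_function_def, THEN conjunct2, THEN conjunct1,
    THEN bspec, THEN bspec, THEN mp] .

lemma choice_summable: "B \<in> balls \<Longrightarrow> C summable_on superballs B"
  using choice[unfolded homogeneous_choice_function_def, THEN conjunct2, THEN conjunct2, THEN bspec]
  unfolding superballs_def .

text \<open>
  An isometry maps the balls containing \<open>A\<close> bijectively onto the balls containing the image of \<open>A\<close> and preserves diameters.
\<close>

lemma eigenvalue_cong:
  assumes A: "A \<in> balls" and g: "g \<in> isometries"
  shows "eigenvalue (g ` A) = eigenvalue A"
proof -
  have bij: "bij g" using g by (simp add: isometries_def)
  have inv: "inv g \<in> isometries" by (rule isometry_inv[OF g])
  have "bij_betw ((`) g) (superballs A) (superballs (g ` A))"
  proof (rule bij_betwI[where g="(`) (inv g)"])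
    show "(`) g \<in> superballs A \<rightarrow> superballs (g ` A)"
      using isometry_ball[OF g] by (auto simp: superballs_def)
    show "(`) (inv g) \<in> superballs (g ` A) \<rightarrow> superballs A"
    proof
      fix T assume T: "T \<in> superballs (g ` A)"
      then have "inv g ` (g ` A) \<subseteq> inv g ` T" unfolding superballs_def by (intro image_mono) simp
      moreover have "inv g ` (g ` A) = A" using bij by (simp add: image_inv_f_f bij_is_inj)
      ultimately show "inv g ` T \<in> superballs A"
        using T isometry_ball[OF inv] by (simp add: superballs_def)
    qed
    show "inv g ` (g ` T) = T" for T using bij by (simp add: image_inv_f_f bij_is_inj)
    show "g ` (inv g ` T) = T" for T using bij by (simp add: image_f_inv_f bij_is_surj)
  qed
  then have "(\<Sum>\<^sub>\<infinity>T\<in>superballs A. C (g ` T)) = eigenvalue (g ` A)"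
    unfolding eigenvalue_def by (rule infsum_reindex_bij_betw)
  moreover have "(\<Sum>\<^sub>\<infinity>T\<in>superballs A. C (g ` T)) = eigenvalue A"
    unfolding eigenvalue_def
    by (rule infsum_cong, rule choice_cong)
       (auto simp: superballs_def isometry_ball[OF g] diameter_isometry[OF g])
  ultimately show ?thesis by simp
qed

lemma countable_superballs:
  assumes A: "A \<in> balls"
  shows "countable (superballs A)"
proof -
  fix x0 :: 'a
  have "superballs A \<subseteq> (\<Union>n::nat. {T \<in> balls. A \<subseteq> T \<and> T \<subseteq> cball x0 (real n)})"
  proof
    fix T assume T: "T \<in> superballs A"
    then have "bounded T" using ball_bounded by (simp add: superballs_def)
    then obtain R where R: "\<And>y. y \<in> T \<Longrightarrow> dist x0 y \<le> R"
      unfolding bounded_any_center[where a=x0] by blast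
    obtain n :: nat where "R \<le> real n" using real_arch_simple by blast
    then have "T \<subseteq> cball x0 (real n)" using R by force
    with T show "T \<in> (\<Union>n::nat. {T \<in> balls. A \<subseteq> T \<and> T \<subseteq> cball x0 (real n)})"
      by (auto simp: superballs_def)
  qed
  moreover have "countable (\<Union>n::nat. {T \<in> balls. A \<subseteq> T \<and> T \<subseteq> cball x0 (real n)})"
    by (rule countable_UN, simp, intro countable_finite finite_balls_between A compact_balls)
  ultimately show ?thesis by (rule countable_subset)
qed

lemma infinite_superballs:
  assumes A: "A \<in> balls"
  shows "infinite (superballs A)"
proof
  assume fin: "finite (superballs A)"
  have "UNIV = \<Union>(superballs A)"
    using larger_ball_through[OF A] by (auto simp: superballs_def)
  moreover have "compact (\<Union>(superballs A))"
    by (intro compact_Union fin) (auto simp: superballs_def ball_compact)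
  ultimately show False using noncompact by simp
qed

lemma measure_ball_mono: "A \<in> balls \<Longrightarrow> T \<in> superballs A \<Longrightarrow> measure m A \<le> measure m T"
  unfolding superballs_def measure_def
  using emeasure_ball_finite ball_sets by (intro enn2real_mono emeasure_mono) auto

lemma norm_indicator_term:
  assumes A: "A \<in> balls" and T: "T \<in> superballs A"
  shows "cmod (indicator_term A x T) \<le> 2 * C T"
proof -
  have TB: "T \<in> balls" using T by (simp add: superballs_def)
  have "cmod (indicator A x - of_real (measure m A / measure m T) * indicator T x) \<le>
      cmod (indicator A x) + cmod (of_real (measure m A / measure m T) * indicator T x)"
    by (rule norm_triangle_ineq4)
  also have "\<dots> \<le> 1 + 1"
  proof (rule add_mono)
    show "cmod (indicator A x) \<le> 1" by (simp add: indicator_def)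
    have "\<bar>measure m A / measure m T\<bar> \<le> 1"
      using measure_ball_mono[OF A T] measure_ball_pos[OF TB] by simp
    then show "cmod (of_real (measure m A / measure m T) * indicator T x) \<le> 1"
      by (simp add: norm_mult indicator_def del: of_real_divide)
  qed
  finally have "C T * cmod (indicator A x - of_real (measure m A / measure m T) * indicator T x) \<le> C T * 2"
    using choice_pos[OF TB] by (intro mult_left_mono) auto
  then show ?thesis using choice_pos[OF TB] by (simp add: indicator_term_def norm_mult)
qed

lemma indicator_term_summable:
  assumes A: "A \<in> balls"
  shows "indicator_term A x summable_on superballs A"
proof (rule Infinite_Sum.abs_summable_summable, rule Infinite_Sum.abs_summable_on_comparison_test')
  show "(\<lambda>T. 2 * C T) summable_on superballs A"
    by (intro summable_on_cmult_right choice_summable A)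
qed (rule norm_indicator_term[OF A])

text \<open>
  The balls inside \<open>A\<close> do not contribute to the Laplacian of \<open>1\<^sub>A\<close>, and neither do the balls disjoint from \<open>A\<close>;
  so the sum may be taken over the balls containing \<open>A\<close>, independently of \<open>x\<close>.
\<close>

lemma laplacian_term_indicator:
  assumes A: "A \<in> balls"
  shows "(laplacian_term (indicator A) x has_sum s) {B \<in> balls. x \<in> B} \<longleftrightarrow>
    (indicator_term A x has_sum s) (superballs A)"
proof (rule has_sum_cong_neutral)
  have int: "(LINT y:B|m. indicator A y) = complex_of_real (measure m (A \<inter> B))" if "B \<in> balls" for B
    using inner_indicators[OF A that] by (simp add: inner_indicator)
  fix B
  { assume B: "B \<in> superballs A - {B \<in> balls. x \<in> B}"
    then have "x \<notin> B" "x \<notin> A" by (auto simp: superballs_def)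
    then show "indicator_term A x B = 0" by (simp add: indicator_term_def) }
  { assume B: "B \<in> {B \<in> balls. x \<in> B} - superballs A"
    then have BB: "B \<in> balls" "x \<in> B" "\<not> A \<subseteq> B" by (auto simp: superballs_def)
    show "laplacian_term (indicator A) x B = 0"
    proof (cases "A \<inter> B = {}")
      case True
      then have "x \<notin> A" using BB by blast
      with True show ?thesis by (simp add: laplacian_term_def int BB)
    next
      case False
      then have "B \<subseteq> A" using balls_nested'[OF A BB(1)] BB(3) by blast
      then have "x \<in> A" "A \<inter> B = B" using BB by auto
      then show ?thesis using measure_ball_pos[OF BB(1)] by (simp add: laplacian_term_def int BB)
    qed }
  { assume B: "B \<in> {B \<in> balls. x \<in> B} \<inter> superballs A"
    then have "B \<in> balls" "x \<in> B" "A \<inter> B = A" by (auto simp: superballs_def)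
    then show "laplacian_term (indicator A) x B = indicator_term A x B"
      by (simp add: laplacian_term_def indicator_term_def int) }
qed

lemma hier_laplacian_alt: "hier_laplacian m C f x = (\<Sum>\<^sub>\<infinity>B\<in>{B\<in>balls. x \<in> B}. laplacian_term f x B)"
  unfolding hier_laplacian_def laplacian_term_def ..

lemma has_sum_laplacian_indicator:
  assumes A: "A \<in> balls"
  shows "(laplacian_term (indicator A) x has_sum hier_laplacian m C (indicator A) x) {B \<in> balls. x \<in> B}"
    and "(indicator_term A x has_sum hier_laplacian m C (indicator A) x) (superballs A)"
proof -
  have "indicator_term A x summable_on superballs A"
    by (rule indicator_term_summable[OF A])
  then obtain s where s: "(indicator_term A x has_sum s) (superballs A)"
    by (auto simp: summable_on_def)
  then have s': "(laplacian_term (indicator A) x has_sum s) {B \<in> balls. x \<in> B}"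
    by (simp add: laplacian_term_indicator[OF A])
  then have "hier_laplacian m C (indicator A) x = s" unfolding hier_laplacian_alt by (rule infsumI)
  with s s' show "(laplacian_term (indicator A) x has_sum hier_laplacian m C (indicator A) x) {B \<in> balls. x \<in> B}"
    "(indicator_term A x has_sum hier_laplacian m C (indicator A) x) (superballs A)" by simp_all
qed

lemma has_sum_laplacian_comb:
  assumes "finite I"
    and "\<And>i B. i \<in> I \<Longrightarrow> B \<in> balls \<Longrightarrow> set_integrable m B (f i)"
    and "\<And>i. i \<in> I \<Longrightarrow> (laplacian_term (f i) x has_sum l i) {B \<in> balls. x \<in> B}"
  shows "(laplacian_term (\<lambda>x. \<Sum>i\<in>I. c i * f i x) x has_sum (\<Sum>i\<in>I. c i * l i)) {B \<in> balls. x \<in> B}"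
proof -
  have "((\<lambda>B. \<Sum>i\<in>I. c i * laplacian_term (f i) x B) has_sum (\<Sum>i\<in>I. c i * l i)) {B \<in> balls. x \<in> B}"
    using assms(1,3)
  proof (induction I rule: finite_induct)
    case (insert i I)
    then show ?case
      by (simp add: has_sum_add has_sum_cmult_right)
  qed simp
  moreover have "laplacian_term (\<lambda>x. \<Sum>i\<in>I. c i * f i x) x B = (\<Sum>i\<in>I. c i * laplacian_term (f i) x B)"
    if B: "B \<in> balls" for B
  proof -
    have "(LINT y:B|m. (\<Sum>i\<in>I. c i * f i y)) = (LINT y|m. (\<Sum>i\<in>I. c i * (indicator B y *\<^sub>R f i y)))"
      unfolding set_lebesgue_integral_def
      by (intro Bochner_Integration.integral_cong refl) (simp add: scaleR_sum_right)
    also have "\<dots> = (\<Sum>i\<in>I. LINT y|m. c i * (indicator B y *\<^sub>R f i y))"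
      by (rule Bochner_Integration.integral_sum, rule integrable_mult_right)
         (use assms(2)[OF _ B] in \<open>simp add: set_integrable_def\<close>)
    also have "\<dots> = (\<Sum>i\<in>I. c i * (LINT y:B|m. f i y))"
      unfolding set_lebesgue_integral_def by (intro sum.cong refl integral_mult_right_zero)
    finally show ?thesis
      unfolding laplacian_term_def
      by (simp add: sum_distrib_left sum_subtractf right_diff_distrib mult_ac)
  qed
  ultimately show ?thesis by (subst has_sum_cong) auto
qed

lemma test_function_set_integrable:
  assumes "f \<in> test_functions" "B \<in> balls"
  shows "set_integrable m B f"
proof -
  have "(\<lambda>x. indicator B x *\<^sub>R f x) = (\<lambda>x. f x * cnj (indicator B x))"
    by (auto simp: indicator_def)
  then show ?thesis
    unfolding set_integrable_def
    using L2_inner_integrable[OF test_function_L2[OF assms(1)] indicator_ball_L2[OF assms(2)]] by simp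
qed

lemma has_sum_laplacian_test:
  assumes f: "f \<in> test_functions"
  shows "(laplacian_term f x has_sum hier_laplacian m C f x) {B \<in> balls. x \<in> B}"
proof -
  obtain \<delta> where \<delta>: "\<delta> > 0" "\<And>\<delta>'. 0 < \<delta>' \<Longrightarrow> \<delta>' \<le> \<delta> \<Longrightarrow>
      (\<exists>\<K> c. finite \<K> \<and> \<K> \<subseteq> range (\<lambda>x. cball x \<delta>') \<and> f = (\<lambda>x. \<Sum>K\<in>\<K>. c K * indicator K x))"
    using test_function_decomposition[OF f] by blast
  obtain \<K> c where K: "finite \<K>" "\<K> \<subseteq> range (\<lambda>x. cball x \<delta>)" "f = (\<lambda>x. \<Sum>K\<in>\<K>. c K * indicator K x)"
    using \<delta>(2)[OF \<delta>(1)] by blast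
  have KB: "K \<in> balls" if "K \<in> \<K>" for K using that K(2) cball_in_balls[OF \<delta>(1)] by blast
  have "(laplacian_term f x has_sum (\<Sum>K\<in>\<K>. c K * hier_laplacian m C (indicator K) x)) {B \<in> balls. x \<in> B}"
    unfolding K(3)
    by (rule has_sum_laplacian_comb[OF K(1)])
       (auto intro: test_function_set_integrable test_indicator has_sum_laplacian_indicator(1) KB)
  then show ?thesis unfolding hier_laplacian_alt using infsumI by fastforce
qed

lemma hier_laplacian_comb:
  assumes "finite I" "\<And>i. i \<in> I \<Longrightarrow> f i \<in> test_functions"
  shows "hier_laplacian m C (\<lambda>x. \<Sum>i\<in>I. c i * f i x) x = (\<Sum>i\<in>I. c i * hier_laplacian m C (f i) x)"
  unfolding hier_laplacian_alt[of "\<lambda>x. \<Sum>i\<in>I. c i * f i x"]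
  by (rule infsumI, rule has_sum_laplacian_comb)
     (use assms in \<open>auto intro: test_function_set_integrable has_sum_laplacian_test\<close>)

text \<open>
  Every summand of the Laplacian of \<open>1\<^sub>A\<close> has norm at most \<open>2 C(T)\<close> in the supremum norm and \<open>2 C(T) m(A)\<close> in
  \<open>L\<^sup>1\<close>; a bounded integrable function is square integrable.
\<close>

lemma hier_laplacian_indicator_L2:
  assumes A: "A \<in> balls"
  shows "hier_laplacian m C (indicator A) \<in> L2 m"
proof -
  obtain b :: "nat \<Rightarrow> 'a set" where b: "bij_betw b UNIV (superballs A)"
    using countableE_infinite[OF countable_superballs[OF A] infinite_superballs[OF A]]
      bij_betw_inv_into by metis
  have bT: "b n \<in> superballs A" "b n \<in> balls" for n
    using bij_betwE[OF b] by (auto simp: superballs_def)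
  define u where "u n x = indicator_term A x (b n)" for n x
  have C: "summable (\<lambda>n. C (b n))"
  proof -
    have "(\<lambda>n. C (b n)) summable_on UNIV"
      using choice_summable[OF A] summable_on_reindex_bij_betw[OF b, of C] by simp
    then show ?thesis by (auto simp: summable_on_def summable_def dest: has_sum_imp_sums)
  qed
  have sums: "(\<lambda>n. u n x) sums hier_laplacian m C (indicator A) x" for x
  proof (rule has_sum_imp_sums)
    show "((\<lambda>n. u n x) has_sum hier_laplacian m C (indicator A) x) UNIV"
      unfolding u_def
      using has_sum_laplacian_indicator(2)[OF A, of x]
        has_sum_reindex_bij_betw[OF b, of "indicator_term A x"] by simp
  qed
  have bound: "cmod (u n x) \<le> 2 * C (b n)" for n x
    unfolding u_def by (rule norm_indicator_term[OF A bT(1)])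
  have summ: "summable (\<lambda>n. cmod (u n x))" for x
    by (rule summable_comparison_test'[OF summable_mult[OF C, of 2], of 0]) (use bound in auto)
  have int_ind: "integrable m (indicator B :: 'a \<Rightarrow> real)" if "B \<in> balls" for B
    using ball_sets[OF that] emeasure_ball_finite[OF that] by (simp add: integrable_indicator_iff less_top)
  have int_ind': "integrable m (indicator B :: 'a \<Rightarrow> complex)" if "B \<in> balls" for B
  proof -
    have "integrable m (\<lambda>x. complex_of_real (indicator B x))"
      by (intro integrable_of_real int_ind that)
    then show ?thesis by (simp add: of_real_indicator)
  qed
  have int: "integrable m (u n)" for n
    unfolding u_def[abs_def] indicator_term_def
    by (intro integrable_mult_right Bochner_Integration.integrable_diff int_ind' A bT)
  have norm_int: "(LINT x|m. cmod (u n x)) \<le> 2 * measure m A * C (b n)" for n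
  proof -
    have Tpos: "measure m (b n) > 0" by (rule measure_ball_pos[OF bT(2)])
    have "(LINT x|m. cmod (u n x)) \<le>
        (LINT x|m. C (b n) * (indicator A x + measure m A / measure m (b n) * indicator (b n) x))"
    proof (rule integral_mono)
      show "integrable m (\<lambda>x. cmod (u n x))" using int by simp
      show "integrable m (\<lambda>x. C (b n) * (indicator A x + measure m A / measure m (b n) * indicator (b n) x))"
        by (intro integrable_mult_right Bochner_Integration.integrable_add int_ind A bT)
      fix x
      have "cmod (indicator A x - of_real (measure m A / measure m (b n)) * indicator (b n) x) \<le>
          cmod (indicator A x) + cmod (of_real (measure m A / measure m (b n)) * indicator (b n) x)"
        by (rule norm_triangle_ineq4)
      also have "\<dots> = indicator A x + measure m A / measure m (b n) * indicator (b n) x"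
        by (simp add: norm_mult indicator_def del: of_real_divide)
      finally show "cmod (u n x) \<le> C (b n) * (indicator A x + measure m A / measure m (b n) * indicator (b n) x)"
        unfolding u_def indicator_term_def
        using choice_pos[OF bT(2)[of n]] by (simp add: norm_mult)
    qed
    also have "\<dots> = C (b n) * (measure m A + measure m A / measure m (b n) * measure m (b n))"
      using int_ind[OF A] int_ind[OF bT(2)[of n]] by (simp add: space_m)
    also have "\<dots> = 2 * measure m A * C (b n)" using Tpos by simp
    finally show ?thesis .
  qed
  have "summable (\<lambda>n. LINT x|m. cmod (u n x))"
    by (rule summable_comparison_test'[OF summable_mult[OF C, of "2 * measure m A"], of 0])
       (use norm_int in auto)
  then have "integrable m (\<lambda>x. \<Sum>n. u n x)"
    using int summ by (intro integrable_suminf) auto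
  moreover have eq: "(\<lambda>x. \<Sum>n. u n x) = hier_laplacian m C (indicator A)"
    using sums by (intro ext) (metis sums_unique)
  ultimately have L1: "integrable m (hier_laplacian m C (indicator A))" by simp
  define K where "K = (\<Sum>n. 2 * C (b n))"
  have le: "cmod (hier_laplacian m C (indicator A) x) \<le> K" for x
  proof -
    have "cmod (\<Sum>n. u n x) \<le> (\<Sum>n. cmod (u n x))" by (rule summable_norm[OF summ])
    also have "\<dots> \<le> K" unfolding K_def by (intro suminf_le bound summ summable_mult C)
    finally show ?thesis using fun_cong[OF eq, of x] by simp
  qed
  have meas: "hier_laplacian m C (indicator A) \<in> borel_measurable m" using L1 by auto
  have "integrable m (\<lambda>x. K * cmod (hier_laplacian m C (indicator A) x))" using L1 by auto
  then have "integrable m (\<lambda>x. (cmod (hier_laplacian m C (indicator A) x))\<^sup>2)"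
  proof (rule Bochner_Integration.integrable_bound[OF _ _ AE_I2])
    show "(\<lambda>x. (cmod (hier_laplacian m C (indicator A) x))\<^sup>2) \<in> borel_measurable m" using meas by auto
    show "norm ((cmod (hier_laplacian m C (indicator A) x))\<^sup>2) \<le> norm (K * cmod (hier_laplacian m C (indicator A) x))" for x
      using mult_right_mono[OF le[of x], of "cmod (hier_laplacian m C (indicator A) x)"]
      by (simp add: power2_eq_square order_trans[OF _ abs_ge_self])
  qed
  with meas show ?thesis by (simp add: L2_def)
qed

text \<open>
  On a ball \<open>B\<close> disjoint from \<open>A\<close> only the balls containing both contribute, so the Laplacian of \<open>1\<^sub>A\<close> is constant
  there, and the constant depends symmetrically on \<open>A\<close> and \<open>B\<close> up to the factor \<open>m(A)\<close>.
\<close>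

lemma hier_laplacian_indicator_off_ball:
  assumes A: "A \<in> balls" and B: "B \<in> balls" and disj: "A \<inter> B = {}" and x: "x \<in> B"
  shows "hier_laplacian m C (indicator A) x =
    - of_real (measure m A) * (\<Sum>\<^sub>\<infinity>T\<in>superballs A \<inter> superballs B. of_real (C T / measure m T))"
proof -
  have xA: "x \<notin> A" using disj x by blast
  have "hier_laplacian m C (indicator A) x = (\<Sum>\<^sub>\<infinity>T\<in>superballs A. indicator_term A x T)"
    using infsumI[OF has_sum_laplacian_indicator(2)[OF A]] by simp
  also have "\<dots> = (\<Sum>\<^sub>\<infinity>T\<in>superballs A \<inter> superballs B. - of_real (measure m A) * of_real (C T / measure m T))"
  proof (rule infsum_cong_neutral)
    fix T assume T: "T \<in> superballs A - superballs A \<inter> superballs B"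
    then have T': "T \<in> balls" "A \<subseteq> T" "\<not> B \<subseteq> T" by (auto simp: superballs_def)
    have "x \<notin> T"
    proof
      assume "x \<in> T"
      then have "T \<subseteq> B" using balls_nested[OF T'(1) B _ x] T'(3) by blast
      then show False using T'(2) disj ball_nonempty[OF A] by blast
    qed
    with xA show "indicator_term A x T = 0" by (simp add: indicator_term_def)
  next
    fix T assume "T \<in> superballs A \<inter> (superballs A \<inter> superballs B)"
    then have "x \<in> T" using x by (auto simp: superballs_def)
    with xA show "indicator_term A x T = - of_real (measure m A) * of_real (C T / measure m T)"
      by (simp add: indicator_term_def)
  qed auto
  also have "\<dots> = - of_real (measure m A) * (\<Sum>\<^sub>\<infinity>T\<in>superballs A \<inter> superballs B. of_real (C T / measure m T))"
    by (rule infsum_cmult_right')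
  finally show ?thesis .
qed

lemma inner_constant_on_ball:
  assumes B: "B \<in> balls" and const: "\<And>x. x \<in> B \<Longrightarrow> f x = c"
  shows "L2_inner m f (indicator B) = c * of_real (measure m B)"
proof -
  have "L2_inner m f (indicator B) = L2_inner m (\<lambda>x. c * indicator B x) (indicator B)"
    unfolding L2_inner_def by (intro Bochner_Integration.integral_cong refl) (auto simp: indicator_def const)
  then show ?thesis by (simp add: L2_inner_cmult_left inner_indicators B)
qed

lemma hier_laplacian_indicator_symmetric:
  assumes A: "A \<in> balls" and B: "B \<in> balls" and AB: "A = B \<or> A \<inter> B = {}"
  shows "L2_inner m (hier_laplacian m C (indicator A)) (indicator B) =
    L2_inner m (indicator A) (hier_laplacian m C (indicator B))"
  using AB
proof
  assume "A = B"
  moreover have "cnj (hier_laplacian m C (indicator A) x) = hier_laplacian m C (indicator A) x" for x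
  proof -
    have L: "hier_laplacian m C (indicator A) x = (\<Sum>\<^sub>\<infinity>T\<in>superballs A. indicator_term A x T)"
      using infsumI[OF has_sum_laplacian_indicator(2)[OF A]] by simp
    have "cnj (indicator_term A x T) = indicator_term A x T" for T
      by (simp add: indicator_term_def indicator_def)
    then show ?thesis unfolding L infsum_cnj[symmetric] by simp
  qed
  ultimately show ?thesis
    unfolding L2_inner_def by (intro Bochner_Integration.integral_cong refl) (auto simp: indicator_def)
next
  assume disj: "A \<inter> B = {}"
  define K where "K = (\<Sum>\<^sub>\<infinity>T\<in>superballs A \<inter> superballs B. complex_of_real (C T / measure m T))"
  have real: "cnj K = K" unfolding K_def infsum_cnj[symmetric] by simp
  have 1: "L2_inner m (hier_laplacian m C (indicator A)) (indicator B) = - of_real (measure m A) * K * of_real (measure m B)"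
    using hier_laplacian_indicator_off_ball[OF A B disj]
    by (intro inner_constant_on_ball[OF B]) (simp add: K_def)
  have "L2_inner m (hier_laplacian m C (indicator B)) (indicator A) = - of_real (measure m B) * K * of_real (measure m A)"
    using hier_laplacian_indicator_off_ball[OF B A] disj
    by (intro inner_constant_on_ball[OF A]) (simp add: K_def Int_commute)
  then have 2: "L2_inner m (indicator A) (hier_laplacian m C (indicator B)) = cnj (- of_real (measure m B) * K * of_real (measure m A))"
    using L2_inner_commute[of m "indicator A" "hier_laplacian m C (indicator B)"] by simp
  show ?thesis unfolding 1 2 by (simp add: real)
qed

text \<open>In the telescoping difference the balls containing the parent contribute multiples of \<open>f\<^sub>T\<close>, and \<open>T\<close> itself nothing.\<close>

lemma hier_laplacian_ball_difference:
  assumes T: "T \<in> balls"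
  shows "hier_laplacian m C (ball_difference m T) x = of_real (eigenvalue (parent T)) * ball_difference m T x"
proof -
  define S where "S = parent T"
  have S: "S \<in> balls" unfolding S_def by (rule parent_ball[OF T])
  have pos: "measure m T > 0" "measure m S > 0" using measure_ball_pos T S by auto
  define a b where "a = complex_of_real (1 / measure m T)" and "b = complex_of_real (1 / measure m S)"
  have "(laplacian_term (\<lambda>x. \<Sum>U\<in>{T, S}. (if U = T then a else - b) * indicator U x) x has_sum
      (\<Sum>U\<in>{T, S}. (if U = T then a else - b) * hier_laplacian m C (indicator U) x)) {B \<in> balls. x \<in> B}"
    by (rule has_sum_laplacian_comb)
       (use T S in \<open>auto intro: test_function_set_integrable test_indicator has_sum_laplacian_indicator(1)\<close>)
  moreover have neq: "T \<noteq> S" using parent_psubset[OF T] by (auto simp: S_def)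
  have pair: "(\<Sum>U\<in>{T, S}. (if U = T then a else - b) * g U) = a * g T - b * g S" for g :: "'a set \<Rightarrow> complex"
    using neq by (subst sum.insert) auto
  ultimately have "(laplacian_term (\<lambda>x. a * indicator T x - b * indicator S x) x has_sum
      (a * hier_laplacian m C (indicator T) x - b * hier_laplacian m C (indicator S) x)) {B \<in> balls. x \<in> B}"
    unfolding pair by blast
  moreover have "(\<lambda>x. a * indicator T x - b * indicator S x) = ball_difference m T"
    by (simp add: ball_difference_eq a_def b_def S_def)
  ultimately have hier: "hier_laplacian m C (ball_difference m T) x =
      a * hier_laplacian m C (indicator T) x - b * hier_laplacian m C (indicator S) x"
    unfolding hier_laplacian_alt[of "ball_difference m T"] by (intro infsumI) simp
  have super: "superballs S \<subseteq> superballs T"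
    using parent_psubset[OF T] by (auto simp: superballs_def S_def)
  have rest: "U = T" if "U \<in> superballs T - superballs S" for U
    using that parent_least[OF T, of U] by (auto simp: superballs_def S_def)
  have "(indicator_term T x has_sum hier_laplacian m C (indicator T) x) (superballs T) \<longleftrightarrow>
      (indicator_term T x has_sum hier_laplacian m C (indicator T) x) (superballs S)"
  proof (rule has_sum_cong_neutral)
    fix U assume "U \<in> superballs T - superballs S"
    then have "U = T" by (rule rest)
    then show "indicator_term T x U = 0" using pos by (simp add: indicator_term_def)
  qed (use super in auto)
  then have "(indicator_term T x has_sum hier_laplacian m C (indicator T) x) (superballs S)"
    using has_sum_laplacian_indicator(2)[OF T] by simp
  from has_sum_add[OF has_sum_cmult_right[OF this, of a]
      has_sum_cmult_right[OF has_sum_laplacian_indicator(2)[OF S, of x], of "- b"]]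
  have 1: "((\<lambda>U. a * indicator_term T x U - b * indicator_term S x U) has_sum
      hier_laplacian m C (ball_difference m T) x) (superballs S)"
    unfolding hier by simp
  have 2: "a * indicator_term T x U - b * indicator_term S x U = of_real (C U) * ball_difference m T x"
    if "U \<in> superballs S" for U
  proof -
    have "measure m U > 0" using that measure_ball_pos by (simp add: superballs_def)
    then show ?thesis
      using pos unfolding indicator_term_def ball_difference_eq a_def b_def S_def
      by (simp add: field_simps)
  qed
  have "(C has_sum eigenvalue S) (superballs S)"
    unfolding eigenvalue_def using choice_summable[OF S] by simp
  then have "((\<lambda>U. of_real (C U) * ball_difference m T x) has_sum of_real (eigenvalue S) * ball_difference m T x) (superballs S)"
    by (intro has_sum_cmult_left has_sum_of_real)
  then have "((\<lambda>U. a * indicator_term T x U - b * indicator_term S x U) has_sum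
      of_real (eigenvalue S) * ball_difference m T x) (superballs S)"
    by (subst has_sum_cong[OF 2])
  with 1 show ?thesis unfolding S_def by (rule has_sum_unique)
qed

end


section \<open>Schroedinger operators with a locally constant potential\<close>

locale schroedinger_locally_constant = homogeneous_hierarchical_laplacian m C
  for m :: "'a::metric_space measure" and C +
  fixes V :: "'a \<Rightarrow> real" and r :: real
  assumes radius_pos: "r > 0" and potential_const: "\<And>x y. dist x y \<le> r \<Longrightarrow> V x = V y"
begin

definition hamiltonian :: "('a \<Rightarrow> complex) \<Rightarrow> 'a \<Rightarrow> complex" where
  "hamiltonian f x = hier_laplacian m C f x + of_real (V x) * f x"

lemma schroedinger_op_eq: "schroedinger_op m C V = op_closure m {(f, hamiltonian f) | f. f \<in> test_functions}"
  unfolding schroedinger_op_def hamiltonian_def[abs_def] ..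

lemma hamiltonian_comb:
  assumes "finite I" "\<And>i. i \<in> I \<Longrightarrow> f i \<in> test_functions"
  shows "hamiltonian (\<lambda>x. \<Sum>i\<in>I. c i * f i x) = (\<lambda>x. \<Sum>i\<in>I. c i * hamiltonian (f i) x)"
  unfolding hamiltonian_def
  by (intro ext, subst hier_laplacian_comb[OF assms])
     (auto simp: distrib_left sum.distrib sum_distrib_left mult_ac)

lemma potential_on_small_set:
  assumes "S \<subseteq> cball z r" "x \<in> S" "y \<in> S"
  shows "V x = V y"
proof -
  have "dist z x \<le> r" "dist z y \<le> r" using assms by auto
  then show ?thesis using potential_const[of z x] potential_const[of z y] by simp
qed

lemma potential_indicator_L2:
  assumes "0 < \<delta>" "\<delta> \<le> r"
  shows "(\<lambda>x. complex_of_real (V x) * indicator (cball a \<delta>) x) \<in> L2 m"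
proof -
  have "V x = V a" if "x \<in> cball a \<delta>" for x
    using that assms potential_const[of a x] by simp
  then have "(\<lambda>x. complex_of_real (V x) * indicator (cball a \<delta>) x) = (\<lambda>x. of_real (V a) * indicator (cball a \<delta>) x)"
    by (auto simp: indicator_def)
  then show ?thesis using L2_cmult[OF indicator_ball_L2[OF cball_in_balls[OF assms(1)]]] by simp
qed

lemma hamiltonian_indicator_L2:
  assumes "0 < \<delta>" "\<delta> \<le> r"
  shows "hamiltonian (indicator (cball a \<delta>)) \<in> L2 m"
  unfolding hamiltonian_def[abs_def]
  by (rule L2_add[OF hier_laplacian_indicator_L2[OF cball_in_balls[OF assms(1)]] potential_indicator_L2[OF assms]])

lemma test_function_small_decomposition:
  fixes f :: "'a \<Rightarrow> complex"
  assumes f: "f \<in> test_functions"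
  shows "\<exists>\<delta>0>0. \<delta>0 \<le> r \<and> (\<forall>\<delta>. 0 < \<delta> \<longrightarrow> \<delta> \<le> \<delta>0 \<longrightarrow>
    (\<exists>\<K> c. finite \<K> \<and> \<K> \<subseteq> range (\<lambda>x. cball x \<delta>) \<and> f = (\<lambda>x. \<Sum>K\<in>\<K>. c K * indicator K x)))"
proof -
  obtain \<delta>0 where \<delta>0: "\<delta>0 > 0" "\<And>\<delta>. 0 < \<delta> \<Longrightarrow> \<delta> \<le> \<delta>0 \<Longrightarrow>
    (\<exists>\<K> c. finite \<K> \<and> \<K> \<subseteq> range (\<lambda>x. cball x \<delta>) \<and> f = (\<lambda>x. \<Sum>K\<in>\<K>. c K * indicator K x))"
    using test_function_decomposition[OF f] by blast
  then show ?thesis using radius_pos by (intro exI[of _ "min \<delta>0 r"]) auto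
qed

lemma hamiltonian_L2:
  assumes f: "f \<in> test_functions"
  shows "hamiltonian f \<in> L2 m"
proof -
  obtain \<delta> where \<delta>: "\<delta> > 0" "\<delta> \<le> r" "\<And>\<delta>'. 0 < \<delta>' \<Longrightarrow> \<delta>' \<le> \<delta> \<Longrightarrow>
      (\<exists>\<K> c. finite \<K> \<and> \<K> \<subseteq> range (\<lambda>x. cball x \<delta>') \<and> f = (\<lambda>x. \<Sum>K\<in>\<K>. c K * indicator K x))"
    using test_function_small_decomposition[OF f] by blast
  obtain \<K> c where K: "finite \<K>" "\<K> \<subseteq> range (\<lambda>x. cball x \<delta>)" "f = (\<lambda>x. \<Sum>K\<in>\<K>. c K * indicator K x)"
    using \<delta>(3)[OF \<delta>(1)] by blast
  have KB: "K \<in> balls" if "K \<in> \<K>" for K using that K(2) cball_in_balls[OF \<delta>(1)] by blast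
  have "hamiltonian f = (\<lambda>x. \<Sum>K\<in>\<K>. c K * hamiltonian (indicator K) x)"
    unfolding K(3) by (rule hamiltonian_comb[OF K(1)]) (rule test_indicator[OF KB])
  also have "\<dots> \<in> L2 m"
    by (intro L2_sum L2_cmult) (use K(2) hamiltonian_indicator_L2[OF \<delta>(1,2)] in blast)
  finally show ?thesis .
qed

text \<open>
  Balls of equal radius coincide or are disjoint, the two cases covered for the Laplacian; the potential is real.
\<close>

lemma hamiltonian_symmetric_on_balls:
  assumes \<delta>: "0 < \<delta>" "\<delta> \<le> r" and A: "A = cball a \<delta>" and B: "B = cball b \<delta>"
  shows "L2_inner m (hamiltonian (indicator A)) (indicator B) = L2_inner m (indicator A) (hamiltonian (indicator B))"
proof -
  have balls: "A \<in> balls" "B \<in> balls" unfolding A B using cball_in_balls[OF \<delta>(1)] by auto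
  have "A = B \<or> A \<inter> B = {}"
    unfolding A B using cball_recentre[of _ a \<delta>] cball_recentre[of _ b \<delta>] by blast
  then have L: "L2_inner m (hier_laplacian m C (indicator A)) (indicator B) =
      L2_inner m (indicator A) (hier_laplacian m C (indicator B))"
    by (rule hier_laplacian_indicator_symmetric[OF balls])
  have V: "L2_inner m (\<lambda>x. of_real (V x) * indicator A x) (indicator B) =
      L2_inner m (indicator A) (\<lambda>x. of_real (V x) * indicator B x)"
    unfolding L2_inner_def by (intro Bochner_Integration.integral_cong refl) simp
  have VL: "(\<lambda>x. complex_of_real (V x) * indicator A x) \<in> L2 m" "(\<lambda>x. complex_of_real (V x) * indicator B x) \<in> L2 m"
    unfolding A B by (rule potential_indicator_L2[OF \<delta>])+
  have "L2_inner m (hamiltonian (indicator A)) (indicator B) =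
      L2_inner m (hier_laplacian m C (indicator A)) (indicator B) + L2_inner m (\<lambda>x. of_real (V x) * indicator A x) (indicator B)"
    unfolding hamiltonian_def[abs_def]
    by (rule L2_inner_add_left[OF hier_laplacian_indicator_L2[OF balls(1)] VL(1) indicator_ball_L2[OF balls(2)]])
  also have "\<dots> = L2_inner m (indicator A) (hamiltonian (indicator B))"
    unfolding L V hamiltonian_def[abs_def]
    by (rule L2_inner_add_right[OF hier_laplacian_indicator_L2[OF balls(2)] VL(2) indicator_ball_L2[OF balls(1)], symmetric])
  finally show ?thesis .
qed

text \<open>
  Both functions are combinations of indicators of balls of one common radius.
\<close>

lemma hamiltonian_symmetric:
  assumes f: "f \<in> test_functions" and g: "g \<in> test_functions"
  shows "L2_inner m (hamiltonian f) g = L2_inner m f (hamiltonian g)"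
proof -
  obtain \<delta>1 where \<delta>1: "\<delta>1 > 0" "\<delta>1 \<le> r" "\<And>\<delta>'. 0 < \<delta>' \<Longrightarrow> \<delta>' \<le> \<delta>1 \<Longrightarrow>
      (\<exists>\<K> c. finite \<K> \<and> \<K> \<subseteq> range (\<lambda>x. cball x \<delta>') \<and> f = (\<lambda>x. \<Sum>K\<in>\<K>. c K * indicator K x))"
    using test_function_small_decomposition[OF f] by blast
  obtain \<delta>2 where \<delta>2: "\<delta>2 > 0" "\<delta>2 \<le> r" "\<And>\<delta>'. 0 < \<delta>' \<Longrightarrow> \<delta>' \<le> \<delta>2 \<Longrightarrow>
      (\<exists>\<K> c. finite \<K> \<and> \<K> \<subseteq> range (\<lambda>x. cball x \<delta>') \<and> g = (\<lambda>x. \<Sum>K\<in>\<K>. c K * indicator K x))"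
    using test_function_small_decomposition[OF g] by blast
  define \<delta> where "\<delta> = min \<delta>1 \<delta>2"
  have \<delta>: "0 < \<delta>" "\<delta> \<le> \<delta>1" "\<delta> \<le> \<delta>2" "\<delta> \<le> r" using \<delta>1 \<delta>2 by (auto simp: \<delta>_def)
  obtain \<K> c where K: "finite \<K>" "\<K> \<subseteq> range (\<lambda>x. cball x \<delta>)" "f = (\<lambda>x. \<Sum>K\<in>\<K>. c K * indicator K x)"
    using \<delta>1(3)[OF \<delta>(1,2)] by blast
  obtain \<J> d where J: "finite \<J>" "\<J> \<subseteq> range (\<lambda>x. cball x \<delta>)" "g = (\<lambda>x. \<Sum>J\<in>\<J>. d J * indicator J x)"
    using \<delta>2(3)[OF \<delta>(1,3)] by blast
  have B: "K \<in> balls" "hamiltonian (indicator K) \<in> L2 m" if "K \<in> range (\<lambda>x. cball x \<delta>)" for K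
    using that cball_in_balls[OF \<delta>(1)] hamiltonian_indicator_L2[OF \<delta>(1,4)] by blast+
  have KB: "K \<in> balls" "hamiltonian (indicator K) \<in> L2 m" if "K \<in> \<K>" for K
    using B K(2) that by blast+
  have JB: "J \<in> balls" "hamiltonian (indicator J) \<in> L2 m" if "J \<in> \<J>" for J
    using B J(2) that by blast+
  have Hf: "hamiltonian f = (\<lambda>x. \<Sum>K\<in>\<K>. c K * hamiltonian (indicator K) x)"
    unfolding K(3) by (rule hamiltonian_comb[OF K(1)]) (rule test_indicator[OF KB(1)])
  have Hg: "hamiltonian g = (\<lambda>x. \<Sum>J\<in>\<J>. d J * hamiltonian (indicator J) x)"
    unfolding J(3) by (rule hamiltonian_comb[OF J(1)]) (rule test_indicator[OF JB(1)])
  have bilinear: "L2_inner m (\<lambda>x. \<Sum>K\<in>\<K>. c K * u K x) (\<lambda>x. \<Sum>J\<in>\<J>. d J * v J x) =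
      (\<Sum>K\<in>\<K>. \<Sum>J\<in>\<J>. c K * (cnj (d J) * L2_inner m (u K) (v J)))"
    if u: "\<And>K. K \<in> \<K> \<Longrightarrow> u K \<in> L2 m" and v: "\<And>J. J \<in> \<J> \<Longrightarrow> v J \<in> L2 m" for u v
  proof -
    have vL: "(\<lambda>x. \<Sum>J\<in>\<J>. d J * v J x) \<in> L2 m" by (intro L2_sum L2_cmult v)
    have "L2_inner m (\<lambda>x. \<Sum>K\<in>\<K>. c K * u K x) (\<lambda>x. \<Sum>J\<in>\<J>. d J * v J x) =
        (\<Sum>K\<in>\<K>. L2_inner m (\<lambda>x. c K * u K x) (\<lambda>x. \<Sum>J\<in>\<J>. d J * v J x))"
      by (rule L2_inner_sum_left[OF _ vL]) (intro L2_cmult u)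
    also have "\<dots> = (\<Sum>K\<in>\<K>. \<Sum>J\<in>\<J>. c K * (cnj (d J) * L2_inner m (u K) (v J)))"
    proof (rule sum.cong[OF refl])
      fix K assume K: "K \<in> \<K>"
      have "L2_inner m (u K) (\<lambda>x. \<Sum>J\<in>\<J>. d J * v J x) = (\<Sum>J\<in>\<J>. L2_inner m (u K) (\<lambda>x. d J * v J x))"
        by (rule L2_inner_sum_right[OF _ u[OF K]]) (intro L2_cmult v)
      then show "L2_inner m (\<lambda>x. c K * u K x) (\<lambda>x. \<Sum>J\<in>\<J>. d J * v J x) =
          (\<Sum>J\<in>\<J>. c K * (cnj (d J) * L2_inner m (u K) (v J)))"
        by (simp add: L2_inner_cmult_left L2_inner_cmult_right sum_distrib_left)
    qed
    finally show ?thesis .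
  qed
  have "L2_inner m (hamiltonian f) g =
      (\<Sum>K\<in>\<K>. \<Sum>J\<in>\<J>. c K * (cnj (d J) * L2_inner m (hamiltonian (indicator K)) (indicator J)))"
    unfolding Hf unfolding J(3) by (rule bilinear) (use KB(2) indicator_ball_L2 JB(1) in auto)
  also have "\<dots> = (\<Sum>K\<in>\<K>. \<Sum>J\<in>\<J>. c K * (cnj (d J) * L2_inner m (indicator K) (hamiltonian (indicator J))))"
  proof (intro sum.cong refl)
    fix K J assume "K \<in> \<K>" "J \<in> \<J>"
    then obtain a b where "K = cball a \<delta>" "J = cball b \<delta>" using K(2) J(2) by blast
    from hamiltonian_symmetric_on_balls[OF \<delta>(1,4) this]
    show "c K * (cnj (d J) * L2_inner m (hamiltonian (indicator K)) (indicator J)) =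
        c K * (cnj (d J) * L2_inner m (indicator K) (hamiltonian (indicator J)))" by simp
  qed
  also have "\<dots> = L2_inner m f (hamiltonian g)"
    unfolding Hg unfolding K(3) by (rule bilinear[symmetric]) (use KB(1) indicator_ball_L2 JB(2) in auto)
  finally show ?thesis .
qed

end


section \<open>Eigenbases\<close>

context homogeneous_ultrametric_measure_space
begin

definition children_differences :: "'a set \<Rightarrow> ('a \<Rightarrow> complex) set" where
  "children_differences S = ball_difference m ` {T \<in> balls. parent T = S}"

text \<open>
  The differences belonging to the children of one ball are not orthogonal to each other, and they are linearly
  dependent; an orthonormal system spanning them is chosen instead.
\<close>

definition node_basis :: "'a set \<Rightarrow> ('a \<Rightarrow> complex) set" where
  "node_basis S = (SOME E. orthonormal_system m E \<and> E \<subseteq> lin_span (children_differences S) \<and>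
     children_differences S \<subseteq> closed_span m E)"

lemma children_differences_test: "children_differences S \<subseteq> test_functions"
  unfolding children_differences_def using ball_difference_test by blast

lemma children_differences_L2: "children_differences S \<subseteq> L2 m"
  using children_differences_test test_function_L2 by blast

lemma node_basis:
  assumes "S \<in> balls"
  shows "orthonormal_system m (node_basis S)" "node_basis S \<subseteq> lin_span (children_differences S)"
    "children_differences S \<subseteq> closed_span m (node_basis S)"
proof -
  have "finite (children_differences S)"
    unfolding children_differences_def by (intro finite_imageI finite_children assms)
  from gram_schmidt[OF this children_differences_L2]
  have ex: "\<exists>E. orthonormal_system m E \<and> E \<subseteq> lin_span (children_differences S) \<and>
      children_differences S \<subseteq> closed_span m E" by blast
  from someI_ex[OF ex]
  show "orthonormal_system m (node_basis S)" "node_basis S \<subseteq> lin_span (children_differences S)"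
    "children_differences S \<subseteq> closed_span m (node_basis S)"
    unfolding node_basis_def by blast+
qed

text \<open>
  The complement of a ball in its parent is open and nonempty, hence of positive measure.
\<close>

lemma measure_parent_greater:
  fixes T :: "'a set"
  assumes T: "T \<in> balls"
  shows "measure m T < measure m (parent T)"
proof -
  note P = parent_ball[OF T]
  have "open (parent T - T)"
    by (rule open_Diff[OF ball_open[OF P] compact_imp_closed[OF ball_compact[OF T]]])
  moreover have "parent T - T \<noteq> {}" using parent_psubset[OF T] by blast
  ultimately have "emeasure m (parent T - T) > 0" by (rule full_support)
  moreover have fin: "emeasure m (parent T - T) < \<infinity>"
    using emeasure_mono[of "parent T - T" "parent T" m] emeasure_ball_finite[OF P] ball_sets[OF P]
    by (auto intro: le_less_trans)
  ultimately have "measure m (parent T - T) > 0" by (simp add: measure_def enn2real_positive_iff)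
  moreover have "measure m (parent T - T) = measure m (parent T) - measure m T"
    by (rule measure_Diff)
       (use emeasure_ball_finite[OF P] ball_sets P T parent_psubset[OF T] in \<open>auto simp: less_top\<close>)
  ultimately show ?thesis by simp
qed

text \<open>
  Needed so that every node contributes its eigenvalue to the spectrum.
\<close>

lemma node_basis_nonempty:
  fixes S :: "'a set"
  assumes S: "S \<in> balls" and pos: "diameter S > 0"
  shows "node_basis S \<noteq> {}"
proof
  assume empty: "node_basis S = {}"
  obtain x where "x \<in> S" using ball_nonempty[OF S] by blast
  then obtain T where T: "T \<in> balls" "parent T = S" using child_through[OF S pos] by blast
  have "ball_difference m T \<in> closed_span m (node_basis S)"
    using node_basis(3)[OF S] T by (auto simp: children_differences_def)
  then have "L2_norm m (ball_difference m T) = 0"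
    by (rule orthonormal_system.closed_span_coefficients_zero[OF node_basis(1)[OF S]]) (simp add: empty)
  then have "L2_inner m (ball_difference m T) (indicator T) = 0"
    using L2_Cauchy_Schwarz[OF ball_difference_L2[OF T(1)] indicator_ball_L2[OF T(1)]] by simp
  moreover have "parent T \<inter> T = T" using parent_psubset[OF T(1)] by blast
  ultimately have "complex_of_real (measure m T / measure m T - measure m T / measure m (parent T)) = 0"
    using inner_ball_difference_indicator[OF T(1) T(1)] by simp
  then have "measure m T / measure m T - measure m T / measure m (parent T) = 0"
    by (simp only: of_real_eq_0_iff)
  then show False
    using measure_parent_greater[OF T(1)] measure_ball_pos[OF T(1)] by (simp add: field_simps)
qed

lemma node_bases_orthogonal:
  assumes S: "S \<in> balls" "S' \<in> balls" "S \<noteq> S'" and u: "u \<in> node_basis S" and v: "v \<in> node_basis S'"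
  shows "L2_inner m u v = 0"
proof -
  have uL: "u \<in> closed_span m (children_differences S)"
    using u node_basis(2)[OF S(1)] lin_span_L2[OF children_differences_L2]
    by (intro lin_span_closed_span) blast+
  have vL: "v \<in> closed_span m (children_differences S')"
    using v node_basis(2)[OF S(2)] lin_span_L2[OF children_differences_L2]
    by (intro lin_span_closed_span) blast+
  have "L2_inner m f v = 0" if f: "f \<in> children_differences S" for f
  proof -
    have fL: "f \<in> L2 m" using f children_differences_L2 by blast
    have "L2_inner m v f = 0"
    proof (rule closed_span_orthogonal[OF children_differences_L2 fL _ vL])
      fix g assume "g \<in> children_differences S'"
      then show "L2_inner m g f = 0"
        using f S(3) ball_differences_orthogonal unfolding children_differences_def by blast
    qed
    then show ?thesis using L2_inner_commute[of m f v] by simp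
  qed
  then show ?thesis
    by (rule closed_span_orthogonal[OF children_differences_L2 closed_span_L2[OF vL] _ uL])
qed

end

context schroedinger_locally_constant
begin

text \<open>A ball of diameter zero has no children, hence carries no eigenfunctions.\<close>

definition nodes :: "'a set set" where
  "nodes = {S \<in> balls. 0 < diameter S \<and> (\<exists>z. S \<subseteq> cball z r)}"

definition node_value :: "'a set \<Rightarrow> real" where
  "node_value S = eigenvalue S + V (SOME x. x \<in> S)"

lemma node_value_eq:
  assumes "S \<in> nodes" "x \<in> S"
  shows "node_value S = eigenvalue S + V x"
proof -
  have "(SOME x. x \<in> S) \<in> S" using assms(2) by (rule someI)
  moreover obtain z where "S \<subseteq> cball z r" using assms(1) unfolding nodes_def by blast
  ultimately have "V (SOME x. x \<in> S) = V x" using potential_on_small_set assms(2) by metis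
  then show ?thesis by (simp add: node_value_def)
qed

lemma hamiltonian_ball_difference:
  assumes T: "T \<in> balls" and S: "parent T \<in> nodes"
  shows "hamiltonian (ball_difference m T) = (\<lambda>x. of_real (node_value (parent T)) * ball_difference m T x)"
proof
  fix x
  show "hamiltonian (ball_difference m T) x = of_real (node_value (parent T)) * ball_difference m T x"
  proof (cases "x \<in> parent T")
    case True
    then show ?thesis
      unfolding hamiltonian_def hier_laplacian_ball_difference[OF T] node_value_eq[OF S True]
      by (simp add: distrib_right)
  next
    case False
    then show ?thesis
      unfolding hamiltonian_def hier_laplacian_ball_difference[OF T]
      by (simp add: ball_difference_outside[OF T])
  qed
qed

lemma hamiltonian_node:
  assumes S: "S \<in> nodes" and e: "e \<in> lin_span (children_differences S)"
  shows "hamiltonian e = (\<lambda>x. of_real (node_value S) * e x)"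
proof -
  obtain F c where F: "finite F" "F \<subseteq> children_differences S" "e = (\<lambda>x. \<Sum>u\<in>F. c u * u x)"
    using e unfolding lin_span_def by blast
  have "hamiltonian e = (\<lambda>x. \<Sum>u\<in>F. c u * hamiltonian u x)"
    unfolding F(3) by (rule hamiltonian_comb[OF F(1)]) (use F(2) children_differences_test in blast)
  also have "\<dots> = (\<lambda>x. \<Sum>u\<in>F. c u * (of_real (node_value S) * u x))"
  proof (intro ext sum.cong refl)
    fix u x assume "u \<in> F"
    then obtain T where T: "T \<in> balls" "parent T = S" "u = ball_difference m T"
      using F(2) by (auto simp: children_differences_def)
    have "hamiltonian u = (\<lambda>x. of_real (node_value S) * u x)"
      unfolding T(3) using hamiltonian_ball_difference[OF T(1)] S unfolding T(2) by blast
    then show "c u * hamiltonian u x = c u * (of_real (node_value S) * u x)" by simp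
  qed
  also have "\<dots> = (\<lambda>x. of_real (node_value S) * e x)"
    unfolding F(3) by (simp add: sum_distrib_left mult_ac)
  finally show ?thesis .
qed

text \<open>
  The family \<open>\<S>\<close> selects the eigenfunctions that are to be spanned, and \<open>W\<close> consists of test functions that fill
  up their orthogonal complement. The two applications take all balls inside the horocycle and all balls inside one of
  its members.
\<close>

theorem diagonalization:
  assumes \<S>: "\<S> \<subseteq> nodes" and W: "W \<subseteq> test_functions"
    and orth: "\<And>T w. T \<in> balls \<Longrightarrow> parent T \<in> \<S> \<Longrightarrow> w \<in> W \<Longrightarrow> L2_inner m (ball_difference m T) w = 0"
    and total: "\<And>f. f \<in> L2 m \<Longrightarrow> (\<And>T. T \<in> balls \<Longrightarrow> parent T \<in> \<S> \<Longrightarrow> L2_inner m f (ball_difference m T) = 0) \<Longrightarrow>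
      (\<And>w. w \<in> W \<Longrightarrow> L2_inner m f w = 0) \<Longrightarrow> AE x in m. f x = 0"
  shows "\<exists>E \<mu>. orthonormal_system m E \<and> \<mu> ` E = node_value ` \<S> \<and>
    closed_span m E = closed_span m {ball_difference m T | T. T \<in> balls \<and> parent T \<in> \<S>} \<and>
    closed_span m E = orth_complement m (closed_span m W) \<and>
    op_restrict (schroedinger_op m C V) (closed_span m E) = diagonal_operator m E \<mu>"
proof -
  define E where "E = (\<Union>S\<in>\<S>. node_basis S)"
  define G where "G = {ball_difference m T | T. T \<in> balls \<and> parent T \<in> \<S>}"
  have SB: "S \<in> balls" if "S \<in> \<S>" for S using that \<S> by (auto simp: nodes_def)
  have G_eq: "G = (\<Union>S\<in>\<S>. children_differences S)"
    unfolding G_def children_differences_def by blast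
  have unique: "S = S'" if "S \<in> \<S>" "S' \<in> \<S>" "e \<in> node_basis S" "e \<in> node_basis S'" for S S' e
  proof (rule ccontr)
    assume "S \<noteq> S'"
    then have "L2_inner m e e = 0" using that SB by (intro node_bases_orthogonal)
    moreover have "L2_inner m e e = 1"
      using orthonormal_system.inner_system[OF node_basis(1)[OF SB[OF that(1)]] that(3,3)] by simp
    ultimately show False by simp
  qed
  define node where "node e = (THE S. S \<in> \<S> \<and> e \<in> node_basis S)" for e
  have node: "node e = S" if "S \<in> \<S>" "e \<in> node_basis S" for e S
    unfolding node_def using that unique by (intro the_equality) auto
  define \<mu> where "\<mu> e = node_value (node e)" for e
  have span: "E \<subseteq> lin_span G"
    unfolding E_def
  proof (rule UN_least)
    fix S assume S: "S \<in> \<S>"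
    have "lin_span (children_differences S) \<subseteq> lin_span G"
      by (rule lin_span_mono) (use S in \<open>auto simp: G_eq\<close>)
    then show "node_basis S \<subseteq> lin_span G" using node_basis(2)[OF SB[OF S]] by blast
  qed
  have G_test: "G \<subseteq> test_functions" unfolding G_eq using children_differences_test by blast
  have G_L2: "G \<subseteq> L2 m" using G_test test_function_L2 by blast
  have E_test: "E \<subseteq> test_functions"
    using span lin_span_minimal[OF G_test test_zero test_add test_cmult] by blast
  have E_L2: "E \<subseteq> L2 m" using E_test test_function_L2 by blast
  have ortho: "orthonormal_system m E"
  proof
    show "E \<subseteq> L2 m" by (rule E_L2)
    fix u v assume "u \<in> E" "v \<in> E"
    then obtain S S' where S: "S \<in> \<S>" "u \<in> node_basis S" "S' \<in> \<S>" "v \<in> node_basis S'"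
      unfolding E_def by blast
    show "L2_inner m u v = (if u = v then 1 else 0)"
    proof (cases "S = S'")
      case True
      then show ?thesis
        using orthonormal_system.inner_system[OF node_basis(1)[OF SB[OF S(1)]] S(2)] S(4) by simp
    next
      case False
      then have "u \<noteq> v" using unique S by blast
      then show ?thesis using node_bases_orthogonal[OF SB[OF S(1)] SB[OF S(3)] False S(2,4)] by simp
    qed
  qed
  interpret E: orthonormal_system m E by (rule ortho)
  have G_span: "G \<subseteq> closed_span m E"
  proof
    fix f assume "f \<in> G"
    then obtain S where S: "S \<in> \<S>" "f \<in> children_differences S" unfolding G_eq by blast
    have "node_basis S \<subseteq> closed_span m E"
      using closed_span_base[OF E_L2] S(1) by (auto simp: E_def)
    from closed_span_minimal[OF this] show "f \<in> closed_span m E"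
      using node_basis(3)[OF SB[OF S(1)]] S(2) by blast
  qed
  have spans: "closed_span m E = closed_span m G"
  proof
    show "closed_span m G \<subseteq> closed_span m E" by (rule closed_span_minimal[OF G_span])
    show "closed_span m E \<subseteq> closed_span m G"
    proof (rule closed_span_minimal)
      show "E \<subseteq> closed_span m G" using span E_L2 lin_span_closed_span by blast
    qed
  qed
  have GW: "L2_inner m g w = 0" if "g \<in> G" "w \<in> W" for g w
    using that orth by (auto simp: G_def)
  interpret symmetric_operator_with_eigenvectors m E test_functions W hamiltonian \<mu>
  proof
    show "test_functions \<subseteq> L2 m" using test_function_L2 by blast
    show "hamiltonian f \<in> L2 m" if "f \<in> test_functions" for f by (rule hamiltonian_L2[OF that])
    show "(\<lambda>x. 0) \<in> (test_functions :: ('a \<Rightarrow> complex) set)" by (rule test_zero)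
    show "(\<lambda>x. f x + g x) \<in> test_functions" if "f \<in> test_functions" "g \<in> test_functions" for f g :: "'a \<Rightarrow> complex"
      by (rule test_add[OF that])
    show "(\<lambda>x. c * f x) \<in> test_functions" if "f \<in> test_functions" for f :: "'a \<Rightarrow> complex" and c
      by (rule test_cmult[OF that])
    show "hamiltonian (\<lambda>x. \<Sum>u\<in>F. c u * u x) = (\<lambda>x. \<Sum>u\<in>F. c u * hamiltonian u x)"
      if "finite F" "F \<subseteq> test_functions" for F c
      by (rule hamiltonian_comb[OF that(1)]) (use that(2) in blast)
    show "L2_inner m (hamiltonian f) g = L2_inner m f (hamiltonian g)"
      if "f \<in> test_functions" "g \<in> test_functions" for f g by (rule hamiltonian_symmetric[OF that])
    show "E \<subseteq> test_functions" by (rule E_test)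
    show "hamiltonian e = (\<lambda>x. of_real (\<mu> e) * e x)" if e: "e \<in> E" for e
    proof -
      obtain S where S: "S \<in> \<S>" "e \<in> node_basis S" using e unfolding E_def by blast
      have "e \<in> lin_span (children_differences S)" using S node_basis(2)[OF SB] by blast
      then show ?thesis
        using hamiltonian_node[of S e] S(1) \<S> unfolding \<mu>_def node[OF S] by blast
    qed
    show "W \<subseteq> test_functions" by (rule W)
    show "L2_inner m e w = 0" if w: "w \<in> W" and e: "e \<in> E" for w e
    proof (rule closed_span_orthogonal[OF G_L2])
      show "w \<in> L2 m" using w W test_function_L2 by blast
      show "L2_inner m g w = 0" if "g \<in> G" for g by (rule GW[OF that w])
      show "e \<in> closed_span m G" using e spans closed_span_base[OF E_L2] by blast
    qed
    show "AE x in m. f x = 0" if f: "f \<in> L2 m" and f_orth: "\<And>u. u \<in> E \<union> W \<Longrightarrow> L2_inner m f u = 0" for f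
    proof (rule total[OF f])
      fix w assume "w \<in> W"
      then show "L2_inner m f w = 0" using f_orth by blast
    next
      fix T assume "T \<in> balls" "parent T \<in> \<S>"
      then have "ball_difference m T \<in> closed_span m E" using G_span by (auto simp: G_def)
      then have "L2_inner m (ball_difference m T) f = 0"
      proof (rule closed_span_orthogonal[OF E_L2 f, rotated])
        fix e assume "e \<in> E"
        then show "L2_inner m e f = 0" using f_orth[of e] L2_inner_commute[of m e f] by simp
      qed
      then show "L2_inner m f (ball_difference m T) = 0"
        using L2_inner_commute[of m f "ball_difference m T"] by simp
    qed
  qed
  have "\<mu> ` E = node_value ` \<S>"
  proof
    show "\<mu> ` E \<subseteq> node_value ` \<S>" using node by (auto simp: E_def \<mu>_def)
    show "node_value ` \<S> \<subseteq> \<mu> ` E"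
    proof
      fix y assume "y \<in> node_value ` \<S>"
      then obtain S where S: "S \<in> \<S>" "y = node_value S" by blast
      have "node_basis S \<noteq> {}" using S(1) \<S> by (intro node_basis_nonempty) (auto simp: nodes_def)
      then obtain e where e: "e \<in> node_basis S" by blast
      then have "\<mu> e = y" using node[OF S(1) e] S(2) by (simp add: \<mu>_def)
      then show "y \<in> \<mu> ` E" using e S(1) by (auto simp: E_def)
    qed
  qed
  then show ?thesis
    using ortho spans orth_complement_W restricted_closure_diagonal unfolding schroedinger_op_eq G_def by metis
qed

end


section \<open>The spectrum below a horocycle\<close>

lemma closure_sums:
  fixes A R :: "real set"
  shows "closure {s + t | s t. s \<in> closure A \<and> t \<in> R} = closure {s + t | s t. s \<in> A \<and> t \<in> R}"
proof
  show "closure {s + t | s t. s \<in> A \<and> t \<in> R} \<subseteq> closure {s + t | s t. s \<in> closure A \<and> t \<in> R}"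
    by (rule closure_mono) (use closure_subset in blast)
  show "closure {s + t | s t. s \<in> closure A \<and> t \<in> R} \<subseteq> closure {s + t | s t. s \<in> A \<and> t \<in> R}"
  proof (rule closure_minimal[OF _ closed_closure], clarify)
    fix s t assume s: "s \<in> closure A" and t: "t \<in> R"
    show "s + t \<in> closure {s + t | s t. s \<in> A \<and> t \<in> R}"
      unfolding closure_approachable
    proof (intro allI impI)
      fix \<epsilon> :: real assume "\<epsilon> > 0"
      then obtain a where "a \<in> A" "dist a s < \<epsilon>" using s unfolding closure_approachable by blast
      then show "\<exists>y\<in>{s + t | s t. s \<in> A \<and> t \<in> R}. dist y (s + t) < \<epsilon>"
        using t by (intro bexI[of _ "a + t"]) (auto simp: dist_real_def)
    qed
  qed
qed

context homogeneous_hierarchical_laplacian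
begin

definition eigenvalues_below :: "'a set \<Rightarrow> real set" where
  "eigenvalues_below B = eigenvalue ` {S \<in> balls. 0 < diameter S \<and> S \<subseteq> B}"

text \<open>
  This is where homogeneity enters: the isometry group acts transitively on the balls of one horocycle.
\<close>

lemma eigenvalues_below_cong: "eigenvalues_below (cball x r) = eigenvalues_below (cball y r)"
proof -
  have sub: "eigenvalues_below (cball x r) \<subseteq> eigenvalues_below (cball y r)" for x y
  proof
    fix l assume "l \<in> eigenvalues_below (cball x r)"
    then obtain S where S: "S \<in> balls" "0 < diameter S" "S \<subseteq> cball x r" "l = eigenvalue S"
      unfolding eigenvalues_below_def by blast
    obtain g where g: "g \<in> isometries" "g x = y" using transitive by blast
    have "g ` S \<subseteq> cball y r" using S(3) isometry_cball[OF g(1), of x r] g(2) by blast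
    moreover have "eigenvalue (g ` S) = l" using eigenvalue_cong[OF S(1) g(1)] S(4) by simp
    ultimately show "l \<in> eigenvalues_below (cball y r)"
      unfolding eigenvalues_below_def
      using isometry_ball[OF g(1) S(1)] diameter_isometry[OF g(1)] S(2) by (intro image_eqI[of _ _ "g ` S"]) auto
  qed
  show ?thesis using sub by blast
qed

lemma parent_below_iff:
  fixes B :: "'a set"
  assumes "B \<in> balls" "T \<in> balls"
  shows "parent T \<subseteq> B \<longleftrightarrow> T \<subset> B"
  using parent_least[OF assms(2,1)] parent_psubset[OF assms(2)] by blast

text \<open>
  The case of zero potential. The functions orthogonal to the indicator of the ball and to the indicators of all
  balls disjoint from it are supported on the ball and have integral zero, and these are spanned by the differences.
\<close>

theorem spectrum_laplacian_ball:
  assumes "r > 0"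
  shows "spectrum m (L_ball m (cball b r)) (laplacian_ball m C (cball b r)) =
    complex_of_real ` closure (eigenvalues_below (cball b r))"
proof -
  define B where "B = cball b r"
  have B: "B \<in> balls" unfolding B_def by (rule cball_in_balls[OF assms])
  interpret schroedinger_locally_constant m C "\<lambda>x. 0" r
    by unfold_locales (use assms in auto)
  define \<S> where "\<S> = {S \<in> balls. 0 < diameter S \<and> S \<subseteq> B}"
  define W where "W = insert (indicator B) {indicator A :: 'a \<Rightarrow> complex | A. A \<in> balls \<and> A \<inter> B = {}}"
  have below: "parent T \<in> \<S> \<longleftrightarrow> T \<subset> B" if "T \<in> balls" for T
    using parent_below_iff[OF B that] parent_ball[OF that] diameter_parent_pos[OF that] by (simp add: \<S>_def)
  have "\<exists>E \<mu>. orthonormal_system m E \<and> \<mu> ` E = node_value ` \<S> \<and>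
      closed_span m E = closed_span m {ball_difference m T | T. T \<in> balls \<and> parent T \<in> \<S>} \<and>
      closed_span m E = orth_complement m (closed_span m W) \<and>
      op_restrict (schroedinger_op m C (\<lambda>x. 0)) (closed_span m E) = diagonal_operator m E \<mu>"
  proof (rule diagonalization)
    show "\<S> \<subseteq> nodes" unfolding \<S>_def nodes_def B_def by blast
    show "W \<subseteq> test_functions" unfolding W_def using test_indicator B by blast
  next
    fix T w assume T: "T \<in> balls" "parent T \<in> \<S>" and "w \<in> W"
    then consider "w = indicator B" | A where "w = indicator A" "A \<in> balls" "A \<inter> B = {}"
      unfolding W_def by blast
    then show "L2_inner m (ball_difference m T) w = 0"
    proof cases
      case 1
      have "\<not> B \<subset> parent T" using T(2) by (auto simp: \<S>_def)
      then show ?thesis unfolding 1 by (rule inner_ball_difference_indicator_zero[OF B T(1)])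
    next
      case 2
      have "\<not> A \<subset> parent T" using T(2) 2(3) ball_nonempty[OF 2(2)] by (auto simp: \<S>_def)
      then show ?thesis unfolding 2(1) by (rule inner_ball_difference_indicator_zero[OF 2(2) T(1)])
    qed
  next
    fix f assume f: "f \<in> L2 m"
      and fT: "\<And>T. T \<in> balls \<Longrightarrow> parent T \<in> \<S> \<Longrightarrow> L2_inner m f (ball_difference m T) = 0"
      and fW: "\<And>w. w \<in> W \<Longrightarrow> L2_inner m f w = 0"
    show "AE x in m. f x = 0"
    proof (rule orthogonal_to_small_balls_imp_zero[OF f assms])
      fix x :: 'a and \<delta> assume \<delta>: "0 < \<delta>" "\<delta> \<le> r"
      have K: "cball x \<delta> \<in> balls" by (rule cball_in_balls[OF \<delta>(1)])
      show "L2_inner m f (indicator (cball x \<delta>)) = 0"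
      proof (cases "cball x \<delta> \<inter> B = {}")
        case True
        then show ?thesis using K by (intro fW) (auto simp: W_def)
      next
        case False
        then obtain y where y: "y \<in> cball x \<delta>" "y \<in> cball b r" by (auto simp: B_def)
        have "cball x \<delta> \<subseteq> B"
          using cball_recentre[OF y(1)] cball_recentre[OF y(2)] \<delta>(2) unfolding B_def
          by (metis subset_cball)
        then show ?thesis
          using fT below by (intro orthogonal_below_ball[OF f B fW _ K]) (auto simp: W_def)
      qed
    qed
  qed
  then obtain E \<mu> where E: "orthonormal_system m E" "\<mu> ` E = node_value ` \<S>"
    "closed_span m E = closed_span m {ball_difference m T | T. T \<in> balls \<and> parent T \<in> \<S>}"
    "op_restrict (schroedinger_op m C (\<lambda>x. 0)) (closed_span m E) = diagonal_operator m E \<mu>" by blast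
  have "{ball_difference m T | T. T \<in> balls \<and> parent T \<in> \<S>} = {ball_difference m T | T. T \<in> balls \<and> T \<subset> B}"
    using below by blast
  then have L: "L_ball m B = closed_span m E" unfolding L_ball_def E(3) by simp
  have op: "laplacian_op m C = schroedinger_op m C (\<lambda>x. 0)"
    unfolding laplacian_op_def schroedinger_op_def by simp
  have "node_value ` \<S> = eigenvalues_below B"
    unfolding eigenvalues_below_def \<S>_def[symmetric] by (simp add: node_value_def)
  then show ?thesis
    unfolding B_def[symmetric] laplacian_ball_def L op E(4)
    using orthonormal_system.spectrum_diagonal_operator[OF E(1), of \<mu>] E(2) by simp
qed

text \<open>
  The potential is constant on each ball of the horocycle, and the indicators of these balls span the complement.
\<close>

theorem schroedinger_minus_diagonal:
  assumes H: "\<H> = range (\<lambda>x. cball x r)" and "r > 0"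
  shows "\<exists>E \<mu>. orthonormal_system m E \<and> L_minus m \<H> = closed_span m E \<and>
    schroedinger_minus m C \<H> \<sigma> = diagonal_operator m E \<mu> \<and>
    \<mu> ` E = {l + t | l t. l \<in> eigenvalues_below (cball b r) \<and> t \<in> \<sigma> ` \<H>}"
proof -
  have HB: "B \<in> balls" if "B \<in> \<H>" for B using that H cball_in_balls[OF \<open>r > 0\<close>] by blast
  have in_H: "x \<in> B \<longleftrightarrow> B = cball x r" if "B \<in> \<H>" for x B
    using that \<open>r > 0\<close> cball_recentre unfolding H by fastforce
  have pot: "horocycle_potential \<H> \<sigma> x = \<sigma> (cball x r)" for x
  proof -
    have "horocycle_potential \<H> \<sigma> x = (\<Sum>\<^sub>\<infinity>B\<in>{cball x r}. \<sigma> B * indicator B x)"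
      unfolding horocycle_potential_def
      by (rule infsum_cong_neutral) (use in_H in \<open>auto simp: H indicator_def\<close>)
    also have "\<dots> = \<sigma> (cball x r)" using \<open>r > 0\<close> by simp
    finally show ?thesis .
  qed
  interpret schroedinger_locally_constant m C "horocycle_potential \<H> \<sigma>" r
  proof
    fix x y :: 'a assume "dist x y \<le> r"
    then have "cball y r = cball x r" by (intro cball_recentre) simp
    then show "horocycle_potential \<H> \<sigma> x = horocycle_potential \<H> \<sigma> y" by (simp add: pot)
  qed fact
  define W where "W = {indicator B :: 'a \<Rightarrow> complex | B. B \<in> \<H>}"
  have below: "parent T \<in> nodes" if "T \<in> balls" "B \<in> \<H>" "T \<subset> B" for T B
    using parent_least[OF that(1) HB[OF that(2)] that(3)] parent_ball[OF that(1)] diameter_parent_pos[OF that(1)] that(2)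
    unfolding nodes_def H by blast
  have "\<exists>E \<mu>. orthonormal_system m E \<and> \<mu> ` E = node_value ` nodes \<and>
      closed_span m E = closed_span m {ball_difference m T | T. T \<in> balls \<and> parent T \<in> nodes} \<and>
      closed_span m E = orth_complement m (closed_span m W) \<and>
      op_restrict (schroedinger_op m C (horocycle_potential \<H> \<sigma>)) (closed_span m E) = diagonal_operator m E \<mu>"
  proof (rule diagonalization)
    show "W \<subseteq> test_functions" unfolding W_def using test_indicator HB by blast
  next
    fix T w assume T: "T \<in> balls" "parent T \<in> nodes" and "w \<in> W"
    then obtain B where B: "w = indicator B" "B \<in> \<H>" unfolding W_def by blast
    have "\<not> B \<subset> parent T"
    proof
      assume less: "B \<subset> parent T"
      obtain z where z: "parent T \<subseteq> cball z r" using T(2) unfolding nodes_def by blast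
      obtain x where x: "x \<in> B" using ball_nonempty[OF HB[OF B(2)]] by blast
      have "x \<in> cball z r" using x less z by blast
      then have "B = cball z r" using in_H[OF B(2), of x] x cball_recentre[of x z r] by simp
      with less z show False by blast
    qed
    then show "L2_inner m (ball_difference m T) w = 0"
      unfolding B(1) by (rule inner_ball_difference_indicator_zero[OF HB[OF B(2)] T(1)])
  next
    fix f assume f: "f \<in> L2 m"
      and fT: "\<And>T. T \<in> balls \<Longrightarrow> parent T \<in> nodes \<Longrightarrow> L2_inner m f (ball_difference m T) = 0"
      and fW: "\<And>w. w \<in> W \<Longrightarrow> L2_inner m f w = 0"
    show "AE x in m. f x = 0"
    proof (rule orthogonal_to_small_balls_imp_zero[OF f \<open>r > 0\<close>])
      fix x :: 'a and \<delta> assume \<delta>: "0 < \<delta>" "\<delta> \<le> r"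
      have B: "cball x r \<in> \<H>" by (simp add: H)
      show "L2_inner m f (indicator (cball x \<delta>)) = 0"
      proof (rule orthogonal_below_ball[OF f HB[OF B]])
        show "L2_inner m f (indicator (cball x r)) = 0" using B by (intro fW) (auto simp: W_def)
        show "L2_inner m f (ball_difference m T) = 0" if "T \<in> balls" "T \<subset> cball x r" for T
          using fT[OF that(1)] below[OF that(1) B that(2)] by blast
        show "cball x \<delta> \<in> balls" by (rule cball_in_balls[OF \<delta>(1)])
        show "cball x \<delta> \<subseteq> cball x r" using \<delta>(2) by (rule subset_cball)
      qed
    qed
  qed (rule order_refl)
  then obtain E \<mu> where E: "orthonormal_system m E" "\<mu> ` E = node_value ` nodes"
    "closed_span m E = orth_complement m (closed_span m W)"
    "op_restrict (schroedinger_op m C (horocycle_potential \<H> \<sigma>)) (closed_span m E) = diagonal_operator m E \<mu>" by blast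
  have L: "L_minus m \<H> = closed_span m E"
    unfolding L_minus_def L_plus_def E(3) W_def ..
  have "node_value ` nodes = {l + t | l t. l \<in> eigenvalues_below (cball b r) \<and> t \<in> \<sigma> ` \<H>}"
  proof (intro set_eqI iffI)
    fix y assume "y \<in> node_value ` nodes"
    then obtain S where S: "S \<in> nodes" "y = node_value S" by blast
    then obtain x where x: "x \<in> S" using ball_nonempty by (auto simp: nodes_def)
    obtain z where z: "S \<subseteq> cball z r" using S(1) unfolding nodes_def by blast
    have "eigenvalue S \<in> eigenvalues_below (cball z r)"
      using S(1) z unfolding eigenvalues_below_def nodes_def by blast
    then have "eigenvalue S \<in> eigenvalues_below (cball b r)" using eigenvalues_below_cong[of z r b] by simp
    moreover have "y = eigenvalue S + \<sigma> (cball x r)" using node_value_eq[OF S(1) x] S(2) pot by simp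
    ultimately show "y \<in> {l + t | l t. l \<in> eigenvalues_below (cball b r) \<and> t \<in> \<sigma> ` \<H>}"
      unfolding H by blast
  next
    fix y assume "y \<in> {l + t | l t. l \<in> eigenvalues_below (cball b r) \<and> t \<in> \<sigma> ` \<H>}"
    then obtain l z where l: "l \<in> eigenvalues_below (cball b r)" and y: "y = l + \<sigma> (cball z r)"
      unfolding H by blast
    from l have "l \<in> eigenvalues_below (cball z r)" using eigenvalues_below_cong[of z r b] by simp
    then obtain S where S: "S \<in> balls" "0 < diameter S" "S \<subseteq> cball z r" "l = eigenvalue S"
      unfolding eigenvalues_below_def by blast
    have node: "S \<in> nodes" using S(1-3) unfolding nodes_def by blast
    obtain x where x: "x \<in> S" using ball_nonempty[OF S(1)] by blast
    have "cball x r = cball z r" using S(3) x by (intro cball_recentre) blast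
    then have "y = node_value S" using node_value_eq[OF node x] pot y S(4) by simp
    with node show "y \<in> node_value ` nodes" by blast
  qed
  then show ?thesis
    using E(1,2,4) L unfolding schroedinger_minus_def by metis
qed

end

theorem lemma3p4:
  fixes m :: "'a::metric_space measure"
    and C :: "'a set \<Rightarrow> real"
    and \<H> :: "'a set set"
    and \<sigma> :: "'a set \<Rightarrow> real"
  assumes "homogeneous_ultrametric_measure_space m"
    and "homogeneous_choice_function C"
    and "horocycle \<H>"
  shows "(\<exists>S :: real set.
      (\<forall>B\<in>\<H>. spectrum m (L_ball m B) (laplacian_ball m C B) = complex_of_real ` S) \<and>
      spectrum m (L_minus m \<H>) (schroedinger_minus m C \<H> \<sigma>) =
        complex_of_real ` closure {s + r | s r. s \<in> S \<and> r \<in> \<sigma> ` \<H>}) \<and>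
    pure_point_spectrum m (L_minus m \<H>) (schroedinger_minus m C \<H> \<sigma>)"
proof -
  interpret homogeneous_hierarchical_laplacian m C
    using assms(1,2)
    by (simp add: homogeneous_hierarchical_laplacian_def homogeneous_hierarchical_laplacian_axioms_def)
  obtain r where r: "r > 0" and H: "\<H> = range (\<lambda>x. cball x r)"
    using horocycle_eq_cballs[OF assms(3)] by blast
  fix b :: 'a
  define S where "S = closure (eigenvalues_below (cball b r))"
  obtain E \<mu> where E: "orthonormal_system m E" "L_minus m \<H> = closed_span m E"
    "schroedinger_minus m C \<H> \<sigma> = diagonal_operator m E \<mu>"
    "\<mu> ` E = {l + t | l t. l \<in> eigenvalues_below (cball b r) \<and> t \<in> \<sigma> ` \<H>}"
    using schroedinger_minus_diagonal[OF H r] by blast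
  have "spectrum m (L_ball m B) (laplacian_ball m C B) = complex_of_real ` S" if "B \<in> \<H>" for B
  proof -
    obtain x where "B = cball x r" using \<open>B \<in> \<H>\<close> H by blast
    then show ?thesis
      using spectrum_laplacian_ball[OF r, of x] eigenvalues_below_cong[of x r b] by (simp add: S_def)
  qed
  moreover have "spectrum m (L_minus m \<H>) (schroedinger_minus m C \<H> \<sigma>) =
      complex_of_real ` closure {s + t | s t. s \<in> S \<and> t \<in> \<sigma> ` \<H>}"
    unfolding E(2,3) orthonormal_system.spectrum_diagonal_operator[OF E(1)] E(4) S_def closure_sums ..
  moreover have "pure_point_spectrum m (L_minus m \<H>) (schroedinger_minus m C \<H> \<sigma>)"
    unfolding E(2,3) by (rule orthonormal_system.diagonal_operator_pure_point[OF E(1)])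
  ultimately show ?thesis by blast
qed

end
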